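(* Let $p\in(1,\infty)$. Suppose that $(K,d,\{K_w\}_{w\in T},m)$ satisfies the basic geometric framework, that $m$ is Ahlfors regular with respect to $d$, that $K$ is $p$-conductively homogeneous, and that there exists $C_0\in(0,\infty)$ such that for any $(x,s)\in K\times(0,1]$, $$\inf\bigl\{\mathcal{N}_p(f)^p\bigm| f\in\mathcal{W}^p\cap C(K),\ f|_{B_d(x,s)}=1,\ \operatorname{supp}_K[f]\subseteq B_d(x,2s)\bigr\}\le C_0\,s^{d_{\mathrm f}-d_{\mathrm{w},p}}.$$ Then there exists $C\in(0,\infty)$ such that for any Borel set $E\subseteq K$, any open neighborhood $E'$ of the closure $\overline{E}$ in $K$ and any $f\in L^p(E',m|_{E'})$, $$\limsup_{r\downarrow0}\int_E\frac{1}{m(B_d(x,r))}\int_{B_d(x,r)}\frac{|f(x)-f(y)|^p}{r^{d_{\mathrm{w},p}}}\,m(dy)\,m(dx)\le C\limsup_{r\downarrow0}\liminf_{n\to\infty}\widetilde{\mathcal{E}}_{p,T_n[(E)_{d,r}]}^n(f).$$ Furthermore, with the same $C$, for any $f\in L^p(K,m)$, $$\sup_{r>0}\int_K\frac{1}{m(B_d(x,r))}\int_{B_d(x,r)}\frac{|f(x)-f(y)|^p}{r^{d_{\mathrm{w},p}}}\,m(dy)\,m(dx)\le C\,\mathcal{N}_p(f)^p.$$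
   Context: Tree. $(T,E_T)$ is a locally finite infinite undirected tree with root $\phi\in T$, every vertex having at least two neighbours. For $w\ne\phi$, $\pi(w)$ is the vertex preceding $w$ on the unique simple path from $\phi$ to $w$; $\pi(\phi)=\phi$. $S(w)=\{v:\pi(v)=w\}\setminus\{w\}$, $S^0(w)=\{w\}$, $S^1=S$, $S^{k+1}(w)=\bigcup_{v\in S(w)}S^k(v)$, $S^k(A)=\bigcup_{w\in A}S^k(w)$. $|w|=\min\{n\ge0:\pi^n(w)=\phi\}$, $T_n=\{w:|w|=n\}$. Partition. $K$ is a compact metrizable space without isolated points. A family $\{K_w\}_{w\in T}$ of non-empty compact subsets is a partition of $K$ parametrized by the tree if $K_\phi=K$; $\#K_w\ge2$ and $K_w=\bigcup_{v\in S(w)}K_v$ for all $w$; and $\bigcap_{n\ge0}K_{\omega_n}$ is a single point whenever $\omega_n\in T_n$ and $\omega_n=\pi(\omega_{n+1})$ for all $n\ge0$. For $A\subseteq T_n$: $E_n^*=\{\{v,w\}:v,w\in T_n,v\ne w,K_v\cap K_w\ne\emptyset\}$, $E_n^*(A)=\{\{v,w\}\in E_n^*:v,w\in A\}$; $d_n$ is the graph distance of $(T_n,E_n^* )$; for $w\in T_n$, $\Gamma_M(w)=\{v\in T_n:d_n(v,w)\le M\}$; $U_M(x;n)=\bigcup_{w\in T_n,x\in K_w}\bigcup_{v\in\Gamma_M(w)}K_v$; $T_n[U]=\{w\in T_n:K_w\cap U\ne\emptyset\}$ for $U\subseteq K$. The partition is minimal if $K_w\setminus\bigcup_{v\in T_{|w|}\setminus\{w\}}K_v\ne\emptyset$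 for all $w$, and uniformly finite if $\sup_w\#\Gamma_1(w)<\infty$. $B_d(x,r)=\{y:d(x,y)<r\}$, $(E)_{d,r}=\bigcup_{x\in E}B_d(x,r)$. Basic geometric framework. $K$ is connected, $\{K_w\}_{w\in T}$ is a partition of $K$ parametrized by the tree $(T,E_T)$ with root $\phi$, $d$ is a metric giving the topology of $K$ with $\operatorname{diam}(K,d)=1$, $m$ is a Borel probability measure on $K$, and there are $M_*\in\mathbb{N}$, $r_*\in(0,1)$ such that: (1) each $K_w$ is connected, $\{K_w\}$ is minimal and uniformly finite, and $\#S(w)\ge2$ for all $w\in T$. (2) There are $c_1,\dots,c_5>0$ with: $c_1r_*^{|w|}\le\operatorname{diam}(K_w,d)\le c_2r_*^{|w|}$ for $w\in T$; $B_d(x,c_3r_*^n)\subseteq U_{M_*}(x;n)\subseteq B_d(x,c_4r_*^n)$ for $n\in\mathbb{N}$, $x\in K$; for $n\in\mathbb{N}$, $w\in T_n$ there is $x\in K_w$ with $K_w\supseteq B_d(x,c_5r_*^n)$. (3) There are $m_1\in\mathbb{N}$, $\gamma_1,\gamma\in(0,1)$ with $m(K_w)\ge\gamma m(K_{\pi(w)})$ for $w\in T$ and $m(K_v)\le\gamma_1m(K_w)$ for $w\in T$, $v\in S^{m_1}(w)$; $m$ is volume doubling ($m(B_d(x,2s))\le C_{\mathrm D}m(B_d(x,s))<\infty$ for all $x\in K,s>0$, some constant $C_{\mathrm D}$); and $m(K_w)=\sum_{v\in S(w)}m(K_v)$ for $w\in T$. (4) There is $M_0\ge M_*$ such that for $w\in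 T$, $k\ge1$, $v\in S^k(w)$ and $v'\in\Gamma_{M_*}(v)\cap S^k(w)$ there are $l\le M_0$ and $(v_0,\dots,v_l)\in S^k(w)^{l+1}$ with $v_0=v$, $v_l=v'$ and $\{v_{j-1},v_j\}\in E^*_{|v|}$ for $1\le j\le l$. (5) $\pi(\Gamma_{M_*+1}(w))\subseteq\Gamma_{M_*}(\pi(w))$ for $w\in T$. Ahlfors regular: for some $Q>0$, $C\ge1$, $C^{-1}s^Q\le m(B_d(x,s))\le Cs^Q$ for $x\in K$, $s\in(0,2\operatorname{diam}(K,d))$. $p$-conductive homogeneity. For $A\subseteq T_n$, $f\in\mathbb{R}^A$: $\mathcal{E}_{p,A}^n(f)=\sum_{\{u,v\}\in E_n^*(A)}|f(u)-f(v)|^p$, $\mathcal{E}_p^n=\mathcal{E}_{p,T_n}^n$. For $A_0,A_1\subseteq A$, $\mathrm{cap}_p^n(A_0,A_1;A)=\inf\{\mathcal{E}_{p,A}^n(f):f\in\mathbb{R}^A,f|_{A_i}=i,\ i=0,1\}$. $\mathcal{E}_{M,p,k}=\sup_{w\in T}\mathrm{cap}_p^{|w|+k}(S^k(w),S^k(T_{|w|}\setminus\Gamma_M(w));T_{|w|+k})$. For $f\colon S^k(A)\to\mathbb{R}$ and $w\in A$, $P_{n,k}f(w)=\frac{1}{\sum_{v\in S^k(w)}m(K_v)}\sum_{v\in S^k(w)}f(v)m(K_v)$; $\sigma_{p,k}(A)=\sup_{f\colon S^k(A)\to\mathbb{R}}\mathcal{E}_{p,A}^n(P_{n,k}f)/\mathcal{E}_{p,S^k(A)}^{n+k}(f)$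 (with $0/0=0$). A collection $\{G_i\}_{i=1}^k$, $G_i\subseteq T_n$, is a covering of $(A,E_n^*(A))$ with covering numbers $(N_T,N_E)\in\mathbb{N}^2$ if $A=\bigcup_iG_i$, $\max_{x\in A}\#\{i:x\in G_i\}\le N_T$, and for every $\{u,v\}\in E_n^*(A)$ there are $l\le N_E$ and $w(1),\dots,w(l+1)\in A$ with $w(1)=u$, $w(l+1)=v$, $\{w(i),w(i+1)\}\in\bigcup_jE_n^*(G_j)$ for $1\le i\le l$. A family $\mathscr{J}$ of sets each contained in some $T_n$ is a covering system if for some $(N_T,N_E)$: $\sup_{A\in\mathscr{J}}\#A<\infty$; for all $w\in T$, $k\in\mathbb{N}$ there is a finite $\mathscr{N}\subseteq\{A\in\mathscr{J}:A\subseteq T_{|w|+k}\}$ that is a covering of $(S^k(w),E^*_{|w|+k}(S^k(w)))$ with covering numbers $(N_T,N_E)$; and for all $G\in\mathscr{J}$ with $G\subseteq T_n$ and $k\ge0$ there is a finite $\mathscr{N}\subseteq\{A\in\mathscr{J}:A\subseteq T_{n+k}\}$ that is a covering of $(S^k(G),E^*_{n+k}(S^k(G)))$ with these covering numbers. Put $\sigma_{p,k}^{\mathscr{J}}=\sup_{n\ge0}\max\{\sigma_{p,k}(A):A\in\mathscr{J},A\subseteq T_n\}$. $K$ is $p$-conductively homogeneous if $\sup_{k\ge0}\sigma_{p,k}^{\mathscr{J}}\mathcal{E}_{M_*,p,k}<\infty$ for some covering system $\mathscr{J}$. In that case (a known theorem of Kigami) there is a unique $\sigma_p\in(0,\infty)$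 such that for some $c_1',c_2'>0$ and covering system $\mathscr{J}$: $c_1'\sigma_p^{-k}\le\mathcal{E}_{M_*,p,k}\le c_2'\sigma_p^{-k}$ and $c_1'\sigma_p^k\le\sigma_{p,k}^{\mathscr{J}}\le c_2'\sigma_p^k$ for all $k\ge0$. Energies. For a Borel set $F\supseteq K_w$, $w\in T_n$, and $f\in L^1(F,m|_F)$, $P_nf(w)=\frac{1}{m(K_w)}\int_{K_w}f\,dm$. For $A\subseteq T_n$ and $f\in L^1(F,m|_F)$ with $F\supseteq\bigcup_{w\in A}K_w$, $\widetilde{\mathcal{E}}_{p,A}^n(f)=\sigma_p^n\mathcal{E}_{p,A}^n(P_nf)$ (in the local estimate, this and the integral over $B_d(x,r)$ are well defined for all small $r$ and then all large $n$). $\mathcal{N}_p(f)=(\sup_{n\ge0}\sigma_p^n\mathcal{E}_p^n(P_nf))^{1/p}$ for $f\in L^p(K,m)$; $\mathcal{W}^p=\{f\in L^p(K,m):\mathcal{N}_p(f)<\infty\}$. $d_{\mathrm f}$ is the Hausdorff dimension of $(K,d)$ and $d_{\mathrm{w},p}=d_{\mathrm f}+\log\sigma_p/\log r_*^{-1}$. $\operatorname{supp}_K[f]$ is the closure of $\{f\neq0\}$; continuous functions are identified with their $m$-classes. *)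

theory Defs
  imports "HOL-Probability.Probability"
begin

text \<open>Powers \<open>x\<^sup>a\<close> for \<open>x \<in> [0,\<infinity>]\<close>, meant for exponents \<open>a > 0\<close>.\<close>

definition ennreal_powr :: "ennreal \<Rightarrow> real \<Rightarrow> ennreal" where
  "ennreal_powr x a = (if x = \<infinity> then \<infinity> else ennreal (enn2real x powr a))"

text \<open>The exponent \<open>s\<close> is meant to be positive: \<^term>\<open>0 powr 0 = (0::real)\<close> would give the
  wrong value for \<open>s = 0\<close>. Boundedness of the covering sets is needed because
  \<^const>\<open>diameter\<close> is only meaningful for bounded sets.\<close>

definition hausdorff_premeasure :: "real \<Rightarrow> real \<Rightarrow> 'a::metric_space set \<Rightarrow> ennreal" where
  "hausdorff_premeasure s \<delta> A =
     (INF U \<in> {U :: nat \<Rightarrow> 'a set. A \<subseteq> (\<Union>i. U i) \<and> (\<forall>i. bounded (U i) \<and> diameter (U i) \<le> \<delta>)}.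
        (\<Sum>i. ennreal (diameter (U i) powr s)))"

definition hausdorff_measure :: "real \<Rightarrow> 'a::metric_space set \<Rightarrow> ennreal" where
  "hausdorff_measure s A = (SUP \<delta>\<in>{0<..}. hausdorff_premeasure s \<delta> A)"

definition hausdorff_dimension :: "'a::metric_space set \<Rightarrow> ennreal" where
  "hausdorff_dimension A = (INF s \<in> {s. 0 < s \<and> hausdorff_measure s A = 0}. ennreal s)"

definition in_Lp :: "'a measure \<Rightarrow> real \<Rightarrow> 'a set \<Rightarrow> ('a \<Rightarrow> real) \<Rightarrow> bool" where
  "in_Lp m p F f \<longleftrightarrow> set_borel_measurable m F f \<and> (\<integral>\<^sup>+x\<in>F. ennreal (\<bar>f x\<bar> powr p) \<partial>m) < \<infinity>"

definition ahlfors_regular :: "'a::metric_space measure \<Rightarrow> bool" where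
  "ahlfors_regular m \<longleftrightarrow>
     (\<exists>Q>0. \<exists>C\<ge>1. \<forall>x s. 0 < s \<and> s < 2 * diameter (UNIV :: 'a set) \<longrightarrow>
        s powr Q / C \<le> measure m (ball x s) \<and> measure m (ball x s) \<le> C * s powr Q)"

definition simple_path :: "('t \<Rightarrow> 't \<Rightarrow> bool) \<Rightarrow> 't \<Rightarrow> 't \<Rightarrow> 't list \<Rightarrow> bool" where
  "simple_path E v w xs \<longleftrightarrow>
     xs \<noteq> [] \<and> hd xs = v \<and> last xs = w \<and> distinct xs \<and> successively E xs"

definition is_tree :: "('t \<Rightarrow> 't \<Rightarrow> bool) \<Rightarrow> bool" where
  "is_tree E \<longleftrightarrow> symp E \<and> irreflp E \<and> (\<forall>v w. \<exists>!xs. simple_path E v w xs)"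

text \<open>
  The vertex set of the tree is the whole type \<open>'t\<close>, with adjacency relation \<open>E\<close>. The compact
  space carrying the partition is the whole type \<open>'a\<close>, and its metric is \<^const>\<open>dist\<close>;
  \<open>K w\<close> is the cell \<open>K\<^sub>w\<close>.
\<close>

locale tree_cells =
  fixes E :: "'t \<Rightarrow> 't \<Rightarrow> bool"
    and root :: 't
    and K :: "'t \<Rightarrow> 'a::metric_space set"
begin

definition parent :: "'t \<Rightarrow> 't" where
  "parent w = (if w = root then root else last (butlast (THE xs. simple_path E root w xs)))"

definition children :: "'t \<Rightarrow> 't set" where
  "children w = {v. parent v = w} - {w}"

primrec desc :: "nat \<Rightarrow> 't \<Rightarrow> 't set" where
  "desc 0 w = {w}"
| "desc (Suc k) w = (\<Union>v\<in>children w. desc k v)"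

definition Desc :: "nat \<Rightarrow> 't set \<Rightarrow> 't set" where
  "Desc k A = (\<Union>w\<in>A. desc k w)"

definition height :: "'t \<Rightarrow> nat" where
  "height w = (LEAST n. (parent ^^ n) w = root)"

definition level :: "nat \<Rightarrow> 't set" where
  "level n = {w. height w = n}"

definition is_partition :: bool where
  "is_partition \<longleftrightarrow>
     K root = UNIV \<and>
     (\<forall>w. K w \<noteq> {} \<and> compact (K w) \<and> (\<exists>x\<in>K w. \<exists>y\<in>K w. x \<noteq> y) \<and> K w = (\<Union>v\<in>children w. K v)) \<and>
     (\<forall>\<omega>. (\<forall>n. \<omega> n \<in> level n \<and> \<omega> n = parent (\<omega> (Suc n))) \<longrightarrow> (\<exists>x. (\<Inter>n. K (\<omega> n)) = {x}))"

text \<open>\<open>E\<^sub>n\<^sup>*(A)\<close>, as a set of unordered pairs; \<open>E\<^sub>n\<^sup>*\<close> itself is \<open>cell_edges n (level n)\<close>.\<close>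

definition cell_edges :: "nat \<Rightarrow> 't set \<Rightarrow> 't set set" where
  "cell_edges n A =
     {{v, w} |v w. v \<in> level n \<inter> A \<and> w \<in> level n \<inter> A \<and> v \<noteq> w \<and> K v \<inter> K w \<noteq> {}}"

definition cell_dist :: "nat \<Rightarrow> 't \<Rightarrow> 't \<Rightarrow> enat" where
  "cell_dist n v w =
     (INF xs \<in> {xs. xs \<noteq> [] \<and> set xs \<subseteq> level n \<and> hd xs = v \<and> last xs = w \<and>
                   successively (\<lambda>a b. {a, b} \<in> cell_edges n (level n)) xs}.
        enat (length xs - 1))"

definition nbhd :: "nat \<Rightarrow> 't \<Rightarrow> 't set" where
  "nbhd M w = {v \<in> level (height w). cell_dist (height w) v w \<le> enat M}"

definition cell_nbhd :: "nat \<Rightarrow> 'a \<Rightarrow> nat \<Rightarrow> 'a set" where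
  "cell_nbhd M x n = (\<Union>w\<in>{w \<in> level n. x \<in> K w}. \<Union>v\<in>nbhd M w. K v)"

definition meeting :: "nat \<Rightarrow> 'a set \<Rightarrow> 't set" where
  "meeting n U = {w \<in> level n. K w \<inter> U \<noteq> {}}"

definition minimal :: bool where
  "minimal \<longleftrightarrow> (\<forall>w. K w - (\<Union>v\<in>level (height w) - {w}. K v) \<noteq> {})"

definition uniformly_finite :: bool where
  "uniformly_finite \<longleftrightarrow> (\<exists>N. \<forall>w. finite (nbhd 1 w) \<and> card (nbhd 1 w) \<le> N)"

text \<open>The factor 1/2 accounts for every unordered pair arising from two ordered ones.
  Only the values of \<open>f\<close> on \<open>A\<close> matter, so that functions on \<open>A\<close> are represented by arbitrary
  functions on the set of all vertices.\<close>

definition energy :: "real \<Rightarrow> nat \<Rightarrow> 't set \<Rightarrow> ('t \<Rightarrow> real) \<Rightarrow> real" where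
  "energy p n A f = (\<Sum>(u, v)\<in>{(u, v). {u, v} \<in> cell_edges n A}. \<bar>f u - f v\<bar> powr p) / 2"

definition cap :: "real \<Rightarrow> nat \<Rightarrow> 't set \<Rightarrow> 't set \<Rightarrow> 't set \<Rightarrow> ennreal" where
  "cap p n A0 A1 A =
     (INF f \<in> {f. (\<forall>v\<in>A0. f v = 0) \<and> (\<forall>v\<in>A1. f v = 1)}. ennreal (energy p n A f))"

definition cap_const :: "nat \<Rightarrow> real \<Rightarrow> nat \<Rightarrow> ennreal" where
  "cap_const M p k =
     (SUP w. cap p (height w + k) (desc k w) (Desc k (level (height w) - nbhd M w))
               (level (height w + k)))"

definition is_covering :: "nat \<Rightarrow> 't set \<Rightarrow> 't set set \<Rightarrow> nat \<Rightarrow> nat \<Rightarrow> bool" where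
  "is_covering n A \<N> N\<^sub>T N\<^sub>E \<longleftrightarrow>
     finite \<N> \<and> (\<forall>G\<in>\<N>. G \<subseteq> level n) \<and> A = \<Union>\<N> \<and>
     (\<forall>x\<in>A. card {G \<in> \<N>. x \<in> G} \<le> N\<^sub>T) \<and>
     (\<forall>u v. {u, v} \<in> cell_edges n A \<longrightarrow>
        (\<exists>l\<le>N\<^sub>E. \<exists>w :: nat \<Rightarrow> 't. (\<forall>i\<in>{1..l+1}. w i \<in> A) \<and> w 1 = u \<and> w (l+1) = v \<and>
            (\<forall>i\<in>{1..l}. {w i, w (i+1)} \<in> (\<Union>G\<in>\<N>. cell_edges n G))))"

definition covering_system :: "'t set set \<Rightarrow> bool" where
  "covering_system \<J> \<longleftrightarrow>
     (\<forall>A\<in>\<J>. \<exists>n. A \<subseteq> level n) \<and>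
     (\<exists>N. \<forall>A\<in>\<J>. finite A \<and> card A \<le> N) \<and>
     (\<exists>N\<^sub>T\<ge>1. \<exists>N\<^sub>E\<ge>1.
        (\<forall>w. \<forall>k\<ge>1. \<exists>\<N>\<subseteq>{A \<in> \<J>. A \<subseteq> level (height w + k)}.
            is_covering (height w + k) (desc k w) \<N> N\<^sub>T N\<^sub>E) \<and>
        (\<forall>n. \<forall>G\<in>\<J>. G \<subseteq> level n \<longrightarrow> (\<forall>k. \<exists>\<N>\<subseteq>{A \<in> \<J>. A \<subseteq> level (n + k)}.
            is_covering (n + k) (Desc k G) \<N> N\<^sub>T N\<^sub>E)))"

end

locale measured_tree_cells = tree_cells E root K
  for E :: "'t \<Rightarrow> 't \<Rightarrow> bool" and root :: 't and K :: "'t \<Rightarrow> 'a::metric_space set" +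
  fixes m :: "'a measure"
    and Mstar :: nat
    and rstar :: real
begin

definition discrete_avg :: "nat \<Rightarrow> ('t \<Rightarrow> real) \<Rightarrow> 't \<Rightarrow> real" where
  "discrete_avg k f w =
     (\<Sum>v\<in>desc k w. f v * measure m (K v)) / (\<Sum>v\<in>desc k w. measure m (K v))"

text \<open>\<open>\<sigma>\<^sub>p\<^sub>,\<^sub>k(A)\<close> for \<open>A \<subseteq> T\<^sub>n\<close>. In \<^typ>\<open>ennreal\<close>, \<open>0 / 0 = 0\<close> and \<open>a / 0 = \<infinity>\<close> for \<open>a > 0\<close>.\<close>

definition sigma_set :: "real \<Rightarrow> nat \<Rightarrow> nat \<Rightarrow> 't set \<Rightarrow> ennreal" where
  "sigma_set p n k A =
     (SUP f. ennreal (energy p n A (discrete_avg k f)) / ennreal (energy p (n + k) (Desc k A) f))"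

definition sigma_sys :: "'t set set \<Rightarrow> real \<Rightarrow> nat \<Rightarrow> ennreal" where
  "sigma_sys \<J> p k = (SUP n. SUP A\<in>{A \<in> \<J>. A \<subseteq> level n}. sigma_set p n k A)"

definition conductively_homogeneous :: "real \<Rightarrow> bool" where
  "conductively_homogeneous p \<longleftrightarrow>
     (\<exists>\<J>. covering_system \<J> \<and> (SUP k. sigma_sys \<J> p k * cap_const Mstar p k) < \<infinity>)"

text \<open>Uniqueness of \<open>s\<close> is forced by the bounds on \<^const>\<open>cap_const\<close>, which do not involve
  \<open>\<J>\<close>; existence is a theorem of Kigami for conductively homogeneous spaces, so the description
  is only meaningful for these.\<close>

definition sigma :: "real \<Rightarrow> real" where
  "sigma p = (THE s. 0 < s \<and>
     (\<exists>c1>0. \<exists>c2>0. \<exists>\<J>. covering_system \<J> \<and>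
        (\<forall>k. ennreal (c1 / s ^ k) \<le> cap_const Mstar p k \<and>
             cap_const Mstar p k \<le> ennreal (c2 / s ^ k) \<and>
             ennreal (c1 * s ^ k) \<le> sigma_sys \<J> p k \<and>
             sigma_sys \<J> p k \<le> ennreal (c2 * s ^ k))))"

text \<open>For a function given only on a subset \<open>F\<close> of the space, the values of \<open>f\<close> outside \<open>F\<close>
  are arbitrary; \<open>cell_avg f w\<close> does not depend on them if \<open>K w \<subseteq> F\<close>.\<close>

definition cell_avg :: "('a \<Rightarrow> real) \<Rightarrow> 't \<Rightarrow> real" where
  "cell_avg f w = (1 / measure m (K w)) * (LINT x:K w|m. f x)"

definition scaled_energy :: "real \<Rightarrow> nat \<Rightarrow> 't set \<Rightarrow> ('a \<Rightarrow> real) \<Rightarrow> real" where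
  "scaled_energy p n A f = sigma p ^ n * energy p n A (cell_avg f)"

definition Np :: "real \<Rightarrow> ('a \<Rightarrow> real) \<Rightarrow> ennreal" where
  "Np p f = ennreal_powr (SUP n. ennreal (scaled_energy p n (level n) f)) (1 / p)"

definition Wp :: "real \<Rightarrow> ('a \<Rightarrow> real) set" where
  "Wp p = {f. in_Lp m p UNIV f \<and> Np p f < \<infinity>}"

definition df :: real where
  "df = enn2real (hausdorff_dimension (space m))"

definition dw :: "real \<Rightarrow> real" where
  "dw p = df + ln (sigma p) / ln (1 / rstar)"

end

locale basic_geometric_framework = measured_tree_cells E root K m Mstar rstar
  for E :: "'t \<Rightarrow> 't \<Rightarrow> bool" and root :: 't and K :: "'t \<Rightarrow> 'a::metric_space set"
    and m :: "'a measure" and Mstar :: nat and rstar :: real +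
  assumes tree: "is_tree E"
    and infinite_tree: "infinite (UNIV :: 't set)"
    and locally_finite: "finite {v. E w v}"
    and two_neighbours: "2 \<le> card {v. E w v}"
    and compact_space: "compact (UNIV :: 'a set)"
    and connected_space: "connected (UNIV :: 'a set)"
    and no_isolated_points: "(x :: 'a) islimpt UNIV"
    and diameter_space: "diameter (UNIV :: 'a set) = 1"
    and partition: "is_partition"
    and prob: "prob_space m"
    and borel_sets: "sets m = sets borel"
    and Mstar: "1 \<le> Mstar"
    and rstar: "0 < rstar" "rstar < 1"
    and connected_cells: "connected (K w)"
    and minimal: "minimal"
    and uniformly_finite: "uniformly_finite"
    and children_ge_2: "2 \<le> card (children w)"
    and cell_geometry:
      "\<exists>c1>0. \<exists>c2>0. \<exists>c3>0. \<exists>c4>0. \<exists>c5>0.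
         (\<forall>w. c1 * rstar ^ height w \<le> diameter (K w) \<and> diameter (K w) \<le> c2 * rstar ^ height w) \<and>
         (\<forall>n\<ge>1. \<forall>x. ball x (c3 * rstar ^ n) \<subseteq> cell_nbhd Mstar x n \<and>
                    cell_nbhd Mstar x n \<subseteq> ball x (c4 * rstar ^ n)) \<and>
         (\<forall>n\<ge>1. \<forall>w\<in>level n. \<exists>x\<in>K w. ball x (c5 * rstar ^ n) \<subseteq> K w)"
    and measure_cells:
      "\<exists>m1\<ge>1. \<exists>\<gamma>1\<in>{0<..<1}. \<exists>\<gamma>\<in>{0<..<1}.
         (\<forall>w. \<gamma> * measure m (K (parent w)) \<le> measure m (K w)) \<and>
         (\<forall>w. \<forall>v\<in>desc m1 w. measure m (K v) \<le> \<gamma>1 * measure m (K w))"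
    and volume_doubling:
      "\<exists>C. \<forall>x. \<forall>s>0. measure m (ball x (2 * s)) \<le> C * measure m (ball x s)"
    and measure_children: "measure m (K w) = (\<Sum>v\<in>children w. measure m (K v))"
    and chains:
      "\<exists>M0\<ge>Mstar. \<forall>w. \<forall>k\<ge>1. \<forall>v\<in>desc k w. \<forall>v'\<in>nbhd Mstar v \<inter> desc k w.
         \<exists>l\<le>M0. \<exists>vs :: nat \<Rightarrow> 't. (\<forall>j\<le>l. vs j \<in> desc k w) \<and> vs 0 = v \<and> vs l = v' \<and>
           (\<forall>j\<in>{1..l}. {vs (j - 1), vs j} \<in> cell_edges (height v) (level (height v)))"
    and parent_nbhd: "parent ` nbhd (Mstar + 1) w \<subseteq> nbhd Mstar (parent w)"

end

theory Submission
  imports Defs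
begin

text \<open>
  Let \<open>n\<close> be the level whose cells have size about \<open>r\<close>. If \<open>x\<close> lies in the cell \<open>K w\<close> of level \<open>n\<close>, then the
  ball of radius \<open>r\<close> around \<open>x\<close> is covered by the cells at most \<open>Suc Mstar\<close> steps away from \<open>w\<close>. Writing \<open>f\<^sub>w\<close> for the
  mean of \<open>f\<close> on \<open>K w\<close>, one splits \<open>f x - f y\<close> into \<open>f x - f\<^sub>w\<close>, \<open>f\<^sub>w - f\<^sub>v\<close> and \<open>f\<^sub>v - f y\<close>, where \<open>K v\<close> contains \<open>y\<close>.
  Both kinds of terms are controlled by energies of much finer levels on the descendants of a bounded
  neighbourhood of \<open>w\<close>, and such neighbourhoods overlap boundedly often (\<open>ball_energy_estimate\<close>).

  \<^item> Means of adjacent cells: the definition of \<open>\<sigma>\<^sub>p\<^sub>,\<^sub>k\<close> bounds the energy of averages on a set \<open>G\<close> of the covering system.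
    Since \<open>G\<close> may be disconnected, the bound is localized by discarding all but one
    component (\<open>component_estimate\<close>, \<open>edge_estimate\<close>).
  \<^item> Oscillation on a cell: telescoping over the generations below \<open>w\<close> reduces it to increments between means of
    parents and children. The increments of the \<open>j\<close>-th generation contribute a multiple of
    \<open>(mscale / sigma p) ^ j = rstar powr (j * dw p)\<close>, which is summable because the walk dimension is positive
    (\<open>discrete_poincare\<close>). As cell averages converge to \<open>f\<close> in \<open>L\<^sup>1\<close>, hence almost everywhere along
    a subsequence, Fatou's lemma transfers the discrete inequality to \<open>f\<close> (\<open>poincare\<close>).

  The walk dimension is at least \<open>p\<close>: a truncated distance function is a competitor for the capacities, which
  are comparable with the powers of \<open>1 / sigma p\<close> (\<open>cap_const_upper\<close>, \<open>mscale_less_sigma\<close>).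

  The constant \<open>sigma p\<close> is a definite description, so its existence and uniqueness are part of the argument
  (\<open>ex_scaling_factor\<close>, \<open>scaling_factor_unique\<close>). Conductive homogeneity together with an elementary
  lower bound says that the capacities \<open>e\<^sub>k\<close> and the constants \<open>\<sigma>\<^sub>p\<^sub>,\<^sub>k\<close> are reciprocal up to constants. The latter are submultiplicative by
  iterating averages; the former are submultiplicative because a capacity function can be refined by a partition of
  unity made of capacity functions (\<open>refinement_energy\<close>). Hence both are comparable with geometric
  sequences (\<open>quasi_multiplicative_geometric\<close>).

  Finally the exponent of Ahlfors regularity is the Hausdorff dimension (\<open>df_eq_Q\<close>), which links the
  measure of the cells with the walk dimension.
\<close>

section \<open>The rooted tree\<close>

context basic_geometric_framework
begin

definition path :: "'t \<Rightarrow> 't list" where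
  "path w = (THE xs. simple_path E root w xs)"

lemma simple_path_unique: "simple_path E v w xs \<Longrightarrow> simple_path E v w ys \<Longrightarrow> xs = ys"
  using tree unfolding is_tree_def by blast

lemma path: "simple_path E root w (path w)"
  using tree unfolding is_tree_def path_def by (metis (no_types, lifting) theI')

lemma path_eqI: "simple_path E root w xs \<Longrightarrow> path w = xs"
  using path simple_path_unique by blast

lemma path_root: "path root = [root]"
  by (rule path_eqI) (simp add: simple_path_def)

lemma parent_eq: "parent w = (if w = root then root else last (butlast (path w)))"
  by (simp add: parent_def path_def)

lemma parent_root [simp]: "parent root = root"
  by (simp add: parent_def)

lemma path_split: 
  assumes "w \<noteq> root"
  obtains ys where "path w = ys @ [w]" "ys \<noteq> []" "hd ys = root"
proof -
  have p: "path w \<noteq> []" "hd (path w) = root" "last (path w) = w"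
    using path[of w] by (auto simp: simple_path_def)
  define ys where "ys = butlast (path w)"
  have 1: "path w = ys @ [w]" using p unfolding ys_def by (metis append_butlast_last_id)
  have 2: "ys \<noteq> []" using p 1 assms by auto
  have 3: "hd ys = root" using p(2) 1 2 by (simp add: hd_append)
  show ?thesis using that 1 2 3 by blast
qed

text \<open>Deleting the last vertex of the path to \<open>w\<close> leaves the path to the parent of \<open>w\<close>, by uniqueness of
  simple paths. Lengths of paths therefore count generations.\<close>

lemma path_parent:
  assumes "w \<noteq> root"
  shows "path w = path (parent w) @ [w]" and "E (parent w) w"
proof -
  obtain ys where ys: "path w = ys @ [w]" "ys \<noteq> []" "hd ys = root" using path_split[OF assms] .
  have pw: "parent w = last ys" using assms ys by (simp add: parent_eq)
  have s: "distinct (ys @ [w])" "successively E (ys @ [w])"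
    using path[of w] ys by (auto simp: simple_path_def)
  have "simple_path E root (parent w) ys"
    using s ys pw by (auto simp: simple_path_def successively_append_iff)
  then show "path w = path (parent w) @ [w]" using path_eqI ys by metis
  show "E (parent w) w" using s ys pw by (auto simp: successively_append_iff)
qed

lemma length_path_parent: "w \<noteq> root \<Longrightarrow> length (path w) = Suc (length (path (parent w)))"
  using path_parent(1)[of w] by (metis length_append_singleton)

lemma path_nonempty: "path w \<noteq> []"
  using path[of w] by (auto simp: simple_path_def)

lemma ancestor_root_iff: "(parent ^^ n) w = root \<longleftrightarrow> length (path w) \<le> Suc n"
proof (induction n arbitrary: w)
  case 0
  show ?case
  proof (cases "w = root")
    case False
    then show ?thesis using length_path_parent[of w] path_nonempty[of "parent w"] by (cases "path (parent w)") auto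
  qed (simp add: path_root)
next
  case (Suc n)
  show ?case
  proof (cases "w = root")
    case True
    then show ?thesis using Suc[of root] by (simp add: path_root funpow_swap1 del: funpow.simps) (simp add: funpow_swap1 path_root)
  next
    case False
    then show ?thesis using Suc[of "parent w"] length_path_parent[of w] by (simp add: funpow_swap1)
  qed
qed

lemma height_eq: "height w = length (path w) - 1"
  unfolding height_def ancestor_root_iff using path_nonempty[of w]
  by (intro Least_equality) auto

lemma height_root [simp]: "height root = 0"
  by (simp add: height_eq path_root)

lemma height_parent: "w \<noteq> root \<Longrightarrow> height w = Suc (height (parent w))"
  using length_path_parent[of w] path_nonempty[of "parent w"] by (cases "path (parent w)") (auto simp: height_eq)

lemma height_eq_0_iff [simp]: "height w = 0 \<longleftrightarrow> w = root"
  using height_parent[of w] by (cases "w = root") auto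

lemma height_parent_diff: "height (parent w) = height w - 1"
  using height_parent[of w] by (cases "w = root") auto

lemma height_ancestor: "height ((parent ^^ k) w) = height w - k"
  by (induction k) (auto simp: height_parent_diff)

lemma children_iff: "v \<in> children w \<longleftrightarrow> v \<noteq> root \<and> parent v = w"
  unfolding children_def using height_parent[of v] by auto

lemma height_children: "v \<in> children w \<Longrightarrow> height v = Suc (height w)"
  using height_parent[of v] by (auto simp: children_iff)

lemma desc_iff: "v \<in> desc k w \<longleftrightarrow> height v = height w + k \<and> (parent ^^ k) v = w"
proof (induction k arbitrary: w)
  case (Suc k)
  have "v \<in> desc (Suc k) w \<longleftrightarrow> (\<exists>u. u \<noteq> root \<and> parent u = w \<and> height v = height u + k \<and> (parent ^^ k) v = u)"
    by (auto simp: Suc children_iff)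
  also have "\<dots> \<longleftrightarrow> height v = height w + Suc k \<and> (parent ^^ Suc k) v = w"
  proof
    assume "\<exists>u. u \<noteq> root \<and> parent u = w \<and> height v = height u + k \<and> (parent ^^ k) v = u"
    then show "height v = height w + Suc k \<and> (parent ^^ Suc k) v = w"
      using height_parent by auto
  next
    assume h: "height v = height w + Suc k \<and> (parent ^^ Suc k) v = w"
    have "height ((parent ^^ k) v) = Suc (height w)" using h by (simp add: height_ancestor)
    then show "\<exists>u. u \<noteq> root \<and> parent u = w \<and> height v = height u + k \<and> (parent ^^ k) v = u"
      using h by (intro exI[of _ "(parent ^^ k) v"]) auto
  qed
  finally show ?case .
qed auto

lemma level_iff [simp]: "w \<in> level n \<longleftrightarrow> height w = n"
  by (simp add: level_def)

lemma Desc_iff: "v \<in> Desc k A \<longleftrightarrow> k \<le> height v \<and> (parent ^^ k) v \<in> A"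
  unfolding Desc_def using height_ancestor[of k v] by (auto simp: desc_iff)

lemma desc_self_ancestor: "k \<le> height v \<Longrightarrow> v \<in> desc k ((parent ^^ k) v)"
  by (simp add: desc_iff height_ancestor)

lemma level_desc_root: "level n = desc n root"
proof (intro set_eqI)
  fix v
  have "height v = n \<Longrightarrow> (parent ^^ n) v = root" using height_ancestor[of n v] by simp
  then show "v \<in> level n \<longleftrightarrow> v \<in> desc n root" by (auto simp: desc_iff)
qed

lemma desc_add: "desc (j + k) w = (\<Union>v\<in>desc j w. desc k v)"
proof (intro set_eqI iffI)
  fix v assume v: "v \<in> desc (j + k) w"
  have "(parent ^^ k) v \<in> desc j w" 
    using v by (auto simp: desc_iff height_ancestor funpow_add)
  moreover have "v \<in> desc k ((parent ^^ k) v)"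
    using v by (intro desc_self_ancestor) (auto simp: desc_iff)
  ultimately show "v \<in> (\<Union>v\<in>desc j w. desc k v)" by blast
qed (auto simp: desc_iff funpow_add)

lemma finite_children: "finite (children w)"
proof (rule finite_subset)
  show "children w \<subseteq> {v. E w v}" using path_parent(2) by (auto simp: children_iff)
qed (rule locally_finite)

lemma finite_desc: "finite (desc k w)"
  by (induction k arbitrary: w) (auto simp: finite_children)

lemma finite_level: "finite (level n)"
  by (simp add: level_desc_root finite_desc)

lemma children_nonempty: "children w \<noteq> {}"
  using children_ge_2[of w] by auto

lemma desc_nonempty: "desc k w \<noteq> {}"
  using children_nonempty by (induction k arbitrary: w) fastforce+

lemma desc_disjoint: "v \<noteq> w \<Longrightarrow> desc k v \<inter> desc k w = {}"
  by (auto simp: desc_iff)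

lemma Desc_level: "A \<subseteq> level n \<Longrightarrow> Desc k A \<subseteq> level (n + k)"
  unfolding Desc_def by (fastforce simp: desc_iff)

lemma Desc_mono: "A \<subseteq> B \<Longrightarrow> Desc k A \<subseteq> Desc k B"
  unfolding Desc_def by auto

lemma Desc_Desc: "Desc k (Desc j A) = Desc (j + k) A"
  unfolding Desc_def by (simp add: desc_add)

section \<open>Cells, adjacency and neighbourhoods\<close>

lemma K_root: "K root = UNIV"
  and K_nonempty: "K w \<noteq> {}"
  and K_compact: "compact (K w)"
  and K_children: "K w = (\<Union>v\<in>children w. K v)"
proof -
  note * = partition[unfolded is_partition_def]
  note w = *[THEN conjunct2, THEN conjunct1, THEN spec, of w]
  show "K root = UNIV" by (rule *[THEN conjunct1])
  show "K w \<noteq> {}" by (rule w[THEN conjunct1])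
  show "compact (K w)" by (rule w[THEN conjunct2, THEN conjunct1])
  show "K w = (\<Union>v\<in>children w. K v)" by (rule w[THEN conjunct2, THEN conjunct2, THEN conjunct2])
qed

lemma K_closed: "closed (K w)"
  using K_compact compact_imp_closed by blast

lemma K_desc: "K w = (\<Union>v\<in>desc k w. K v)"
proof (induction k arbitrary: w)
  case (Suc k)
  have "K w = (\<Union>v\<in>children w. K v)" by (rule K_children)
  also have "\<dots> = (\<Union>v\<in>children w. \<Union>u\<in>desc k v. K u)" by (intro SUP_cong refl Suc)
  finally show ?case unfolding desc.simps UN_UN_flatten .
qed simp

lemma K_level: "(\<Union>v\<in>level n. K v) = UNIV"
  using K_desc[of root n] K_root level_desc_root by simp

lemma K_mono_desc: "v \<in> desc k w \<Longrightarrow> K v \<subseteq> K w"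
  using K_desc[of w k] by blast

lemma K_parent: "K v \<subseteq> K (parent v)"
  using K_children[of "parent v"] K_root by (cases "v = root") (auto simp: children_iff)

lemma K_ancestor: "K v \<subseteq> K ((parent ^^ k) v)"
  by (induction k) (use K_parent in auto)

text \<open>Two vertices of the same level are adjacent when their cells meet. Unlike the edge relation,
  adjacency is reflexive, so that paths may pause and projecting a path to a
  coarser level gives a path of the same length.\<close>

definition adj :: "'t \<Rightarrow> 't \<Rightarrow> bool" where
  "adj u v \<longleftrightarrow> height u = height v \<and> K u \<inter> K v \<noteq> {}"

lemma adj_refl [simp]: "adj u u"
  using K_nonempty by (simp add: adj_def)

lemma adj_sym: "adj u v \<Longrightarrow> adj v u"
  by (auto simp: adj_def)

lemma adj_parent: "adj u v \<Longrightarrow> adj (parent u) (parent v)"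
  using K_parent[of u] K_parent[of v] by (auto simp: adj_def height_parent_diff)

lemma adj_ancestor: "adj u v \<Longrightarrow> adj ((parent ^^ k) u) ((parent ^^ k) v)"
  by (induction k) (use adj_parent in auto)

lemma cell_edges_iff:
  "{u, v} \<in> cell_edges n A \<longleftrightarrow> u \<in> A \<and> v \<in> A \<and> height u = n \<and> u \<noteq> v \<and> adj u v"
proof
  show "{u, v} \<in> cell_edges n A \<Longrightarrow> u \<in> A \<and> v \<in> A \<and> height u = n \<and> u \<noteq> v \<and> adj u v"
    unfolding cell_edges_def adj_def by (auto simp: doubleton_eq_iff)
  show "u \<in> A \<and> v \<in> A \<and> height u = n \<and> u \<noteq> v \<and> adj u v \<Longrightarrow> {u, v} \<in> cell_edges n A"
    unfolding cell_edges_def adj_def by (intro CollectI exI[of _ u] exI[of _ v]) simp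
qed

primrec near :: "nat \<Rightarrow> 't \<Rightarrow> 't set" where
  "near 0 w = {w}"
| "near (Suc M) w = {v. \<exists>u\<in>near M w. adj u v}"

lemma height_near: "v \<in> near M w \<Longrightarrow> height v = height w"
  by (induction M arbitrary: v) (auto simp: adj_def)

lemma near_Suc_subset: "near M w \<subseteq> near (Suc M) w"
  by (simp, blast intro: adj_refl)

lemma near_mono: "M \<le> M' \<Longrightarrow> near M w \<subseteq> near M' w"
  by (rule lift_Suc_mono_le[of "\<lambda>M. near M w"]) (use near_Suc_subset in auto)

lemma near_self [simp]: "w \<in> near M w"
  using near_mono[of 0 M w] by auto

lemma near_one: "near 1 w = {v. adj w v}"
  by simp

lemma near_trans: "u \<in> near M w \<Longrightarrow> v \<in> near N u \<Longrightarrow> v \<in> near (M + N) w"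
  by (induction N arbitrary: v) auto

lemma near_sym: "v \<in> near M w \<Longrightarrow> w \<in> near M v"
proof (induction M arbitrary: v)
  case (Suc M)
  then obtain u where u: "u \<in> near M w" "adj u v" by auto
  have "u \<in> near 1 v" using adj_sym u(2) by (simp add: near_one)
  then show ?case using near_trans[of u 1 v w M] Suc.IH[OF u(1)] by simp
qed simp

lemma near_ancestor: "v \<in> near M w \<Longrightarrow> (parent ^^ k) v \<in> near M ((parent ^^ k) w)"
proof (induction M arbitrary: v)
  case (Suc M)
  then show ?case using adj_ancestor by (auto; blast)
qed simp

lemma near_path:
  assumes "v \<in> near M w"
  shows "\<exists>xs. xs \<noteq> [] \<and> set xs \<subseteq> level (height w) \<and> hd xs = w \<and> last xs = v \<and>
     successively (\<lambda>a b. {a, b} \<in> cell_edges (height w) (level (height w))) xs \<and> length xs \<le> Suc M"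
  using assms
proof (induction M arbitrary: v)
  case 0
  then show ?case by (intro exI[of _ "[w]"]) auto
next
  case (Suc M)
  then obtain u where u: "u \<in> near M w" "adj u v" by auto
  obtain xs where xs: "xs \<noteq> []" "set xs \<subseteq> level (height w)" "hd xs = w" "last xs = u"
     "successively (\<lambda>a b. {a, b} \<in> cell_edges (height w) (level (height w))) xs" "length xs \<le> Suc M"
    using Suc.IH[OF u(1)] by blast
  show ?case
  proof (cases "u = v")
    case True
    then show ?thesis using xs by (intro exI[of _ xs]) auto
  next
    case False
    have h: "height u = height w" "height v = height w"
      using height_near[OF u(1)] height_near[OF Suc.prems] by auto
    show ?thesis using xs h u(2) False
      by (intro exI[of _ "xs @ [v]"]) (auto simp: successively_append_iff cell_edges_iff)
  qed
qed

lemma path_near: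
  assumes "xs \<noteq> []" "successively (\<lambda>a b. {a, b} \<in> cell_edges n A) xs"
  shows "last xs \<in> near (length xs - 1) (hd xs)"
  using assms
proof (induction xs rule: rev_nonempty_induct)
  case (snoc x xs)
  then have "last xs \<in> near (length xs - 1) (hd xs)" "adj (last xs) x"
    by (auto simp: successively_append_iff cell_edges_iff)
  then have "x \<in> near (Suc (length xs - 1)) (hd xs)" by auto
  moreover have "Suc (length xs - 1) = length xs" using snoc by (cases xs) auto
  ultimately show ?case using snoc by (auto simp: hd_append)
qed simp

lemma nbhd_eq_near: "nbhd M w = near M w"
proof (intro set_eqI iffI)
  fix v assume v: "v \<in> near M w"
  obtain ys where ys: "ys \<noteq> []" "set ys \<subseteq> level (height v)" "hd ys = v" "last ys = w"
     "successively (\<lambda>a b. {a, b} \<in> cell_edges (height v) (level (height v))) ys" "length ys \<le> Suc M"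
    using near_path[OF near_sym[OF v]] by blast
  have h: "height v = height w" using height_near[OF v] .
  have "cell_dist (height w) v w \<le> enat (length ys - 1)"
    unfolding cell_dist_def using ys h by (intro INF_lower) auto
  also have "\<dots> \<le> enat M" using ys by simp
  finally show "v \<in> nbhd M w" using h by (simp add: nbhd_def)
next
  fix v assume v: "v \<in> nbhd M w"
  then have h: "height v = height w" and d: "cell_dist (height w) v w \<le> enat M" by (auto simp: nbhd_def)
  have "cell_dist (height w) v w < enat (Suc M)" using d by (simp add: le_less_trans)
  then obtain xs where xs: "xs \<noteq> []" "hd xs = v" "last xs = w"
    "successively (\<lambda>a b. {a, b} \<in> cell_edges (height w) (level (height w))) xs" 
    "enat (length xs - 1) < enat (Suc M)"
    unfolding cell_dist_def INF_less_iff by auto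
  have "w \<in> near (length xs - 1) v" using path_near[OF xs(1,4)] xs by simp
  then have "w \<in> near M v" using near_mono[of "length xs - 1" M v] xs(5) by auto
  then show "v \<in> near M w" by (rule near_sym)
qed

text \<open>Each passage to the parents turns a chain of \<open>Suc Mstar\<close> steps into one of \<open>Mstar\<close> steps and does not
  lengthen the remaining steps, so one step is gained per generation.\<close>

lemma near_contract:
  assumes "v \<in> near (Mstar + j) w"
  shows "(parent ^^ j) v \<in> near Mstar ((parent ^^ j) w)"
  using assms
proof (induction j arbitrary: v w)
  case (Suc j)
  have *: "parent v \<in> near (Mstar + i) (parent w)" if "v \<in> near (Mstar + Suc i) w" for i v
    using that
  proof (induction i arbitrary: v)
    case 0
    then have "v \<in> nbhd (Mstar + 1) w" by (simp add: nbhd_eq_near)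
    then show ?case using parent_nbhd[of w] by (auto simp: nbhd_eq_near simp del: near.simps)
  next
    case (Suc i)
    then obtain u where "u \<in> near (Mstar + Suc i) w" "adj u v" by auto
    then show ?case using Suc.IH[of u] adj_parent[of u v] by auto
  qed
  have "parent v \<in> near (Mstar + j) (parent w)" using * Suc.prems by blast
  then have "(parent ^^ j) (parent v) \<in> near Mstar ((parent ^^ j) (parent w))" by (rule Suc.IH)
  then show ?case by (simp add: funpow_swap1)
qed simp

lemma finite_near: "finite (near M w)"
  by (rule finite_subset[OF _ finite_level[of "height w"]]) (use height_near in auto)

lemma card_near_bounded: "\<exists>D\<ge>1. \<forall>w. card (near M w) \<le> D"
proof -
  obtain N where N: "\<And>w. card (near 1 w) \<le> N"
    using uniformly_finite unfolding uniformly_finite_def nbhd_eq_near by blast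
  have "card (near M w) \<le> N ^ M" for w
  proof (induction M)
    case (Suc M)
    have "near (Suc M) w = (\<Union>u\<in>near M w. near 1 u)" by auto
    then have "card (near (Suc M) w) \<le> (\<Sum>u\<in>near M w. card (near 1 u))"
      using card_UN_le[OF finite_near] by metis
    also have "\<dots> \<le> (\<Sum>u\<in>near M w. N)" by (intro sum_mono N)
    also have "\<dots> \<le> N ^ M * N" using Suc by simp
    finally show ?case by (simp add: mult.commute)
  qed simp
  then show ?thesis by (intro exI[of _ "max 1 (N ^ M)"]) (auto simp: le_max_iff_disj)
qed

text \<open>A connected union of cells of one level has a connected adjacency graph: the cells reachable
  from a given one and the remaining ones have disjoint closed unions.\<close>

lemma reachable_of_connected:
  assumes F: "finite F" "F \<subseteq> level n" and c: "connected (\<Union>v\<in>F. K v)" and a: "a \<in> F" and b: "b \<in> F"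
  shows "(a, b) \<in> {(u, v). u \<in> F \<and> v \<in> F \<and> adj u v}\<^sup>*"
proof -
  define R where "R = {(u, v). u \<in> F \<and> v \<in> F \<and> adj u v}"
  define C where "C = {x \<in> F. (a, x) \<in> R\<^sup>*}"
  have cl: "closed (\<Union>v\<in>C. K v)" "closed (\<Union>v\<in>F-C. K v)"
    using F K_closed by (auto intro!: closed_UN simp: C_def)
  have u: "(\<Union>v\<in>F. K v) \<subseteq> (\<Union>v\<in>C. K v) \<union> (\<Union>v\<in>F-C. K v)" by auto
  have d: "(\<Union>v\<in>C. K v) \<inter> (\<Union>v\<in>F-C. K v) \<inter> (\<Union>v\<in>F. K v) = {}"
  proof (rule ccontr)
    assume "\<not> ?thesis"
    then obtain x u v where x: "u \<in> C" "v \<in> F - C" "x \<in> K u" "x \<in> K v" by blast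
    have "(u, v) \<in> R" using x F by (auto simp: R_def C_def adj_def subset_iff)
    then have "v \<in> C" using x by (auto simp: C_def intro: rtrancl_into_rtrancl)
    then show False using x by blast
  qed
  have "(\<Union>v\<in>C. K v) \<inter> (\<Union>v\<in>F. K v) = {} \<or> (\<Union>v\<in>F-C. K v) \<inter> (\<Union>v\<in>F. K v) = {}"
    using connected_closedD[OF c d u cl] .
  moreover have "a \<in> C" using a by (simp add: C_def)
  ultimately have "F - C = {}" using K_nonempty C_def by blast
  then show ?thesis using b by (auto simp: C_def R_def)
qed

text \<open>A path that repeats no edge has at most as many steps as there are pairs of cells in \<open>F\<close>.\<close>

lemma jump_bound:
  assumes F: "finite F" "F \<subseteq> level n" and c: "connected (\<Union>v\<in>F. K v)" and a: "a \<in> F" and b: "b \<in> F"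
    and g: "\<And>u v. u \<in> F \<Longrightarrow> v \<in> F \<Longrightarrow> adj u v \<Longrightarrow> \<bar>g u - g v\<bar> \<le> \<delta>" and "0 \<le> \<delta>"
  shows "\<bar>g a - g b :: real\<bar> \<le> (real (card F))\<^sup>2 * \<delta>"
proof -
  define R where "R = {(u, v). u \<in> F \<and> v \<in> F \<and> adj u v}"
  have fR: "R \<subseteq> F \<times> F" "finite (F \<times> F)" using F by (auto simp: R_def)
  then have finR: "finite R" using finite_subset by blast
  have "(a, b) \<in> R\<^sup>*" using reachable_of_connected[OF F c a b] by (simp add: R_def)
  then obtain k where k: "k \<le> card R" "(a, b) \<in> R ^^ k"
    unfolding rtrancl_finite_eq_relpow[OF finR] by auto
  have "\<bar>g x - g y\<bar> \<le> real k * \<delta>" if "(x, y) \<in> R ^^ k" for k x y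
    using that
  proof (induction k arbitrary: y)
    case (Suc k)
    then obtain z where z: "(x, z) \<in> R ^^ k" "(z, y) \<in> R" by auto
    have "\<bar>g x - g z\<bar> \<le> real k * \<delta>" using Suc.IH z by simp
    moreover have "\<bar>g z - g y\<bar> \<le> \<delta>" using z(2) g by (auto simp: R_def)
    ultimately show ?case by (simp add: algebra_simps)
  qed simp
  then have "\<bar>g a - g b\<bar> \<le> real k * \<delta>" using k by simp
  also have "\<dots> \<le> real ((card F)\<^sup>2) * \<delta>"
  proof (intro mult_right_mono)
    have "card R \<le> card (F \<times> F)" using fR card_mono by blast
    then show "real k \<le> real ((card F)\<^sup>2)" using k by (simp add: card_cartesian_product power2_eq_square flip: of_nat_mult)
  qed fact
  finally show ?thesis by simp
qed

lemma geometry_constants: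
  obtains c1 c2 c3 c4 c5 where "0 < c1" "0 < c2" "0 < c3" "0 < c4" "0 < c5"
    and "\<And>w. c1 * rstar ^ height w \<le> diameter (K w)"
    and "\<And>w. diameter (K w) \<le> c2 * rstar ^ height w"
    and "\<And>n x. 1 \<le> n \<Longrightarrow> ball x (c3 * rstar ^ n) \<subseteq> cell_nbhd Mstar x n"
    and "\<And>n x. 1 \<le> n \<Longrightarrow> cell_nbhd Mstar x n \<subseteq> ball x (c4 * rstar ^ n)"
    and "\<And>w. 1 \<le> height w \<Longrightarrow> \<exists>x\<in>K w. ball x (c5 * rstar ^ height w) \<subseteq> K w"
  using cell_geometry
  apply (elim exE conjE)
  subgoal premises prems for c1 c2 c3 c4 c5
    apply (rule prems(1)[of c1 c2 c3 c4 c5])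
    using prems(2-) by simp_all
  done

lemma dist_cell_le_diameter: "x \<in> K w \<Longrightarrow> y \<in> K w \<Longrightarrow> dist x y \<le> diameter (K w)"
  using K_compact by (intro diameter_bounded_bound compact_imp_bounded)

lemma eventually_rstar_power_less:
  assumes "0 < \<epsilon>"
  shows "\<forall>\<^sub>F n in sequentially. c * rstar ^ n < \<epsilon>"
proof -
  have "(\<lambda>n. c * rstar ^ n) \<longlonglongrightarrow> c * 0"
    using rstar by (intro tendsto_mult tendsto_const LIMSEQ_realpow_zero) auto
  then show ?thesis using assms by (intro order_tendstoD) auto
qed

text \<open>Points that lie in a single cell of the level of \<open>u\<close> are dense in \<open>K u\<close>, because by
  minimality every small descendant cell contains one.\<close>

lemma pure_points_dense:
  assumes x: "x \<in> K u" and "0 < \<epsilon>"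
  shows "\<exists>y\<in>K u. dist x y < \<epsilon> \<and> (\<forall>v. height v = height u \<longrightarrow> y \<in> K v \<longrightarrow> v = u)"
proof -
  obtain c2 where c2: "c2 > 0" "\<And>w. diameter (K w) \<le> c2 * rstar ^ height w"
    using geometry_constants by metis
  obtain k where k: "c2 * rstar ^ k < \<epsilon>"
    using eventually_happens'[OF sequentially_bot eventually_rstar_power_less[OF assms(2)]] by blast
  obtain w where w: "w \<in> desc k u" "x \<in> K w" using K_desc[of u k] x by blast
  obtain y where y: "y \<in> K w" "\<And>v. v \<in> level (height w) - {w} \<Longrightarrow> y \<notin> K v"
    using minimal unfolding minimal_def by blast
  have hw: "height w = height u + k" using w by (simp add: desc_iff)
  have "dist x y \<le> diameter (K w)" using w(2) y(1) by (rule dist_cell_le_diameter)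
  also have "\<dots> \<le> c2 * rstar ^ height w" by (rule c2)
  also have "\<dots> \<le> c2 * rstar ^ k" using c2 rstar hw by (intro mult_left_mono power_decreasing) auto
  finally have "dist x y < \<epsilon>" using k by simp
  moreover have "y \<in> K u" using y(1) K_mono_desc[OF w(1)] by blast
  moreover have "v = u" if v: "height v = height u" "y \<in> K v" for v
  proof -
    obtain w' where w': "w' \<in> desc k v" "y \<in> K w'" using K_desc[of v k] v by blast
    have "height w' = height w" using w' v hw by (simp add: desc_iff)
    then have "w' = w" using y(2)[of w'] w' by auto
    then show ?thesis using w w' by (simp add: desc_iff)
  qed
  ultimately show ?thesis by blast
qed

end

context basic_geometric_framework
begin

text \<open>A ball around a point that lies only in \<open>K w\<close> is covered by the neighbours of \<open>w\<close>, and a point that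
  lies only in \<open>K u\<close> can only be covered by \<open>u\<close>. Approximating \<open>x\<close> and \<open>y\<close> by such points turns the
  inclusion of balls in neighbourhoods of points into separation of non-neighbouring cells. For a general
  point of \<open>K w\<close> one more step is needed, from \<open>w\<close> to another cell that contains the point.\<close>

lemma far_cells_dist:
  obtains c where "0 < c"
    and "\<And>u w x y. height u = height w \<Longrightarrow> u \<notin> near Mstar w \<Longrightarrow> x \<in> K u \<Longrightarrow> y \<in> K w \<Longrightarrow>
            c * rstar ^ height w \<le> dist x y"
    and "\<And>w x y. x \<in> K w \<Longrightarrow> height w = 0 \<or> dist x y < c * rstar ^ height w \<Longrightarrow>
            \<exists>v\<in>near (Suc Mstar) w. y \<in> K v"
proof -
  obtain c where c: "0 < c" "\<And>n x. 1 \<le> n \<Longrightarrow> ball x (c * rstar ^ n) \<subseteq> cell_nbhd Mstar x n"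
    using geometry_constants by metis
  show ?thesis
  proof (rule that[OF c(1)])
    fix u w x y assume h: "height u = height w" "u \<notin> near Mstar w" "x \<in> K u" "y \<in> K w"
    have n: "1 \<le> height w"
    proof (rule ccontr)
      assume "\<not> ?thesis"
      then have "height w = 0" by linarith
      then have "u = root" "w = root" using h(1) height_eq_0_iff[of u] height_eq_0_iff[of w] by linarith+
      then show False using h(2) by simp
    qed
    show "c * rstar ^ height w \<le> dist x y"
    proof (rule ccontr)
      assume "\<not> ?thesis"
      then have d: "0 < (c * rstar ^ height w - dist x y) / 2" (is "0 < ?d") by simp
      obtain x' where x': "x' \<in> K u" "dist x x' < ?d" "\<And>v. height v = height u \<Longrightarrow> x' \<in> K v \<Longrightarrow> v = u"
        using pure_points_dense[OF h(3) d] by blast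
      obtain y' where y': "y' \<in> K w" "dist y y' < ?d" "\<And>v. height v = height w \<Longrightarrow> y' \<in> K v \<Longrightarrow> v = w"
        using pure_points_dense[OF h(4) d] by blast
      have "dist y' x' \<le> dist y y' + dist x y + dist x x'"
        using dist_triangle[of y' x' y] dist_triangle[of y x' x] by (simp add: dist_commute)
      also have "\<dots> < c * rstar ^ height w" using x'(2) y'(2) by (simp add: field_simps)
      finally have "x' \<in> ball y' (c * rstar ^ height w)" by simp
      then have "x' \<in> cell_nbhd Mstar y' (height w)" by (rule subsetD[OF c(2)[OF n]])
      then obtain w' v where v: "height w' = height w" "y' \<in> K w'" "v \<in> near Mstar w'" "x' \<in> K v"
        unfolding cell_nbhd_def nbhd_eq_near by auto
      have "w' = w" using y'(3) v by blast
      moreover have "v = u" using x'(3)[of v] v height_near[OF v(3)] h(1) by simp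
      ultimately show False using h(2) v(3) by simp
    qed
  next
    fix w x y assume x: "x \<in> K w" and d: "height w = 0 \<or> dist x y < c * rstar ^ height w"
    show "\<exists>v\<in>near (Suc Mstar) w. y \<in> K v"
    proof (cases "height w = 0")
      case True
      then show ?thesis using K_root by (intro bexI[of _ root]) (auto simp del: near.simps)
    next
      case False
      then have n: "1 \<le> height w" by linarith
      have "y \<in> ball x (c * rstar ^ height w)" using d False by auto
      then have "y \<in> cell_nbhd Mstar x (height w)" by (intro subsetD[OF c(2)[OF n]])
      then obtain w' v where v: "height w' = height w" "x \<in> K w'" "v \<in> near Mstar w'" "y \<in> K v"
        unfolding cell_nbhd_def nbhd_eq_near by auto
      have "adj w w'" using v x by (auto simp: adj_def)
      then have "w' \<in> near 1 w" by simp
      then have "v \<in> near (1 + Mstar) w" using near_trans v(3) by blast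
      then show ?thesis using v(4) by auto
    qed
  qed
qed

end

section \<open>The measure of the cells and the Hausdorff dimension\<close>

locale regular_framework = basic_geometric_framework E root K m Mstar rstar
  for E :: "'t \<Rightarrow> 't \<Rightarrow> bool" and root :: 't and K :: "'t \<Rightarrow> 'a::metric_space set"
    and m :: "'a measure" and Mstar :: nat and rstar :: real +
  fixes Q CA :: real
  assumes Q: "0 < Q" and CA: "1 \<le> CA"
    and ahlfors: "0 < s \<Longrightarrow> s < 2 \<Longrightarrow> s powr Q / CA \<le> measure m (ball x s) \<and> measure m (ball x s) \<le> CA * s powr Q"
begin

interpretation M: prob_space m by (rule prob)

text \<open>The measure of a cell of level \<open>n\<close> is comparable with the \<open>n\<close>-th power of this number.\<close>

definition mscale :: real where "mscale = rstar powr Q"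

lemma mscale: "0 < mscale" "mscale < 1"
  using rstar Q by (auto simp: mscale_def powr01_less_one)

lemma powr_mscale: "0 \<le> c \<Longrightarrow> (c * rstar ^ n) powr Q = c powr Q * mscale ^ n"
proof -
  have "(rstar ^ n) powr Q = rstar powr (real n * Q)"
    using rstar by (subst powr_realpow[symmetric]) (simp_all add: powr_powr)
  also have "\<dots> = mscale ^ n"
    using rstar by (subst powr_realpow[symmetric]) (simp_all add: mscale_def powr_powr mult.commute)
  finally show "0 \<le> c \<Longrightarrow> ?thesis" using rstar by (simp add: powr_mult)
qed

lemma space_m [simp]: "space m = UNIV"
  using sets_eq_imp_space_eq[OF borel_sets] by simp

lemma sets_m [simp]: "A \<in> sets m \<longleftrightarrow> A \<in> sets borel"
  using borel_sets by simp

lemma K_sets [measurable]: "K w \<in> sets m"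
  using K_closed by (simp add: borel_closed)

lemma K_sets_borel [measurable]: "K w \<in> sets borel"
  using K_closed by (simp add: borel_closed)

text \<open>For radii from twice the diameter on, the bound holds because the total mass is one.\<close>

lemma ball_upper:
  assumes "0 < s"
  shows "measure m (ball x s) \<le> CA * s powr Q"
proof (cases "s < 2")
  case True
  then show ?thesis using ahlfors assms by blast
next
  case False
  have "measure m (ball x s) \<le> 1" by simp
  also have "\<dots> \<le> CA * 1" using CA by simp
  also have "\<dots> \<le> CA * s powr Q" using CA Q False by (intro mult_left_mono ge_one_powr_ge_zero) auto
  finally show ?thesis .
qed

lemma cell_measure_bounds:
  obtains a b where "0 < a" "0 < b" "\<And>w. a * mscale ^ height w \<le> measure m (K w)"
     "\<And>w. measure m (K w) \<le> b * mscale ^ height w"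
proof -
  obtain c2 c5 where c: "0 < c2" "0 < c5" "\<And>w. diameter (K w) \<le> c2 * rstar ^ height w"
    "\<And>w. 1 \<le> height w \<Longrightarrow> \<exists>x\<in>K w. ball x (c5 * rstar ^ height w) \<subseteq> K w"
    using geometry_constants by metis
  define a where "a = min 1 (min c5 1 powr Q / CA)"
  have "0 < a" using c CA by (simp add: a_def)
  moreover have "a * mscale ^ height w \<le> measure m (K w)" for w
  proof (cases "1 \<le> height w")
    case True
    obtain x where x: "x \<in> K w" "ball x (c5 * rstar ^ height w) \<subseteq> K w" using c(4)[OF True] by blast
    define s where "s = min c5 1 * rstar ^ height w"
    have r1: "rstar ^ height w \<le> 1" using rstar by (intro power_le_one) auto
    have s: "0 < s" "s \<le> c5 * rstar ^ height w" using c rstar by (auto simp: s_def)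
    have "s \<le> 1 * 1" unfolding s_def using r1 c rstar by (intro mult_mono) auto
    then have s2: "s < 2" by simp
    have "a * mscale ^ height w \<le> (min c5 1 powr Q / CA) * mscale ^ height w"
      using mscale by (intro mult_right_mono) (auto simp: a_def)
    also have "\<dots> = s powr Q / CA" using c by (simp add: s_def powr_mscale)
    also have "\<dots> \<le> measure m (ball x s)" using ahlfors s s2 by blast
    also have "\<dots> \<le> measure m (K w)"
      using x s by (intro M.finite_measure_mono) (auto intro: order_trans[OF subset_ball])
    finally show ?thesis .
  next
    case False
    then have "w = root" by (metis One_nat_def Suc_leI height_eq_0_iff not_gr_zero)
    then show ?thesis using M.prob_space by (simp add: K_root a_def)
  qed
  moreover have "measure m (K w) \<le> (CA * (2 * c2) powr Q) * mscale ^ height w" for w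
  proof -
    obtain x where x: "x \<in> K w" using K_nonempty by blast
    have "K w \<subseteq> ball x (2 * c2 * rstar ^ height w)"
    proof
      fix y assume "y \<in> K w"
      then have "dist x y \<le> diameter (K w)" by (rule dist_cell_le_diameter[OF x])
      also have "\<dots> \<le> c2 * rstar ^ height w" by (rule c)
      also have "\<dots> < 2 * c2 * rstar ^ height w" using c rstar by simp
      finally show "y \<in> ball x (2 * c2 * rstar ^ height w)" by simp
    qed
    then have "measure m (K w) \<le> measure m (ball x (2 * c2 * rstar ^ height w))" by (intro M.finite_measure_mono) auto
    also have "\<dots> \<le> CA * (2 * c2 * rstar ^ height w) powr Q" using c rstar by (intro ball_upper) auto
    also have "\<dots> = CA * (2 * c2) powr Q * mscale ^ height w" using c by (simp add: powr_mscale)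
    finally show ?thesis .
  qed
  moreover have "0 < CA * (2 * c2) powr Q" using CA c by simp
  ultimately show ?thesis using that by blast
qed

lemma measure_K_pos: "0 < measure m (K w)"
  using cell_measure_bounds mscale by (metis mult_pos_pos order_less_le_trans zero_less_power)

lemma measure_desc: "measure m (K w) = (\<Sum>v\<in>desc k w. measure m (K v))"
proof (induction k arbitrary: w)
  case (Suc k)
  have "measure m (K w) = (\<Sum>v\<in>children w. measure m (K v))" by (rule measure_children)
  also have "\<dots> = (\<Sum>v\<in>children w. \<Sum>u\<in>desc k v. measure m (K u))" by (intro sum.cong refl Suc)
  also have "\<dots> = (\<Sum>u\<in>desc (Suc k) w. measure m (K u))"
    unfolding desc.simps using finite_children finite_desc desc_disjoint
    by (intro sum.UNION_disjoint[symmetric]) auto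
  finally show ?case .
qed simp

text \<open>The measures of the cells of one level add up to the total mass, which leaves nothing for overlaps.\<close>

lemma cell_overlap_null:
  assumes "height u = height v" "u \<noteq> v"
  shows "K u \<inter> K v \<in> null_sets m"
proof -
  let ?n = "height u"
  have sum: "(\<Sum>w\<in>level ?n. measure m (K w)) = 1"
    using measure_desc[of root ?n] M.prob_space by (simp add: K_root level_desc_root)
  have uv: "u \<in> level ?n" "v \<in> level ?n" using assms by auto
  have lv: "level ?n = insert u (insert v (level ?n - {u, v}))" using uv by auto
  have "(\<Sum>w\<in>level ?n. measure m (K w)) = measure m (K u) + measure m (K v) + (\<Sum>w\<in>level ?n - {u, v}. measure m (K w))"
    by (subst lv) (use assms finite_level in auto)
  moreover have "1 \<le> measure m (K u \<union> K v) + (\<Sum>w\<in>level ?n - {u, v}. measure m (K w))"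
  proof -
    have "(UNIV :: 'a set) = (K u \<union> K v) \<union> (\<Union>w\<in>level ?n - {u, v}. K w)"
      using K_level[of ?n] uv by blast
    then have "1 = measure m ((K u \<union> K v) \<union> (\<Union>w\<in>level ?n - {u, v}. K w))"
      using M.prob_space by simp
    also have "\<dots> \<le> measure m (K u \<union> K v) + measure m (\<Union>w\<in>level ?n - {u, v}. K w)"
      using finite_level by (intro measure_Un_le) (auto intro!: sets.finite_UN simp del: sets_m)
    also have "measure m (\<Union>w\<in>level ?n - {u, v}. K w) \<le> (\<Sum>w\<in>level ?n - {u, v}. measure m (K w))"
      using finite_level by (intro M.finite_measure_subadditive_finite) (auto simp del: sets_m)
    finally show ?thesis by simp
  qed
  moreover have "measure m (K u \<union> K v) = measure m (K u) + measure m (K v) - measure m (K u \<inter> K v)"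
    by (rule measure_Un3) (auto simp: fmeasurable_def M.emeasure_eq_measure simp del: sets_m)
  ultimately have "measure m (K u \<inter> K v) = 0" using sum measure_nonneg[of m "K u \<inter> K v"] by linarith
  then show ?thesis
    by (simp add: null_sets_def M.emeasure_eq_measure)
qed

lemma AE_unique_cell: "AE x in m. \<forall>u v. height u = height v \<longrightarrow> x \<in> K u \<longrightarrow> x \<in> K v \<longrightarrow> u = v"
proof -
  have c: "countable (UNIV :: 't set)"
  proof -
    have "(UNIV :: 't set) = (\<Union>n. level n)" by auto
    then show ?thesis using finite_level by (metis countable_UN countable_finite countableI_type)
  qed
  have "AE x in m. \<forall>u\<in>UNIV. \<forall>v\<in>UNIV. \<not> (height u = height v \<and> u \<noteq> v \<and> x \<in> K u \<inter> K v)"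
    unfolding AE_ball_countable[OF c]
  proof (intro ballI)
    fix u v
    show "AE x in m. \<not> (height u = height v \<and> u \<noteq> v \<and> x \<in> K u \<inter> K v)"
      using AE_not_in[OF cell_overlap_null[of u v]] by (cases "height u = height v \<and> u \<noteq> v") auto
  qed
  then show ?thesis by eventually_elim blast
qed

lemma AE_sum_indicator:
  assumes "V \<subseteq> level n"
  shows "AE x in m. (\<Sum>v\<in>V. indicator (K v) x * g v) = (if x \<in> (\<Union>v\<in>V. K v) then g (SOME v. v \<in> V \<and> x \<in> K v) else (0::'b::{comm_semiring_1}))"
  using AE_unique_cell
proof eventually_elim
  fix x assume u: "\<forall>u v. height u = height v \<longrightarrow> x \<in> K u \<longrightarrow> x \<in> K v \<longrightarrow> u = v"
  have fin: "finite V" using assms finite_level finite_subset by blast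
  show "(\<Sum>v\<in>V. indicator (K v) x * g v) = (if x \<in> (\<Union>v\<in>V. K v) then g (SOME v. v \<in> V \<and> x \<in> K v) else 0)"
  proof (cases "x \<in> (\<Union>v\<in>V. K v)")
    case True
    define w where "w = (SOME v. v \<in> V \<and> x \<in> K v)"
    have w: "w \<in> V" "x \<in> K w" using True someI_ex[of "\<lambda>v. v \<in> V \<and> x \<in> K v"] by (auto simp: w_def)
    have "(\<Sum>v\<in>V. indicator (K v) x * g v) = (\<Sum>v\<in>V. if v = w then g w else 0)"
    proof (rule sum.cong[OF refl])
      fix v assume v: "v \<in> V"
      have hv: "height v = height w" using v w assms by (auto simp: subset_iff)
      show "indicator (K v) x * g v = (if v = w then g w else 0)"
        using u hv w by (auto simp: indicator_def)
    qed
    also have "\<dots> = g w" using fin w by simp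
    finally show ?thesis using True by (simp add: w_def)
  next
    case False
    then have "indicator (K v) x * g v = 0" if "v \<in> V" for v using that by (auto simp: indicator_def)
    then have "(\<Sum>v\<in>V. indicator (K v) x * g v) = 0" by (intro sum.neutral) auto
    then show ?thesis using False by simp
  qed
qed

lemma AE_indicator_sum:
  assumes "V \<subseteq> level n"
  shows "AE x in m. (\<Sum>v\<in>V. indicator (K v) x) = (indicator (\<Union>v\<in>V. K v) x :: 'b::{comm_semiring_1})"
  using AE_sum_indicator[OF assms, of "\<lambda>_. 1 :: 'b"] by eventually_elim (simp add: indicator_def)

lemma card_cells_le:
  assumes V: "V \<subseteq> level n" and B: "(\<Union>v\<in>V. K v) \<subseteq> B" "B \<in> sets m" and a: "\<And>v. v \<in> V \<Longrightarrow> a \<le> measure m (K v)"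
  shows "real (card V) * a \<le> measure m B"
proof -
  have fin: "finite V" using V finite_level finite_subset by blast
  have "real (card V) * a \<le> (\<Sum>v\<in>V. measure m (K v))" using sum_mono[of V "\<lambda>_. a", OF a] by simp
  also have "\<dots> = (\<Sum>v\<in>V. LINT x|m. indicator (K v) x)" by simp
  also have "\<dots> = (LINT x|m. (\<Sum>v\<in>V. indicator (K v) x))"
    by (rule Bochner_Integration.integral_sum[symmetric]) (intro integrable_real_indicator K_sets, simp add: M.emeasure_eq_measure)
  also have "\<dots> = (LINT x|m. indicator (\<Union>v\<in>V. K v) x)"
    using fin by (intro integral_cong_AE AE_indicator_sum[OF V] ) (auto intro!: borel_measurable_sum sets.finite_UN simp del: sets_m)
  also have "\<dots> = measure m (\<Union>v\<in>V. K v)" by simp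
  also have "\<dots> \<le> measure m B" using B by (intro M.finite_measure_mono) auto
  finally show ?thesis .
qed

lemma card_desc_le: "\<exists>D\<ge>1. \<forall>k w. real (card (desc k w)) \<le> D / mscale ^ k"
proof -
  obtain a b where ab: "0 < a" "0 < b" "\<And>w. a * mscale ^ height w \<le> measure m (K w)"
     "\<And>w. measure m (K w) \<le> b * mscale ^ height w"
    using cell_measure_bounds by metis
  have "real (card (desc k w)) \<le> b / a / mscale ^ k" for k w
  proof -
    have "real (card (desc k w)) * (a * mscale ^ (height w + k)) \<le> measure m (K w)"
    proof (rule card_cells_le)
      show "desc k w \<subseteq> level (height w + k)" by (auto simp: desc_iff)
      show "(\<Union>v\<in>desc k w. K v) \<subseteq> K w" using K_desc[of w k] by simp
      show "a * mscale ^ (height w + k) \<le> measure m (K v)" if "v \<in> desc k w" for v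
        using ab(3)[of v] that by (simp add: desc_iff)
    qed (rule K_sets)
    also have "\<dots> \<le> b * mscale ^ height w" by (rule ab)
    finally show ?thesis using mscale ab(1) by (simp add: power_add field_simps)
  qed
  moreover have "b / a / mscale ^ k \<le> max 1 (b / a) / mscale ^ k" for k
    using mscale by (intro divide_right_mono) auto
  ultimately show ?thesis by (intro exI[of _ "max 1 (b / a)"]) (meson max.cobounded1 order_trans)
qed

lemma measure_singleton: "measure m {x} = 0"
proof (rule ccontr)
  assume "measure m {x} \<noteq> 0"
  then have pos: "0 < measure m {x} / (2 * CA)" using CA by (simp add: zero_less_measure_iff)
  define s where "s = (measure m {x} / (2 * CA)) powr (1 / Q)"
  have s: "0 < s" "s powr Q = measure m {x} / (2 * CA)"
    using pos Q CA by (auto simp: s_def powr_powr powr_one_gt_zero_iff simp del: zero_less_divide_iff)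
  have "measure m {x} \<le> measure m (ball x s)" using s by (intro M.finite_measure_mono) auto
  also have "\<dots> \<le> CA * s powr Q" by (rule ball_upper[OF s(1)])
  also have "\<dots> = measure m {x} / 2" using s CA by simp
  finally show False using pos CA by (auto simp: zero_less_divide_iff)
qed

text \<open>Covering the space by the cells of one level shows that its Hausdorff dimension is at
  most the exponent of Ahlfors regularity.\<close>

lemma hausdorff_measure_zero:
  assumes "Q < s"
  shows "hausdorff_measure s (UNIV :: 'a set) = 0"
proof -
  obtain c2 where c2: "0 < c2" "\<And>w. diameter (K w) \<le> c2 * rstar ^ height w"
    using geometry_constants by metis
  obtain D where D: "D \<ge> 1" "\<And>k w. real (card (desc k w)) \<le> D / mscale ^ k"
    using card_desc_le by blast
  define \<rho> where "\<rho> = rstar powr s / mscale"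
  have \<rho>: "0 \<le> \<rho>" "\<rho> < 1"
    using assms rstar mscale powr_less_mono'[OF rstar assms] by (auto simp: \<rho>_def mscale_def)
  have bound: "hausdorff_premeasure s \<delta> (UNIV :: 'a set) \<le> ennreal (D * c2 powr s * \<rho> ^ n)"
    if n: "c2 * rstar ^ n \<le> \<delta>" for n \<delta>
  proof -
    define N where "N = card (level n)"
    obtain h where h: "bij_betw h {0..<N} (level n)"
      using ex_bij_betw_nat_finite[OF finite_level] unfolding N_def by blast
    define U where "U i = (if i < N then K (h i) else {})" for i
    have hl: "height (h i) = n" if "i < N" for i using bij_betw_apply[OF h, of i] that by simp
    have dU: "diameter (U i) \<le> c2 * rstar ^ n" for i
    proof (cases "i < N")
      case True
      then show ?thesis using c2(2)[of "h i"] hl[of i] by (simp add: U_def)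
    qed (use c2(1) rstar in \<open>simp add: U_def\<close>)
    have d0: "0 \<le> diameter (U i)" for i by (rule diameter_ge_0) (auto simp: U_def K_compact compact_imp_bounded)
    have cov: "(UNIV :: 'a set) \<subseteq> (\<Union>i. U i)"
    proof
      fix x :: 'a
      obtain w where w: "w \<in> level n" "x \<in> K w" using K_level[of n] by blast
      have "w \<in> h ` {0..<N}" using w(1) bij_betw_imp_surj_on[OF h] by simp
      then obtain i where "i < N" "h i = w" by auto
      then show "x \<in> (\<Union>i. U i)" using w by (auto simp: U_def)
    qed
    have "hausdorff_premeasure s \<delta> (UNIV :: 'a set) \<le> (\<Sum>i. ennreal (diameter (U i) powr s))"
      unfolding hausdorff_premeasure_def
    proof (rule INF_lower, intro CollectI conjI allI cov)
      fix i
      show "bounded (U i)" by (simp add: U_def K_compact compact_imp_bounded)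
      show "diameter (U i) \<le> \<delta>" using dU[of i] n by simp
    qed
    also have "\<dots> = (\<Sum>i<N. ennreal (diameter (U i) powr s))"
      by (rule suminf_finite) (auto simp: U_def)
    also have "\<dots> \<le> (\<Sum>i<N. ennreal ((c2 * rstar ^ n) powr s))"
      using assms Q by (intro sum_mono ennreal_leI powr_mono2 dU d0) auto
    also have "\<dots> = ennreal (real N * (c2 * rstar ^ n) powr s)"
      by (simp add: ennreal_of_nat_eq_real_of_nat ennreal_mult)
    also have "\<dots> \<le> ennreal (D / mscale ^ n * (c2 * rstar ^ n) powr s)"
      using D(2)[of n root] by (intro ennreal_leI mult_right_mono) (auto simp: N_def level_desc_root)
    also have "D / mscale ^ n * (c2 * rstar ^ n) powr s = D * c2 powr s * \<rho> ^ n"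
      using c2 rstar by (simp add: powr_mult \<rho>_def power_divide powr_powr powr_realpow[symmetric] mult.commute)
    finally show ?thesis .
  qed
  have "hausdorff_premeasure s \<delta> (UNIV :: 'a set) \<le> 0" if "0 < \<delta>" for \<delta>
  proof (rule LIMSEQ_le_const)
    have "(\<lambda>n. D * c2 powr s * \<rho> ^ n) \<longlonglongrightarrow> D * c2 powr s * 0"
      using \<rho> by (intro tendsto_mult tendsto_const LIMSEQ_realpow_zero) auto
    then show "(\<lambda>n. ennreal (D * c2 powr s * \<rho> ^ n)) \<longlonglongrightarrow> 0"
      using tendsto_ennrealI by fastforce
    have "\<forall>\<^sub>F n in sequentially. c2 * rstar ^ n < \<delta>" using that by (rule eventually_rstar_power_less)
    then show "\<exists>N. \<forall>n\<ge>N. hausdorff_premeasure s \<delta> (UNIV :: 'a set) \<le> ennreal (D * c2 powr s * \<rho> ^ n)"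
      unfolding eventually_sequentially using bound less_imp_le by blast
  qed
  then show ?thesis unfolding hausdorff_measure_def
    by (metis (no_types, lifting) SUP_le_iff greaterThan_iff le_zero_eq order_refl)
qed

text \<open>Mass distribution principle: a cover by sets of diameter at most \<open>1/2\<close> has to carry the total mass.\<close>

lemma hausdorff_measure_pos:
  assumes "0 < s" "s < Q"
  shows "hausdorff_measure s (UNIV :: 'a set) \<noteq> 0"
proof
  assume z: "hausdorff_measure s (UNIV :: 'a set) = 0"
  define c where "c = CA * 2 powr Q"
  have c: "0 < c" using CA by (simp add: c_def)
  have "hausdorff_premeasure s (1/2) (UNIV :: 'a set) \<le> hausdorff_measure s (UNIV :: 'a set)"
    unfolding hausdorff_measure_def by (rule SUP_upper) auto
  then have "hausdorff_premeasure s (1/2) (UNIV :: 'a set) < ennreal (1 / (2 * c))" using z c by simp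
  then obtain U where U: "(UNIV :: 'a set) \<subseteq> (\<Union>i. U i)" "\<And>i. bounded (U i)" "\<And>i. diameter (U i) \<le> 1/2"
    and sU: "(\<Sum>i. ennreal (diameter (U i) powr s)) < ennreal (1 / (2 * c))"
    unfolding hausdorff_premeasure_def INF_less_iff by blast
  define x where "x i = (SOME y. y \<in> U i)" for i
  define V where "V i = (if U i = {} then {} else cball (x i) (diameter (U i)))" for i
  have UV: "U i \<subseteq> V i" for i
  proof (cases "U i = {}")
    case False
    then have "x i \<in> U i" by (auto simp: x_def intro: someI)
    then show ?thesis using False U(2) diameter_bounded_bound[of "U i"] by (auto simp: V_def)
  qed simp
  have Vs: "V i \<in> sets m" for i by (auto simp: V_def)
  have mV: "measure m (V i) \<le> c * diameter (U i) powr s" for i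
  proof -
    have d0: "0 \<le> diameter (U i)" by (rule diameter_ge_0[OF U(2)])
    consider "U i = {}" | "U i \<noteq> {}" "diameter (U i) = 0" | "U i \<noteq> {}" "0 < diameter (U i)" using d0 by linarith
    then show ?thesis
    proof cases
      case 3
      have "measure m (V i) \<le> measure m (ball (x i) (2 * diameter (U i)))"
        using 3 by (intro M.finite_measure_mono) (auto simp: V_def)
      also have "\<dots> \<le> CA * (2 * diameter (U i)) powr Q" using 3 by (intro ball_upper) auto
      also have "\<dots> = c * diameter (U i) powr Q" using 3 by (simp add: c_def powr_mult)
      also have "\<dots> \<le> c * diameter (U i) powr s"
        using 3 c assms U(3)[of i] by (intro mult_left_mono powr_mono') auto
      finally show ?thesis .
    qed (auto simp: V_def measure_singleton)
  qed
  have "1 = emeasure m (\<Union>i. V i)"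
  proof -
    have "(\<Union>i. V i) = UNIV" using U(1) UV by blast
    then show ?thesis using M.emeasure_space_1 by simp
  qed
  also have "\<dots> \<le> (\<Sum>i. emeasure m (V i))" using Vs by (intro emeasure_subadditive_countably) auto
  also have "\<dots> \<le> (\<Sum>i. ennreal c * ennreal (diameter (U i) powr s))"
    using mV c by (intro suminf_le) (auto simp: M.emeasure_eq_measure ennreal_mult[symmetric] ennreal_leI)
  also have "\<dots> = ennreal c * (\<Sum>i. ennreal (diameter (U i) powr s))" by simp
  also have "\<dots> \<le> ennreal c * ennreal (1 / (2 * c))" using sU by (intro mult_left_mono) auto
  also have "\<dots> = ennreal (1 / 2)" using c by (simp add: ennreal_mult[symmetric] del: ennreal_half)
  finally have "ennreal 1 \<le> ennreal (1/2)" by (simp del: ennreal_half)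
  then show False by (subst (asm) ennreal_le_iff) auto
qed

lemma df_eq_Q: "df = Q"
proof -
  have "hausdorff_dimension (UNIV :: 'a set) = ennreal Q"
  proof (rule antisym)
    show "hausdorff_dimension (UNIV :: 'a set) \<le> ennreal Q"
    proof (rule ennreal_le_epsilon)
      fix e :: real assume "0 < e"
      then have "hausdorff_dimension (UNIV :: 'a set) \<le> ennreal (Q + e)"
        unfolding hausdorff_dimension_def using Q by (intro INF_lower) (auto intro: hausdorff_measure_zero)
      then show "hausdorff_dimension (UNIV :: 'a set) \<le> ennreal Q + ennreal e"
        using Q \<open>0 < e\<close> by (simp add: ennreal_plus)
    qed
    show "ennreal Q \<le> hausdorff_dimension (UNIV :: 'a set)"
      unfolding hausdorff_dimension_def
    proof (rule INF_greatest)
      fix s assume "s \<in> {s. 0 < s \<and> hausdorff_measure s (UNIV :: 'a set) = 0}"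
      then show "ennreal Q \<le> ennreal s" using hausdorff_measure_pos[of s] by (intro ennreal_leI) force
    qed
  qed
  then show ?thesis using Q by (simp add: df_def)
qed

end

section \<open>Discrete energies and averages\<close>

lemma abs_powr_le_iff:
  fixes x X p :: real
  assumes "0 < p" "0 \<le> X"
  shows "\<bar>x\<bar> powr p \<le> X \<longleftrightarrow> \<bar>x\<bar> \<le> X powr (1 / p)"
proof
  assume "\<bar>x\<bar> powr p \<le> X"
  then have "(\<bar>x\<bar> powr p) powr (1 / p) \<le> X powr (1 / p)" using assms by (intro powr_mono2) auto
  then show "\<bar>x\<bar> \<le> X powr (1 / p)" using assms by (simp add: powr_powr)
next
  assume "\<bar>x\<bar> \<le> X powr (1 / p)"
  then have "\<bar>x\<bar> powr p \<le> (X powr (1 / p)) powr p" using assms by (intro powr_mono2) auto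
  then show "\<bar>x\<bar> powr p \<le> X" using assms by (simp add: powr_powr)
qed

lemma abs_powr_le_of_le_mult:
  fixes x X p c :: real
  assumes "0 < p" "0 \<le> X" "0 \<le> c" "\<bar>x\<bar> \<le> c * X powr (1 / p)"
  shows "\<bar>x\<bar> powr p \<le> c powr p * X"
proof -
  have "\<bar>x\<bar> powr p \<le> (c * X powr (1 / p)) powr p" using assms by (intro powr_mono2) auto
  then show ?thesis using assms by (simp add: powr_mult powr_powr)
qed

lemma ennreal_divide_le_iff_mult:
  assumes "0 \<le> a" "0 \<le> b" "0 \<le> s"
  shows "ennreal a / ennreal b \<le> ennreal s \<longleftrightarrow> a \<le> s * b"
proof (cases "b = 0")
  case True
  show ?thesis
  proof (cases "a = 0")
    case False
    then have "ennreal a / ennreal b = \<top>" using True assms by (simp add: divide_ennreal_def ennreal_mult_top)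
    then show ?thesis using False True assms by (simp add: top_unique)
  qed (simp add: True)
next
  case False
  then show ?thesis using assms by (simp add: divide_ennreal pos_divide_le_eq)
qed

context basic_geometric_framework
begin

text \<open>Every edge occurs in both orientations, which the factor 1/2 in \<^const>\<open>energy\<close> compensates.\<close>

definition edge_pairs :: "nat \<Rightarrow> 't set \<Rightarrow> ('t \<times> 't) set" where
  "edge_pairs n A = {(u, v). {u, v} \<in> cell_edges n A}"

lemma edge_pairs_iff [simp]:
  "(u, v) \<in> edge_pairs n A \<longleftrightarrow> u \<in> A \<and> v \<in> A \<and> height u = n \<and> u \<noteq> v \<and> adj u v"
  by (simp add: edge_pairs_def cell_edges_iff)

lemma finite_edge_pairs: "finite (edge_pairs n A)"
  by (rule finite_subset[of _ "level n \<times> level n"]) (auto simp: finite_level adj_def)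

lemma energy_eq: "energy p n A f = (\<Sum>(u, v)\<in>edge_pairs n A. \<bar>f u - f v\<bar> powr p) / 2"
  by (simp add: energy_def edge_pairs_def)

lemma energy_nonneg: "0 \<le> energy p n A f"
  unfolding energy_eq by (auto intro!: sum_nonneg divide_nonneg_nonneg)

lemma energy_mono: "A \<subseteq> B \<Longrightarrow> energy p n A f \<le> energy p n B f"
  unfolding energy_eq by (intro divide_right_mono sum_mono2 finite_edge_pairs) auto

lemma energy_cong: "(\<And>u. u \<in> A \<Longrightarrow> f u = g u) \<Longrightarrow> energy p n A f = energy p n A g"
  unfolding energy_eq by (intro arg_cong2[where f = "(/)"] sum.cong refl) auto

lemma energy_mono_diff:
  assumes "0 \<le> p" "\<And>u v. u \<in> A \<Longrightarrow> v \<in> A \<Longrightarrow> \<bar>f u - f v\<bar> \<le> \<bar>g u - g v\<bar>"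
  shows "energy p n A f \<le> energy p n A g"
  unfolding energy_eq using assms by (intro divide_right_mono sum_mono) (auto intro!: powr_mono2)

lemma energy_edge:
  assumes "u \<in> A" "v \<in> A" "height u = n" "adj u v"
  shows "\<bar>f u - f v\<bar> powr p \<le> energy p n A f"
proof (cases "u = v")
  case True
  then show ?thesis using energy_nonneg by simp
next
  case False
  have "(\<Sum>(u, v)\<in>{(u, v), (v, u)}. \<bar>f u - f v\<bar> powr p) \<le> (\<Sum>(u, v)\<in>edge_pairs n A. \<bar>f u - f v\<bar> powr p)"
    using assms adj_sym False by (intro sum_mono2 finite_edge_pairs) (auto simp: adj_def)
  then show ?thesis using False by (simp add: energy_eq abs_minus_commute)
qed

lemma energy_overlap:
  assumes I: "finite I" and A: "\<And>i. i \<in> I \<Longrightarrow> A i \<subseteq> B" and D: "\<And>u. u \<in> B \<Longrightarrow> card {i \<in> I. u \<in> A i} \<le> D"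
  shows "(\<Sum>i\<in>I. energy p n (A i) f) \<le> real D * energy p n B f"
proof -
  let ?t = "\<lambda>(u, v). \<bar>f u - f v\<bar> powr p"
  have t0: "0 \<le> ?t e" for e by (cases e) auto
  have "(\<Sum>i\<in>I. sum ?t (edge_pairs n (A i))) = (\<Sum>i\<in>I. \<Sum>e\<in>edge_pairs n B. if e \<in> edge_pairs n (A i) then ?t e else 0)"
  proof (rule sum.cong[OF refl])
    fix i assume "i \<in> I"
    then have "edge_pairs n (A i) = {e \<in> edge_pairs n B. e \<in> edge_pairs n (A i)}" using A by fastforce
    then have "sum ?t (edge_pairs n (A i)) = sum ?t {e \<in> edge_pairs n B. e \<in> edge_pairs n (A i)}" by (rule arg_cong)
    then show "sum ?t (edge_pairs n (A i)) = (\<Sum>e\<in>edge_pairs n B. if e \<in> edge_pairs n (A i) then ?t e else 0)"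
      by (simp only: sum.inter_filter[OF finite_edge_pairs])
  qed
  also have "\<dots> = (\<Sum>e\<in>edge_pairs n B. \<Sum>i\<in>I. if e \<in> edge_pairs n (A i) then ?t e else 0)"
    by (rule sum.swap)
  also have "\<dots> \<le> (\<Sum>e\<in>edge_pairs n B. real D * ?t e)"
  proof (rule sum_mono)
    fix e assume e: "e \<in> edge_pairs n B"
    have "(\<Sum>i\<in>I. if e \<in> edge_pairs n (A i) then ?t e else 0) = (\<Sum>i\<in>{i\<in>I. e \<in> edge_pairs n (A i)}. ?t e)"
      by (rule sum.inter_filter[OF I, symmetric])
    also have "\<dots> = real (card {i\<in>I. e \<in> edge_pairs n (A i)}) * ?t e" by simp
    also have "\<dots> \<le> real D * ?t e"
    proof (intro mult_right_mono t0 of_nat_mono)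
      have eB: "fst e \<in> B" using e by (cases e) auto
      have "card {i\<in>I. e \<in> edge_pairs n (A i)} \<le> card {i\<in>I. fst e \<in> A i}"
        using I by (cases e) (intro card_mono, auto)
      also have "\<dots> \<le> D" using eB by (rule D)
      finally show "card {i\<in>I. e \<in> edge_pairs n (A i)} \<le> D" .
    qed
    finally show "(\<Sum>i\<in>I. if e \<in> edge_pairs n (A i) then ?t e else 0) \<le> real D * ?t e" .
  qed
  finally have "(\<Sum>i\<in>I. sum ?t (edge_pairs n (A i))) / 2 \<le> real D * sum ?t (edge_pairs n B) / 2"
    by (simp add: sum_distrib_left)
  then show ?thesis by (simp add: energy_eq sum_divide_distrib[symmetric])
qed

text \<open>If every increment of \<open>h\<close> along an edge is controlled by the energy of \<open>f\<close> on the
  descendants of a neighbourhood of that edge, then bounded overlap controls the whole energy of \<open>h\<close>.\<close>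

lemma energy_local_to_global:
  shows "\<exists>D>0. \<forall>n l B h f c. B \<subseteq> level n \<longrightarrow> 0 \<le> c \<longrightarrow>
     (\<forall>a\<in>B. \<forall>b\<in>B. adj a b \<longrightarrow> \<bar>h a - h b\<bar> powr p \<le> c * energy p (n + l) (Desc l (B \<inter> near L a)) f) \<longrightarrow>
     energy p n B h \<le> c * D * energy p (n + l) (Desc l B) f"
proof -
  obtain D1 where D1: "D1 \<ge> 1" "\<And>w. card (near 1 w) \<le> D1" using card_near_bounded by blast
  obtain D2 where D2: "D2 \<ge> 1" "\<And>w. card (near L w) \<le> D2" using card_near_bounded by blast
  have "energy p n B h \<le> c * real (D1 * D2) * energy p (n + l) (Desc l B) f"
    if B: "B \<subseteq> level n" and c: "0 \<le> c" and
     h: "\<And>a b. a \<in> B \<Longrightarrow> b \<in> B \<Longrightarrow> adj a b \<Longrightarrow> \<bar>h a - h b\<bar> powr p \<le> c * energy p (n + l) (Desc l (B \<inter> near L a)) f"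
   for n l B h f c
  proof -
    have fB: "finite B" using B finite_level finite_subset by blast
    let ?e = "\<lambda>a. energy p (n + l) (Desc l (B \<inter> near L a)) f"
    have fS: "finite (SIGMA u:B. near 1 u)" by (intro finite_SigmaI fB finite_near)
    have "(\<Sum>(u, v)\<in>edge_pairs n B. \<bar>h u - h v\<bar> powr p) \<le> (\<Sum>(u, v)\<in>(SIGMA u:B. near 1 u). c * ?e u)"
    proof -
      have "(\<Sum>(u, v)\<in>edge_pairs n B. \<bar>h u - h v\<bar> powr p) \<le> (\<Sum>(u, v)\<in>edge_pairs n B. c * ?e u)"
        using h by (intro sum_mono) auto
      also have "\<dots> \<le> (\<Sum>(u, v)\<in>(SIGMA u:B. near 1 u). c * ?e u)"
        using c energy_nonneg by (intro sum_mono2 fS) (auto simp only: near_one edge_pairs_iff mem_Sigma_iff mem_Collect_eq subset_iff split_paired_all case_prod_conv intro!: mult_nonneg_nonneg)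
      finally show ?thesis .
    qed
    also have "\<dots> = (\<Sum>u\<in>B. real (card (near 1 u)) * (c * ?e u))"
      by (subst sum.Sigma[symmetric], rule fB, rule ballI, rule finite_near) simp
    also have "\<dots> \<le> (\<Sum>u\<in>B. real D1 * (c * ?e u))"
      using D1 c energy_nonneg by (intro sum_mono mult_right_mono mult_nonneg_nonneg) (auto simp del: near.simps)
    also have "\<dots> = real D1 * c * (\<Sum>u\<in>B. ?e u)" by (simp add: sum_distrib_left mult.assoc)
    also have "\<dots> \<le> real D1 * c * (real D2 * energy p (n + l) (Desc l B) f)"
    proof (intro mult_left_mono energy_overlap fB)
      show "Desc l (B \<inter> near L i) \<subseteq> Desc l B" for i by (rule Desc_mono) auto
      fix u 
      have "card {i \<in> B. u \<in> Desc l (B \<inter> near L i)} \<le> card (near L ((parent ^^ l) u))"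
        by (rule card_mono[OF finite_near]) (auto simp: Desc_iff intro: near_sym)
      also have "\<dots> \<le> D2" by (rule D2)
      finally show "card {i \<in> B. u \<in> Desc l (B \<inter> near L i)} \<le> D2" .
    qed (use c in auto)
    finally have "2 * energy p n B h \<le> c * real (D1 * D2) * energy p (n + l) (Desc l B) f"
      by (simp add: energy_eq[of p n] mult_ac)
    then show ?thesis using energy_nonneg[of p n B h] by linarith
  qed
  then show ?thesis using D1(1) D2(1) by (intro exI[of _ "real (D1 * D2)"]) auto
qed

lemma discrete_avg_cong: "(\<And>v. v \<in> desc k w \<Longrightarrow> f v = g v) \<Longrightarrow> discrete_avg k f w = discrete_avg k g w"
  unfolding discrete_avg_def by simp

end

context regular_framework
begin

lemma discrete_avg_eq: "discrete_avg k f w = (\<Sum>v\<in>desc k w. f v * measure m (K v)) / measure m (K w)"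
  unfolding discrete_avg_def using measure_desc[of w k] by simp

lemma discrete_avg_0 [simp]: "discrete_avg 0 f w = f w"
  using measure_K_pos[of w] by (simp add: discrete_avg_eq)

lemma discrete_avg_const: "(\<And>v. v \<in> desc k w \<Longrightarrow> f v = c) \<Longrightarrow> discrete_avg k f w = c"
  using measure_K_pos[of w] measure_desc[of w k] 
  by (simp add: discrete_avg_eq sum_distrib_left[symmetric])

lemma discrete_avg_add: "discrete_avg (j + k) f w = discrete_avg j (discrete_avg k f) w"
proof -
  have "(\<Sum>u\<in>desc (j + k) w. f u * measure m (K u)) = (\<Sum>v\<in>desc j w. \<Sum>u\<in>desc k v. f u * measure m (K u))"
    unfolding desc_add using finite_desc desc_disjoint by (intro sum.UNION_disjoint) auto
  also have "\<dots> = (\<Sum>v\<in>desc j w. discrete_avg k f v * measure m (K v))"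
    using measure_K_pos by (intro sum.cong) (auto simp: discrete_avg_eq less_le)
  finally show ?thesis by (simp add: discrete_avg_eq)
qed

lemma discrete_avg_diff_le:
  assumes "\<And>v. v \<in> desc k w \<Longrightarrow> \<bar>f v - c\<bar> \<le> \<delta>"
  shows "\<bar>discrete_avg k f w - c\<bar> \<le> \<delta>"
proof -
  have "discrete_avg k f w - c = (\<Sum>v\<in>desc k w. (f v - c) * measure m (K v)) / measure m (K w)"
    using measure_K_pos[of w] measure_desc[of w k]
    by (simp add: discrete_avg_eq left_diff_distrib sum_subtractf sum_distrib_left[symmetric] field_simps)
  then have "\<bar>discrete_avg k f w - c\<bar> = \<bar>\<Sum>v\<in>desc k w. (f v - c) * measure m (K v)\<bar> / measure m (K w)"
    using measure_K_pos[of w] by simp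
  also have "\<dots> \<le> (\<Sum>v\<in>desc k w. \<delta> * measure m (K v)) / measure m (K w)"
    using assms measure_K_pos
    by (intro divide_right_mono order_trans[OF sum_abs] sum_mono) (auto simp: abs_mult intro!: mult_right_mono)
  also have "\<dots> = \<delta>" using measure_K_pos[of w] measure_desc[of w k] by (simp add: sum_distrib_left[symmetric])
  finally show ?thesis .
qed

section \<open>Increments of averages along edges\<close>

lemma sigma_sys_energy:
  assumes "sigma_sys \<J> p k \<le> ennreal s" "0 \<le> s" "G \<in> \<J>" "G \<subseteq> level n"
  shows "energy p n G (discrete_avg k f) \<le> s * energy p (n + k) (Desc k G) f"
proof -
  have "ennreal (energy p n G (discrete_avg k f)) / ennreal (energy p (n + k) (Desc k G) f) \<le> sigma_set p n k G"
    unfolding sigma_set_def by (rule SUP_upper) simp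
  also have "\<dots> \<le> sigma_sys \<J> p k"
    unfolding sigma_sys_def using assms by (intro SUP_upper2[of n] SUP_upper) auto
  also have "\<dots> \<le> ennreal s" by fact
  finally show ?thesis using energy_nonneg assms(2) by (simp add: ennreal_divide_le_iff_mult)
qed

text \<open>A set \<open>G\<close> of the covering system need not be connected, and its energy may involve cells far
  from \<open>x\<close>. Restricting \<open>f\<close> to the descendants of the connected component of \<open>x\<close> in \<open>G\<close> (and
  extending by zero) removes the other components without creating new increments, since
  descendants of different components are never adjacent.\<close>

lemma component_estimate:
  assumes s: "sigma_sys \<J> p k \<le> ennreal s" "0 \<le> s" and G: "G \<in> \<J>" "G \<subseteq> level n" "finite G" "card G \<le> N"
    and x: "x \<in> G" and y: "y \<in> G" and xy: "adj x y"
  shows "\<bar>discrete_avg k f x - discrete_avg k f y\<bar> powr p \<le> s * energy p (n + k) (Desc k (G \<inter> near (N\<^sup>2) x)) f"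
proof -
  define R where "R = {(u, v). u \<in> G \<and> v \<in> G \<and> adj u v}"
  define C where "C = {z \<in> G. (x, z) \<in> R\<^sup>*}"
  have fR: "R \<subseteq> G \<times> G" "finite (G \<times> G)" using G by (auto simp: R_def)
  then have finR: "finite R" using finite_subset by blast
  have Rnear: "z \<in> near i x" if "(x, z) \<in> R ^^ i" for i z
    using that by (induction i arbitrary: z) (auto simp: R_def)
  have Cnear: "C \<subseteq> G \<inter> near (N\<^sup>2) x"
  proof
    fix z assume z: "z \<in> C"
    then obtain i where i: "i \<le> card R" "(x, z) \<in> R ^^ i"
      unfolding C_def rtrancl_finite_eq_relpow[OF finR] by auto
    have "card R \<le> card (G \<times> G)" using fR card_mono by blast
    also have "\<dots> \<le> N\<^sup>2" using G(4) by (simp add: card_cartesian_product power2_eq_square mult_mono)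
    finally have "i \<le> N\<^sup>2" using i by simp
    then have "z \<in> near (N\<^sup>2) x" using Rnear[OF i(2)] near_mono by blast
    then show "z \<in> G \<inter> near (N\<^sup>2) x" using z by (auto simp: C_def)
  qed
  have Cadj: "u \<in> C \<longleftrightarrow> v \<in> C" if "u \<in> G" "v \<in> G" "adj u v" for u v
  proof -
    have "(u, v) \<in> R" "(v, u) \<in> R" using that adj_sym by (auto simp: R_def)
    then show ?thesis using that unfolding C_def by (blast intro: rtrancl_into_rtrancl)
  qed
  have xC: "x \<in> C" "y \<in> C" using x Cadj[OF x y xy] by (auto simp: C_def)
  define f' where "f' v = (if (parent ^^ k) v \<in> C then f v else 0)" for v
  have avg: "discrete_avg k f' w = discrete_avg k f w" if "w \<in> C" for w
    using that by (intro discrete_avg_cong) (auto simp: f'_def desc_iff)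
  have "\<bar>discrete_avg k f x - discrete_avg k f y\<bar> powr p = \<bar>discrete_avg k f' x - discrete_avg k f' y\<bar> powr p"
    using avg xC by simp
  also have "\<dots> \<le> energy p n G (discrete_avg k f')"
    using x y xy G by (intro energy_edge) auto
  also have "\<dots> \<le> s * energy p (n + k) (Desc k G) f'"
    by (rule sigma_sys_energy) fact+
  also have "energy p (n + k) (Desc k G) f' = energy p (n + k) (Desc k C) f"
  proof -
    have "(\<Sum>(u, v)\<in>edge_pairs (n + k) (Desc k G). \<bar>f' u - f' v\<bar> powr p)
        = (\<Sum>(u, v)\<in>edge_pairs (n + k) (Desc k C). \<bar>f u - f v\<bar> powr p)"
    proof (rule sum.mono_neutral_cong_right[OF finite_edge_pairs])
      show "edge_pairs (n + k) (Desc k C) \<subseteq> edge_pairs (n + k) (Desc k G)"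
        by (auto simp: Desc_iff C_def)
      show "\<forall>e\<in>edge_pairs (n + k) (Desc k G) - edge_pairs (n + k) (Desc k C).
          (case e of (u, v) \<Rightarrow> \<bar>f' u - f' v\<bar> powr p) = 0"
      proof (clarify)
        fix u v assume e: "(u, v) \<in> edge_pairs (n + k) (Desc k G)" "(u, v) \<notin> edge_pairs (n + k) (Desc k C)"
        have "(parent ^^ k) u \<in> C \<longleftrightarrow> (parent ^^ k) v \<in> C"
          using e(1) adj_ancestor by (intro Cadj) (auto simp: Desc_iff)
        moreover have "\<not> ((parent ^^ k) u \<in> C \<and> (parent ^^ k) v \<in> C)"
          using e by (auto simp: Desc_iff)
        ultimately show "\<bar>f' u - f' v\<bar> powr p = 0" by (simp add: f'_def)
      qed
      show "\<And>e. e \<in> edge_pairs (n + k) (Desc k C) \<Longrightarrow>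
         (case e of (u, v) \<Rightarrow> \<bar>f' u - f' v\<bar> powr p) = (case e of (u, v) \<Rightarrow> \<bar>f u - f v\<bar> powr p)"
        by (auto simp: f'_def Desc_iff)
    qed
    then show ?thesis by (simp add: energy_eq)
  qed
  also have "s * energy p (n + k) (Desc k C) f \<le> s * energy p (n + k) (Desc k (G \<inter> near (N\<^sup>2) x)) f"
    using s Cnear by (intro mult_left_mono energy_mono Desc_mono) auto
  finally show ?thesis .
qed

text \<open>An edge of \<open>B\<close> is replaced by a path of at most \<open>NE\<close> edges, each inside one covering set. The energies involved stay
  in \<open>B\<close> and near \<open>a\<close>.\<close>

lemma covering_edge_estimate:
  assumes p: "0 < p" and s: "sigma_sys \<J> p k \<le> ennreal s" "0 \<le> s"
    and J: "\<And>A. A \<in> \<J> \<Longrightarrow> finite A \<and> card A \<le> N"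
    and N: "\<N> \<subseteq> {A \<in> \<J>. A \<subseteq> level n}" "is_covering n B \<N> NT NE"
    and ab: "a \<in> B" "b \<in> B" "adj a b" "height a = n"
  shows "\<bar>discrete_avg k f a - discrete_avg k f b\<bar> powr p
     \<le> real NE powr p * s * energy p (n + k) (Desc k (B \<inter> near (NE + N\<^sup>2) a)) f"
proof (cases "a = b")
  case True
  then show ?thesis using s energy_nonneg by simp
next
  case False
  have BN: "B = \<Union>\<N>" using N by (simp add: is_covering_def)
  have "{a, b} \<in> cell_edges n B" using ab False by (simp add: cell_edges_iff)
  then obtain l w where l: "l \<le> NE" and w: "w 1 = a" "w (l+1) = b"
    "\<And>i. i \<in> {1..l} \<Longrightarrow> {w i, w (i+1)} \<in> (\<Union>G\<in>\<N>. cell_edges n G)"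
    using N(2) unfolding is_covering_def by blast
  define X where "X = s * energy p (n + k) (Desc k (B \<inter> near (NE + N\<^sup>2) a)) f"
  have X: "0 \<le> X" using s energy_nonneg by (simp add: X_def)
  have wnear: "i \<le> l \<Longrightarrow> w (i + 1) \<in> near i a" for i
  proof (induction i)
    case (Suc i)
    then have "{w (i+1), w (i+2)} \<in> (\<Union>G\<in>\<N>. cell_edges n G)" using w(3)[of "i+1"] by (simp add: numeral_2_eq_2)
    then have "adj (w (i+1)) (w (i+2))" by (auto simp: cell_edges_iff)
    moreover have "w (i + 1) \<in> near i a" using Suc by simp
    ultimately show ?case by (auto simp: numeral_2_eq_2)
  qed (use w in simp)
  have step: "\<bar>discrete_avg k f (w i) - discrete_avg k f (w (i+1))\<bar> \<le> X powr (1 / p)" if i: "i \<in> {1..l}" for i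
  proof -
    obtain G where G: "G \<in> \<N>" "{w i, w (i+1)} \<in> cell_edges n G" using w(3)[OF i] by blast
    have GJ: "G \<in> \<J>" "G \<subseteq> level n" using N G by auto
    have "i - 1 + 1 = i" "i - 1 \<le> l" using i by auto
    then have "w i \<in> near (i - 1) a" using wnear[of "i - 1"] by metis
    moreover have "near (i - 1) a \<subseteq> near NE a" using i l by (intro near_mono) auto
    ultimately have wi: "w i \<in> near NE a" by blast
    have "\<bar>discrete_avg k f (w i) - discrete_avg k f (w (i+1))\<bar> powr p
        \<le> s * energy p (n + k) (Desc k (G \<inter> near (N\<^sup>2) (w i))) f"
      using s GJ J[OF GJ(1)] G(2) by (intro component_estimate) (auto simp: cell_edges_iff)
    also have "\<dots> \<le> X" unfolding X_def
    proof (intro mult_left_mono energy_mono Desc_mono s)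
      show "G \<inter> near (N\<^sup>2) (w i) \<subseteq> B \<inter> near (NE + N\<^sup>2) a"
        using G(1) BN near_trans[OF wi] by auto
    qed
    finally show ?thesis using abs_powr_le_iff p X by blast
  qed
  have "\<bar>discrete_avg k f (w 1) - discrete_avg k f (w (i+1))\<bar> \<le> real i * X powr (1 / p)" if "i \<le> l" for i
    using that
  proof (induction i)
    case (Suc i)
    have "\<bar>discrete_avg k f (w (i+1)) - discrete_avg k f (w (i+1+1))\<bar> \<le> X powr (1 / p)"
      using Suc.prems by (intro step) auto
    then show ?case using Suc by (simp add: algebra_simps)
  qed simp
  from this[of l] have "\<bar>discrete_avg k f a - discrete_avg k f b\<bar> \<le> real l * X powr (1 / p)" using w by simp
  also have "\<dots> \<le> real NE * X powr (1 / p)" using l by (intro mult_right_mono) auto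
  finally have "\<bar>discrete_avg k f a - discrete_avg k f b\<bar> powr p \<le> real NE powr p * X"
    using p X by (intro abs_powr_le_of_le_mult) auto
  then show ?thesis by (simp add: X_def mult.assoc)
qed

end

locale homogeneous_framework = regular_framework E root K m Mstar rstar Q CA
  for E :: "'t \<Rightarrow> 't \<Rightarrow> bool" and root :: 't and K :: "'t \<Rightarrow> 'a::metric_space set"
    and m :: "'a measure" and Mstar :: nat and rstar :: real and Q CA :: real +
  fixes p :: real and \<J> :: "'t set set"
  assumes p: "1 < p" and J_system: "covering_system \<J>"
    and J_product: "(SUP k. sigma_sys \<J> p k * cap_const Mstar p k) < \<infinity>"
begin

definition covering_numbers :: "nat \<Rightarrow> nat \<Rightarrow> nat \<Rightarrow> bool" where
  "covering_numbers N NT NE \<longleftrightarrow> (\<forall>A\<in>\<J>. finite A \<and> card A \<le> N) \<and> 1 \<le> NE \<and>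
     (\<forall>w. \<forall>k\<ge>1. \<exists>\<N>\<subseteq>{A \<in> \<J>. A \<subseteq> level (height w + k)}.
        is_covering (height w + k) (desc k w) \<N> NT NE) \<and>
     (\<forall>n. \<forall>G\<in>\<J>. G \<subseteq> level n \<longrightarrow> (\<forall>k. \<exists>\<N>\<subseteq>{A \<in> \<J>. A \<subseteq> level (n + k)}.
        is_covering (n + k) (Desc k G) \<N> NT NE))"

lemma ex_covering_numbers: "\<exists>N NT NE. covering_numbers N NT NE"
  using J_system unfolding covering_system_def covering_numbers_def
  by (elim exE conjE, intro exI conjI) assumption+

lemma covering_numbersD:
  assumes "covering_numbers N NT NE"
  shows "A \<in> \<J> \<Longrightarrow> finite A \<and> card A \<le> N" and "1 \<le> NE"
    and "1 \<le> k \<Longrightarrow> \<exists>\<N>\<subseteq>{A \<in> \<J>. A \<subseteq> level (height w + k)}. is_covering (height w + k) (desc k w) \<N> NT NE"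
    and "G \<in> \<J> \<Longrightarrow> G \<subseteq> level n \<Longrightarrow>
        \<exists>\<N>\<subseteq>{A \<in> \<J>. A \<subseteq> level (n + k)}. is_covering (n + k) (Desc k G) \<N> NT NE"
  using assms unfolding covering_numbers_def by simp_all

text \<open>The whole level \<open>n\<close> is covered as the set of descendants of the root.\<close>

lemma edge_estimate:
  "\<exists>C>0. \<exists>L. \<forall>k s a b f. 0 \<le> s \<longrightarrow> sigma_sys \<J> p k \<le> ennreal s \<longrightarrow> adj a b \<longrightarrow>
      \<bar>discrete_avg k f a - discrete_avg k f b\<bar> powr p \<le> C * s * energy p (height a + k) (Desc k (near L a)) f"
proof -
  obtain N NT NE where "covering_numbers N NT NE" using ex_covering_numbers by blast
  note N = covering_numbersD[OF this]
  have "\<bar>discrete_avg k f a - discrete_avg k f b\<bar> powr p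
      \<le> real NE powr p * s * energy p (height a + k) (Desc k (near (NE + N\<^sup>2) a)) f"
    if s: "0 \<le> s" "sigma_sys \<J> p k \<le> ennreal s" and ab: "adj a b" for k s a b f
  proof (cases "height a = 0")
    case True
    then have "a = b" using ab height_eq_0_iff[of a] height_eq_0_iff[of b] by (auto simp: adj_def simp del: height_eq_0_iff)
    then show ?thesis using s energy_nonneg by simp
  next
    case False
    then have n: "1 \<le> height a" by linarith
    obtain \<N> where \<N>: "\<N> \<subseteq> {A \<in> \<J>. A \<subseteq> level (height a)}" "is_covering (height a) (desc (height a) root) \<N> NT NE"
      using N(3)[OF n, of root] by (auto simp only: height_root add_0)
    have lev: "desc (height a) root = level (height a)" by (simp add: level_desc_root)
    have "\<bar>discrete_avg k f a - discrete_avg k f b\<bar> powr p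
      \<le> real NE powr p * s * energy p (height a + k) (Desc k (desc (height a) root \<inter> near (NE + N\<^sup>2) a)) f"
      using p ab by (intro covering_edge_estimate[OF _ s(2,1) N(1) \<N>]) (auto simp: level_desc_root[symmetric] adj_def)
    also have "\<dots> \<le> real NE powr p * s * energy p (height a + k) (Desc k (near (NE + N\<^sup>2) a)) f"
      using s by (intro mult_left_mono energy_mono Desc_mono) auto
    finally show ?thesis .
  qed
  then show ?thesis using N(2) by (intro exI[of _ "real NE powr p"] conjI exI[of _ "NE + N\<^sup>2"]) auto
qed

text \<open>The set \<open>Desc k A\<close> is covered by members of the system inside itself, so averaging over \<open>l\<close> more generations costs
  no energy outside \<open>Desc (k + l) A\<close>.\<close>

lemma sigma_submultiplicative:
  "\<exists>C>0. \<forall>k l s t. 0 \<le> s \<longrightarrow> 0 \<le> t \<longrightarrow> sigma_sys \<J> p k \<le> ennreal s \<longrightarrow> sigma_sys \<J> p l \<le> ennreal t \<longrightarrow>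
      sigma_sys \<J> p (k + l) \<le> ennreal (C * s * t)"
proof -
  obtain N NT NE where "covering_numbers N NT NE" using ex_covering_numbers by blast
  note N = covering_numbersD[OF this]
  obtain D where D: "0 < D" "\<And>n l B h f c. B \<subseteq> level n \<Longrightarrow> 0 \<le> c \<Longrightarrow>
     (\<forall>a\<in>B. \<forall>b\<in>B. adj a b \<longrightarrow> \<bar>h a - h b\<bar> powr p \<le> c * energy p (n + l) (Desc l (B \<inter> near (NE + N\<^sup>2) a)) f) \<Longrightarrow>
     energy p n B h \<le> c * D * energy p (n + l) (Desc l B) f"
    using energy_local_to_global[of p "NE + N\<^sup>2"] by blast
  define C where "C = real NE powr p * D"
  have "sigma_sys \<J> p (k + l) \<le> ennreal (C * s * t)"
    if st: "0 \<le> s" "0 \<le> t" "sigma_sys \<J> p k \<le> ennreal s" "sigma_sys \<J> p l \<le> ennreal t" for k l s t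
    unfolding sigma_sys_def sigma_set_def
  proof (intro SUP_least)
    fix n A f assume A: "A \<in> {A \<in> \<J>. A \<subseteq> level n}"
    obtain \<N> where \<N>: "\<N> \<subseteq> {A \<in> \<J>. A \<subseteq> level (n + k)}" "is_covering (n + k) (Desc k A) \<N> NT NE"
      using N(4)[of A n k] A by blast
    have lev: "Desc k A \<subseteq> level (n + k)" using A by (intro Desc_level) auto
    have "energy p n A (discrete_avg (k + l) f) = energy p n A (discrete_avg k (discrete_avg l f))"
      by (intro energy_cong discrete_avg_add)
    also have "\<dots> \<le> s * energy p (n + k) (Desc k A) (discrete_avg l f)"
      using st A by (intro sigma_sys_energy) auto
    also have "\<dots> \<le> s * (real NE powr p * t * D * energy p (n + k + l) (Desc l (Desc k A)) f)"
    proof (intro mult_left_mono D(2) lev ballI impI)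
      fix a b assume ab: "a \<in> Desc k A" "b \<in> Desc k A" "adj a b"
      show "\<bar>discrete_avg l f a - discrete_avg l f b\<bar> powr p
       \<le> real NE powr p * t * energy p (n + k + l) (Desc l (Desc k A \<inter> near (NE + N\<^sup>2) a)) f"
        using p ab lev by (intro covering_edge_estimate[OF _ st(4,2) N(1) \<N>]) auto
    qed (use st in auto)
    finally have "energy p n A (discrete_avg (k + l) f) \<le> C * s * t * energy p (n + (k + l)) (Desc (k + l) A) f"
      by (simp add: Desc_Desc C_def mult_ac add.assoc)
    moreover have "0 \<le> C * s * t" using st D(1) by (simp add: C_def)
    ultimately show "ennreal (energy p n A (discrete_avg (k + l) f)) / ennreal (energy p (n + (k + l)) (Desc (k + l) A) f)
        \<le> ennreal (C * s * t)"
      using energy_nonneg by (simp add: ennreal_divide_le_iff_mult)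
  qed
  moreover have "0 < C" using D N(2) by (simp add: C_def)
  ultimately show ?thesis by blast
qed

end

section \<open>Capacities between levels\<close>

lemma sum_powr_le:
  fixes a :: "'b \<Rightarrow> real"
  assumes "finite V" "card V \<le> D" "0 < p" "\<And>v. v \<in> V \<Longrightarrow> 0 \<le> a v"
  shows "(\<Sum>v\<in>V. a v) powr p \<le> real D powr p * (\<Sum>v\<in>V. a v powr p)"
proof -
  let ?X = "\<Sum>v\<in>V. a v powr p"
  have X: "0 \<le> ?X" by (intro sum_nonneg) auto
  have "a v \<le> ?X powr (1 / p)" if v: "v \<in> V" for v
  proof -
    have "\<bar>a v\<bar> powr p \<le> ?X" using member_le_sum[of v V "\<lambda>v. a v powr p"] assms v by simp
    then have "\<bar>a v\<bar> \<le> ?X powr (1 / p)" using abs_powr_le_iff[OF assms(3) X] by blast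
    then show ?thesis by simp
  qed
  then have "(\<Sum>v\<in>V. a v) \<le> real (card V) * ?X powr (1 / p)" using sum_mono[of V a "\<lambda>_. ?X powr (1 / p)"] by simp
  also have "\<dots> \<le> real D * ?X powr (1 / p)" using assms by (intro mult_right_mono) auto
  finally have "\<bar>\<Sum>v\<in>V. a v\<bar> \<le> real D * ?X powr (1 / p)" using assms(4) by (simp add: sum_nonneg)
  then have "\<bar>\<Sum>v\<in>V. a v\<bar> powr p \<le> real D powr p * ?X" using assms X by (intro abs_powr_le_of_le_mult) auto
  then show ?thesis using assms(4) by (simp add: sum_nonneg)
qed

lemma Max_image_diff:
  fixes f g :: "'b \<Rightarrow> real"
  assumes "finite W" "W \<noteq> {}"
  shows "\<exists>w\<in>W. \<bar>Max (f ` W) - Max (g ` W)\<bar> \<le> \<bar>f w - g w\<bar>"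
proof -
  have *: "\<exists>w\<in>W. Max (f ` W) - Max (g ` W) \<le> f w - g w" for f g :: "'b \<Rightarrow> real"
  proof -
    have "Max (f ` W) \<in> f ` W" using assms by (intro Max_in) auto
    then obtain w where w: "w \<in> W" "Max (f ` W) = f w" by auto
    then have "g w \<le> Max (g ` W)" using assms by (intro Max_ge) auto
    then show ?thesis using w by (intro bexI[of _ w]) auto
  qed
  show ?thesis
  proof (cases "Max (f ` W) \<ge> Max (g ` W)")
    case True
    then show ?thesis using *[of f g] by force
  next
    case False
    then show ?thesis using *[of g f] by force
  qed
qed

context basic_geometric_framework
begin

lemma near_increment:
  fixes F :: "'t \<Rightarrow> real"
  assumes "0 < p" "v \<in> near M w"
  shows "\<bar>F v - F w\<bar> powr p \<le> real M powr p * energy p (height w) (near M w) F"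
proof -
  let ?X = "energy p (height w) (near M w) F"
  have "\<bar>F v - F w\<bar> \<le> real i * ?X powr (1 / p)" if "v \<in> near i w" "i \<le> M" for i v
    using that
  proof (induction i arbitrary: v)
    case (Suc i)
    then obtain u where u: "u \<in> near i w" "adj u v" by auto
    have sub: "near i w \<subseteq> near M w" "near (Suc i) w \<subseteq> near M w" using Suc.prems by (intro near_mono; simp)+
    have "\<bar>F u - F v\<bar> powr p \<le> ?X"
      using u sub Suc.prems(1) height_near[OF u(1)] by (intro energy_edge) blast+
    then have "\<bar>F u - F v\<bar> \<le> ?X powr (1 / p)" using abs_powr_le_iff assms(1) energy_nonneg by blast
    moreover have "\<bar>F u - F w\<bar> \<le> real i * ?X powr (1 / p)" using Suc.IH u Suc.prems by simp
    ultimately show ?case by (simp add: algebra_simps)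
  qed simp
  then show ?thesis using assms energy_nonneg by (intro abs_powr_le_of_le_mult) auto
qed

text \<open>A bump function for \<open>w\<close>: one minus a competitor for the capacity that defines \<^const>\<open>cap_const\<close>.\<close>

definition bump :: "nat \<Rightarrow> 't \<Rightarrow> ('t \<Rightarrow> real) \<Rightarrow> bool" where
  "bump k w H \<longleftrightarrow> (\<forall>v\<in>desc k w. H v = 1) \<and>
     (\<forall>v. height v = height w + k \<longrightarrow> (parent ^^ k) v \<notin> near Mstar w \<longrightarrow> H v = 0)"

lemma Desc_far_iff:
  "v \<in> Desc k (level (height w) - near Mstar w) \<longleftrightarrow> height v = height w + k \<and> (parent ^^ k) v \<notin> near Mstar w"
  by (auto simp: Desc_iff height_ancestor)

lemma cap_const_le:
  assumes "\<And>w. \<exists>H. bump k w H \<and> energy p (height w + k) (level (height w + k)) H \<le> c"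
  shows "cap_const Mstar p k \<le> ennreal c"
  unfolding cap_const_def
proof (intro SUP_least)
  fix w
  obtain H where H: "bump k w H" "energy p (height w + k) (level (height w + k)) H \<le> c" using assms by blast
  have "cap p (height w + k) (desc k w) (Desc k (level (height w) - nbhd Mstar w)) (level (height w + k))
     \<le> ennreal (energy p (height w + k) (level (height w + k)) (\<lambda>v. 1 - H v))"
    unfolding cap_def using H(1) by (intro INF_lower) (auto simp: bump_def nbhd_eq_near Desc_far_iff)
  also have "energy p (height w + k) (level (height w + k)) (\<lambda>v. 1 - H v) = energy p (height w + k) (level (height w + k)) H"
    by (simp add: energy_eq abs_minus_commute)
  finally show "cap p (height w + k) (desc k w) (Desc k (level (height w) - nbhd Mstar w)) (level (height w + k)) \<le> ennreal c"
    using H(2) by (meson ennreal_leI order_trans)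
qed

lemma cap_const_ge:
  assumes "\<And>H. bump k w H \<Longrightarrow> c \<le> energy p (height w + k) (level (height w + k)) H"
  shows "ennreal c \<le> cap_const Mstar p k"
proof -
  have "ennreal c \<le> cap p (height w + k) (desc k w) (Desc k (level (height w) - nbhd Mstar w)) (level (height w + k))"
    unfolding cap_def
  proof (intro INF_greatest ennreal_leI)
    fix f assume f: "f \<in> {f. (\<forall>v\<in>desc k w. f v = (0::real)) \<and> (\<forall>v\<in>Desc k (level (height w) - nbhd Mstar w). f v = 1)}"
    have "c \<le> energy p (height w + k) (level (height w + k)) (\<lambda>v. 1 - f v)"
      using f by (intro assms) (auto simp: bump_def nbhd_eq_near Desc_far_iff)
    also have "\<dots> = energy p (height w + k) (level (height w + k)) f"
      by (simp add: energy_eq abs_minus_commute)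
    finally show "c \<le> energy p (height w + k) (level (height w + k)) f" .
  qed
  also have "\<dots> \<le> cap_const Mstar p k" unfolding cap_const_def by (rule SUP_upper) simp
  finally show ?thesis .
qed

lemma ex_bump:
  assumes "cap_const Mstar p k < ennreal c" "0 \<le> p"
  shows "\<exists>H. bump k w H \<and> (\<forall>v. 0 \<le> H v \<and> H v \<le> 1) \<and> energy p (height w + k) (level (height w + k)) H \<le> c"
proof -
  have "cap p (height w + k) (desc k w) (Desc k (level (height w) - nbhd Mstar w)) (level (height w + k))
     \<le> cap_const Mstar p k" unfolding cap_const_def by (rule SUP_upper) simp
  also have "\<dots> < ennreal c" by fact
  finally obtain f where f: "\<forall>v\<in>desc k w. f v = 0" "\<forall>v\<in>Desc k (level (height w) - nbhd Mstar w). f v = 1"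
     "ennreal (energy p (height w + k) (level (height w + k)) f) < ennreal c"
    unfolding cap_def INF_less_iff by auto
  define H where "H v = 1 - max 0 (min 1 (f v))" for v
  have "energy p (height w + k) (level (height w + k)) H \<le> energy p (height w + k) (level (height w + k)) f"
    using assms by (intro energy_mono_diff) (auto simp: H_def)
  also have "\<dots> \<le> c" using f(3) by (metis energy_nonneg ennreal_less_iff less_imp_le)
  finally have "energy p (height w + k) (level (height w + k)) H \<le> c" .
  moreover have "bump k w H" using f by (auto simp: bump_def nbhd_eq_near Desc_far_iff H_def)
  moreover have "0 \<le> H v \<and> H v \<le> 1" for v by (auto simp: H_def)
  ultimately show ?thesis by blast
qed

lemma infdist_cell_attained: "\<exists>y\<in>K w. infdist x (K w) = dist x y"
proof -
  obtain y where y: "y \<in> K w" "\<And>z. z \<in> K w \<Longrightarrow> dist x y \<le> dist x z"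
    using continuous_attains_inf[OF K_compact[of w] K_nonempty[of w], of "\<lambda>y. dist x y"] continuous_on_dist[OF continuous_on_const continuous_on_id] by blast
  have "infdist x (K w) = dist x y"
    unfolding infdist_notempty[OF K_nonempty] using y by (intro antisym cINF_lower cINF_greatest K_nonempty bdd_belowI[of _ 0]) auto
  then show ?thesis using y by blast
qed

text \<open>Otherwise the neighbourhood of one small cell would be the whole space, which has diameter one.\<close>

lemma separated_cells: "\<exists>u w. height u = height w \<and> u \<notin> near Mstar w"
proof (rule ccontr)
  assume "\<not> ?thesis"
  then have all: "u \<in> near Mstar w" if "height u = height w" for u w using that by blast
  obtain c where c: "0 < c" "\<And>n x. 1 \<le> n \<Longrightarrow> cell_nbhd Mstar x n \<subseteq> ball x (c * rstar ^ n)"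
    using geometry_constants by metis
  have "\<forall>\<^sub>F n in sequentially. c * rstar ^ n < 1 / 4" by (rule eventually_rstar_power_less) simp
  then have "\<forall>\<^sub>F n in sequentially. c * rstar ^ n < 1 / 4 \<and> 1 \<le> n"
    using eventually_ge_at_top[of 1] by eventually_elim simp
  then obtain n where n: "c * rstar ^ n < 1 / 4" "1 \<le> n"
    using eventually_happens'[OF sequentially_bot] by blast
  obtain x :: 'a where True by blast
  obtain w where w: "height w = n" "x \<in> K w" using K_level[of n] level_iff by blast
  have "(UNIV :: 'a set) \<subseteq> cell_nbhd Mstar x n"
  proof
    fix y :: 'a
    obtain v where v: "height v = n" "y \<in> K v" using K_level[of n] level_iff by blast
    then show "y \<in> cell_nbhd Mstar x n"
      unfolding cell_nbhd_def nbhd_eq_near using all[of v w] w by auto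
  qed
  then have sub: "(UNIV :: 'a set) \<subseteq> ball x (1 / 4)" using c(2)[OF n(2), of x] n(1) by (meson less_imp_le order_trans subset_ball)
  obtain y z :: 'a where "1 / 2 < dist y z"
    using diameter_lower_bounded[of "UNIV :: 'a set" "1 / 2"] compact_space
    by (auto simp: diameter_space compact_imp_bounded)
  moreover have "dist x y < 1 / 4" "dist x z < 1 / 4" using sub by auto
  ultimately show False using dist_triangle[of y z x] by (simp add: dist_commute)
qed

text \<open>A bump separates \<open>w\<close> from \<open>u\<close>. If its transform \<open>g H\<close> still does so and has edge increments
  controlled by the energy of \<open>H\<close>, then a path from \<open>w\<close> to \<open>u\<close> bounds that energy from below.\<close>

lemma bump_energy_lower:
  assumes p: "0 < p" and u: "height u = height w" "u \<notin> near Mstar w"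
    and g: "\<And>H. bump k w H \<Longrightarrow> g H w = 1 \<and> g H u = 0"
    and e: "\<And>H a b. bump k w H \<Longrightarrow> adj a b \<Longrightarrow> height a = height w \<Longrightarrow>
       \<bar>g H a - g H b\<bar> powr p \<le> c * energy p (height w + k) (level (height w + k)) H"
    and "0 < c"
  shows "ennreal (1 / ((real (card (level (height w))))\<^sup>2 powr p * c)) \<le> cap_const Mstar p k"
proof (rule cap_const_ge)
  fix H assume H: "bump k w H"
  let ?N = "(real (card (level (height w))))\<^sup>2"
  let ?X = "c * energy p (height w + k) (level (height w + k)) H"
  have X: "0 \<le> ?X" using \<open>0 < c\<close> energy_nonneg by simp
  have con: "connected (\<Union>v\<in>level (height w). K v)" using K_level connected_space by simp
  have "\<bar>g H w - g H u\<bar> \<le> ?N * ?X powr (1 / p)"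
  proof (rule jump_bound[OF finite_level subset_refl con])
    fix a b assume "a \<in> level (height w)" "b \<in> level (height w)" "adj a b"
    then show "\<bar>g H a - g H b\<bar> \<le> ?X powr (1 / p)"
      using e[OF H, of a b] abs_powr_le_iff[OF p X] by simp
  qed (use u in auto)
  then have "\<bar>g H w - g H u\<bar> powr p \<le> ?N powr p * ?X" using p X by (intro abs_powr_le_of_le_mult) auto
  then have 1: "1 \<le> ?N powr p * c * energy p (height w + k) (level (height w + k)) H" using g[OF H] by (simp add: mult.assoc)
  moreover have "0 < ?N powr p * c"
    using 1 energy_nonneg[of p "height w + k" "level (height w + k)" H] \<open>0 < c\<close>
    by (metis mult_zero_left not_one_le_zero powr_ge_zero order_le_less mult_pos_pos)
  ultimately show "1 / (?N powr p * c) \<le> energy p (height w + k) (level (height w + k)) H"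
    by (simp add: divide_le_eq mult.commute)
qed

end

context homogeneous_framework
begin

text \<open>Averaging a bump function produces an increment of size one at a fixed level.\<close>

lemma sigma_cap_lower:
  "\<exists>C>0. \<forall>k s. 0 < s \<longrightarrow> sigma_sys \<J> p k \<le> ennreal s \<longrightarrow> ennreal (1 / (C * s)) \<le> cap_const Mstar p k"
proof -
  obtain u w where uw: "height u = height w" "u \<notin> near Mstar w" using separated_cells by blast
  obtain C L where C: "0 < C" "\<And>k s a b f. 0 \<le> s \<Longrightarrow> sigma_sys \<J> p k \<le> ennreal s \<Longrightarrow> adj a b \<Longrightarrow>
      \<bar>discrete_avg k f a - discrete_avg k f b\<bar> powr p \<le> C * s * energy p (height a + k) (Desc k (near L a)) f"
    using edge_estimate by blast
  let ?N = "(real (card (level (height w))))\<^sup>2 powr p"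
  have "w \<in> level (height w)" by simp
  then have "0 < card (level (height w))" using finite_level card_gt_0_iff by blast
  then have N: "0 < ?N" by simp
  have "ennreal (1 / (?N * (C * s))) \<le> cap_const Mstar p k" if s: "0 < s" "sigma_sys \<J> p k \<le> ennreal s" for k s
  proof (rule bump_energy_lower[where g = "discrete_avg k", OF _ uw])
    fix H assume H: "bump k w H"
    have "discrete_avg k H u = 0"
      using H uw by (intro discrete_avg_const) (auto simp: bump_def desc_iff)
    then show "discrete_avg k H w = 1 \<and> discrete_avg k H u = 0"
      using H by (auto simp: bump_def intro!: discrete_avg_const)
    fix a b assume ab: "adj a b" "height a = height w"
    have "\<bar>discrete_avg k H a - discrete_avg k H b\<bar> powr p \<le> C * s * energy p (height a + k) (Desc k (near L a)) H"
      using s ab by (intro C) auto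
    also have "\<dots> \<le> C * s * energy p (height w + k) (level (height w + k)) H"
      unfolding ab(2) using s C ab(2) height_near by (intro mult_left_mono energy_mono Desc_level) auto
    finally show "\<bar>discrete_avg k H a - discrete_avg k H b\<bar> powr p \<le> C * s * energy p (height w + k) (level (height w + k)) H" .
  qed (use p s C in auto)
  then show ?thesis using N C(1) by (intro exI[of _ "?N * C"]) (auto simp: mult.assoc)
qed

lemma cap_const_pos: "0 < cap_const Mstar p k"
proof -
  obtain u w where uw: "height u = height w" "u \<notin> near Mstar w" using separated_cells by blast
  obtain u' where u': "u' \<in> desc k u" using desc_nonempty by blast
  obtain w' where w': "w' \<in> desc k w" using desc_nonempty by blast
  have con: "connected (\<Union>v\<in>level (height w + k). K v)" using K_level connected_space by simp
  let ?N = "(real (card (level (height w + k))))\<^sup>2 powr p"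
  have "w' \<in> level (height w + k)" using w' by (simp add: desc_iff)
  then have "0 < card (level (height w + k))" using finite_level card_gt_0_iff by blast
  then have N: "0 < ?N" by simp
  have "ennreal (1 / ?N) \<le> cap_const Mstar p k"
  proof (rule cap_const_ge)
    fix H assume H: "bump k w H"
    let ?X = "energy p (height w + k) (level (height w + k)) H"
    have "\<bar>H w' - H u'\<bar> \<le> (real (card (level (height w + k))))\<^sup>2 * ?X powr (1 / p)"
    proof (rule jump_bound[OF finite_level subset_refl con])
      fix a b assume "a \<in> level (height w + k)" "b \<in> level (height w + k)" "adj a b"
      then have "\<bar>H a - H b\<bar> powr p \<le> ?X" by (intro energy_edge) auto
      then show "\<bar>H a - H b\<bar> \<le> ?X powr (1 / p)" using abs_powr_le_iff p energy_nonneg by simp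
    qed (use uw u' w' in \<open>auto simp: desc_iff\<close>)
    then have "\<bar>H w' - H u'\<bar> powr p \<le> ?N * ?X" using p energy_nonneg by (intro abs_powr_le_of_le_mult) auto
    moreover have "H w' = 1" "H u' = 0" using H u' w' uw by (auto simp: bump_def desc_iff)
    ultimately have "1 \<le> ?N * ?X" by simp
    then show "1 / ?N \<le> ?X" using N by (simp add: divide_le_eq mult.commute)
  qed
  moreover have "0 < ennreal (1 / ?N)" using N by (simp add: ennreal_less_zero_iff)
  ultimately show ?thesis by (rule less_le_trans[rotated])
qed

text \<open>Truncated distance to \<open>K w\<close>, sampled at one point per cell, is a competitor whose energy is at most a constant times
  the number of cells near \<open>K w\<close> times the \<open>p\<close>-th power of the relative size of the cells.\<close>

lemma cap_const_upper:
  "\<exists>C>0. \<forall>k. cap_const Mstar p k \<le> ennreal (C * (rstar powr p / mscale) ^ k)"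
proof -
  obtain c where c: "0 < c" "\<And>u w x y. height u = height w \<Longrightarrow> u \<notin> near Mstar w \<Longrightarrow> x \<in> K u \<Longrightarrow> y \<in> K w \<Longrightarrow>
            c * rstar ^ height w \<le> dist x y"
    using far_cells_dist by metis
  obtain c2 where c2: "0 < c2" "\<And>w. diameter (K w) \<le> c2 * rstar ^ height w"
    using geometry_constants by metis
  obtain a b where a: "0 < a" "\<And>w. a * mscale ^ height w \<le> measure m (K w)"
    using cell_measure_bounds by metis
  obtain D where D: "D \<ge> 1" "\<And>w. card (near 1 w) \<le> D" using card_near_bounded by blast
  define R where "R = c + 5 * c2"
  define C where "C = CA * R powr Q / a * real D * (2 * c2 / c) powr p"
  have R: "0 < R" using c c2 by (simp add: R_def)
  have C: "0 < C" using CA R a D c c2 by (simp add: C_def)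
  have dK: "dist x y \<le> c2 * rstar ^ height w" if "x \<in> K w" "y \<in> K w" for x y w
    using dist_cell_le_diameter[OF that] c2(2)[of w] by simp
  define \<xi> where "\<xi> v = (SOME x. x \<in> K v)" for v
  have \<xi>: "\<xi> v \<in> K v" for v unfolding \<xi>_def using K_nonempty by (simp add: some_in_eq)
  have "\<exists>H. bump k w H \<and> energy p (height w + k) (level (height w + k)) H \<le> C * (rstar powr p / mscale) ^ k" for k w
  proof -
    let ?n = "height w"
    let ?N = "height w + k"
    let ?c = "c * rstar ^ height w"
    have cpos: "0 < ?c" using c rstar by simp
    define \<delta> where "\<delta> v = infdist (\<xi> v) (K w)" for v
    define H where "H v = 1 - min 1 (\<delta> v / ?c)" for v
    have rk: "rstar ^ (?n + k) \<le> rstar ^ ?n" using rstar by (intro power_decreasing) auto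
    have \<delta>0: "0 \<le> \<delta> v" for v by (simp add: \<delta>_def infdist_nonneg)
    have bumpH: "bump k w H" unfolding bump_def
    proof (intro conjI ballI allI impI)
      fix v assume "v \<in> desc k w"
      then have "\<xi> v \<in> K w" using \<xi> K_mono_desc by blast
      then show "H v = 1" using cpos by (simp add: H_def \<delta>_def)
    next
      fix v assume v: "height v = ?N" "(parent ^^ k) v \<notin> near Mstar w"
      obtain y where y: "y \<in> K w" "\<delta> v = dist (\<xi> v) y"
        using infdist_cell_attained unfolding \<delta>_def by blast
      have "?c \<le> dist (\<xi> v) y"
        using v \<xi>[of v] K_ancestor[of v k] y(1) by (intro c(2)[of "(parent ^^ k) v"]) (auto simp: height_ancestor)
      then have "1 \<le> \<delta> v / ?c" using cpos y(2) by (simp add: pos_le_divide_eq)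
      then show "H v = 0" unfolding H_def by simp
    qed
    define V where "V = {v \<in> level ?N. \<delta> v < ?c + 2 * c2 * rstar ^ ?n}"
    have finV: "finite V" by (rule finite_subset[OF _ finite_level[of ?N]]) (auto simp: V_def)
    have \<delta>diff: "\<bar>\<delta> u - \<delta> v\<bar> \<le> 2 * c2 * rstar ^ ?N" if uv: "adj u v" "height u = ?N" for u v
    proof -
      obtain z where z: "z \<in> K u" "z \<in> K v" using uv by (auto simp: adj_def)
      have hv: "height v = ?N" using uv by (simp add: adj_def)
      have "\<bar>\<delta> u - \<delta> v\<bar> \<le> dist (\<xi> u) (\<xi> v)" unfolding \<delta>_def by (rule infdist_triangle_abs)
      also have "\<dots> \<le> dist (\<xi> u) z + dist z (\<xi> v)" by (rule dist_triangle)
      also have "\<dots> \<le> c2 * rstar ^ ?N + c2 * rstar ^ ?N"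
        using dK[OF \<xi> z(1)] dK[OF z(2) \<xi>] uv(2) hv by simp
      finally show ?thesis by simp
    qed
    have Hdiff: "\<bar>H u - H v\<bar> \<le> 2 * c2 / c * rstar ^ k" if uv: "adj u v" "height u = ?N" for u v
    proof -
      have "\<bar>H u - H v\<bar> \<le> \<bar>\<delta> u / ?c - \<delta> v / ?c\<bar>" unfolding H_def by linarith
      also have "\<dots> = \<bar>\<delta> u - \<delta> v\<bar> / ?c" using cpos by (simp add: diff_divide_distrib[symmetric])
      also have "\<dots> \<le> 2 * c2 * rstar ^ ?N / ?c" using \<delta>diff[OF uv] cpos by (intro divide_right_mono) auto
      also have "\<dots> = 2 * c2 / c * rstar ^ k" using rstar c by (simp add: power_add)
      finally show ?thesis .
    qed
    have supp: "u \<in> V" if uv: "adj u v" "height u = ?N" "H u \<noteq> H v" for u v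
    proof (rule ccontr)
      assume "u \<notin> V"
      then have "\<delta> u \<ge> ?c + 2 * c2 * rstar ^ ?n" using uv by (simp add: V_def)
      moreover have "2 * c2 * rstar ^ ?N \<le> 2 * c2 * rstar ^ ?n" using rk c2 by simp
      moreover have "0 < 2 * c2 * rstar ^ ?n" using c2 rstar by simp
      ultimately have "\<delta> u \<ge> ?c" "\<delta> v \<ge> ?c" using \<delta>diff[OF uv(1,2)] unfolding abs_le_iff by linarith+
      then have "1 \<le> \<delta> u / ?c" "1 \<le> \<delta> v / ?c" using cpos by (simp_all add: pos_le_divide_eq)
      then show False using uv(3) by (simp add: H_def)
    qed
    have cardV: "real (card V) * (a * mscale ^ ?N) \<le> CA * R powr Q * mscale ^ ?n"
    proof -
      have "real (card V) * (a * mscale ^ ?N) \<le> measure m (ball (\<xi> w) (R * rstar ^ ?n))"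
      proof (rule card_cells_le)
        show "V \<subseteq> level ?N" by (auto simp: V_def)
        show "a * mscale ^ ?N \<le> measure m (K v)" if "v \<in> V" for v using a(2)[of v] that by (simp add: V_def)
        show "(\<Union>v\<in>V. K v) \<subseteq> ball (\<xi> w) (R * rstar ^ ?n)"
        proof
          fix y assume "y \<in> (\<Union>v\<in>V. K v)"
          then obtain v where v: "v \<in> V" "y \<in> K v" by blast
          obtain z where z: "z \<in> K w" "\<delta> v = dist (\<xi> v) z"
            using infdist_cell_attained unfolding \<delta>_def by blast
          have "dist (\<xi> w) y \<le> dist (\<xi> w) z + dist z (\<xi> v) + dist (\<xi> v) y"
            using dist_triangle[of "\<xi> w" y z] dist_triangle[of z y "\<xi> v"] by linarith
          also have "\<dots> < c2 * rstar ^ ?n + (?c + 2 * c2 * rstar ^ ?n) + c2 * rstar ^ ?n"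
          proof -
            have "dist (\<xi> v) y \<le> c2 * rstar ^ ?N" using dK[OF \<xi> v(2)] v(1) by (simp add: V_def)
            also have "\<dots> \<le> c2 * rstar ^ ?n" using rk c2 by simp
            finally have 1: "dist (\<xi> v) y \<le> c2 * rstar ^ ?n" .
            have 2: "dist z (\<xi> v) < ?c + 2 * c2 * rstar ^ ?n" using v(1) z by (simp add: V_def dist_commute)
            show ?thesis using 1 2 dK[OF \<xi> z(1)] by linarith
          qed
          also have "\<dots> \<le> R * rstar ^ ?n" using c2(1) rstar by (simp add: R_def algebra_simps)
          finally show "y \<in> ball (\<xi> w) (R * rstar ^ ?n)" by simp
        qed
      qed (simp add: borel_open)
      also have "\<dots> \<le> CA * (R * rstar ^ ?n) powr Q" using R rstar by (intro ball_upper) auto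
      also have "\<dots> = CA * R powr Q * mscale ^ ?n" using R by (simp add: powr_mscale)
      finally show ?thesis .
    qed
    define \<eta> where "\<eta> = (2 * c2 / c * rstar ^ k) powr p"
    have \<eta>: "0 \<le> \<eta>" "\<eta> = (2 * c2 / c) powr p * (rstar powr p) ^ k"
    proof -
      have "(rstar ^ k) powr p = (rstar powr p) ^ k"
        using rstar by (simp add: powr_realpow[symmetric] powr_powr mult.commute)
      then show "\<eta> = (2 * c2 / c) powr p * (rstar powr p) ^ k" using c c2 rstar unfolding \<eta>_def by (subst powr_mult) auto
    qed (simp add: \<eta>_def)
    have "(\<Sum>(u, v)\<in>edge_pairs ?N (level ?N). \<bar>H u - H v\<bar> powr p) \<le> (\<Sum>(u, v)\<in>(SIGMA u:V. near 1 u). \<eta>)"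
    proof -
      have fS: "finite (SIGMA u:V. near 1 u)" by (intro finite_SigmaI finV finite_near)
      have "(\<Sum>(u, v)\<in>edge_pairs ?N (level ?N). \<bar>H u - H v\<bar> powr p)
          = (\<Sum>(u, v)\<in>{(u, v) \<in> edge_pairs ?N (level ?N). H u \<noteq> H v}. \<bar>H u - H v\<bar> powr p)"
        by (intro sum.mono_neutral_right finite_edge_pairs) auto
      also have "\<dots> \<le> (\<Sum>(u, v)\<in>{(u, v) \<in> edge_pairs ?N (level ?N). H u \<noteq> H v}. \<eta>)"
      proof (rule sum_mono, clarify)
        fix u v assume "(u, v) \<in> edge_pairs ?N (level ?N)"
        then show "\<bar>H u - H v\<bar> powr p \<le> \<eta>"
          unfolding \<eta>_def using p by (intro powr_mono2 Hdiff) auto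
      qed
      also have "\<dots> \<le> (\<Sum>(u, v)\<in>(SIGMA u:V. near 1 u). \<eta>)"
      proof (rule sum_mono2[OF fS])
        show "{(u, v) \<in> edge_pairs ?N (level ?N). H u \<noteq> H v} \<subseteq> (SIGMA u:V. near 1 u)"
          using supp by auto
      qed (use \<eta> in auto)
      finally show ?thesis .
    qed
    also have "\<dots> = (\<Sum>u\<in>V. real (card (near 1 u)) * \<eta>)"
      by (subst sum.Sigma[symmetric], rule finV, rule ballI, rule finite_near) simp
    also have "\<dots> \<le> (\<Sum>u\<in>V. real D * \<eta>)"
      using D \<eta> by (intro sum_mono mult_right_mono) (auto simp del: near.simps)
    also have "\<dots> = real (card V) * (real D * \<eta>)" by simp
    also have "\<dots> \<le> (CA * R powr Q / a / mscale ^ k) * (real D * \<eta>)"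
    proof (intro mult_right_mono)
      show "real (card V) \<le> CA * R powr Q / a / mscale ^ k"
        using cardV a(1) mscale by (simp add: power_add field_simps)
    qed (use \<eta> in auto)
    also have "\<dots> = C * (rstar powr p / mscale) ^ k" by (simp add: C_def \<eta>(2) power_divide)
    finally have "2 * energy p ?N (level ?N) H \<le> C * (rstar powr p / mscale) ^ k" by (simp add: energy_eq)
    then have "energy p ?N (level ?N) H \<le> C * (rstar powr p / mscale) ^ k"
      using energy_nonneg[of p ?N "level ?N" H] by linarith
    then show ?thesis using bumpH by blast
  qed
  then show ?thesis using C cap_const_le by blast
qed

end

section \<open>Refinement of capacity functions\<close>

context homogeneous_framework
begin

(* Unfolded into a bounded existential, neighbourhoods are no longer recognized by the rules about near. *)
declare near.simps(2) [simp del]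

lemma energy_Max_le:
  assumes "finite W" "W \<noteq> {}"
  shows "energy p n A (\<lambda>v. Max ((\<lambda>w. H w v) ` W)) \<le> (\<Sum>w\<in>W. energy p n A (H w))"
proof -
  have "(\<Sum>(u, v)\<in>edge_pairs n A. \<bar>Max ((\<lambda>w. H w u) ` W) - Max ((\<lambda>w. H w v) ` W)\<bar> powr p)
      \<le> (\<Sum>e\<in>edge_pairs n A. \<Sum>w\<in>W. case e of (u, v) \<Rightarrow> \<bar>H w u - H w v\<bar> powr p)"
  proof (rule sum_mono)
    fix e :: "'t \<times> 't"
    obtain u v where e: "e = (u, v)" by (cases e)
    obtain w where w: "w \<in> W" "\<bar>Max ((\<lambda>w. H w u) ` W) - Max ((\<lambda>w. H w v) ` W)\<bar> \<le> \<bar>H w u - H w v\<bar>"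
      using Max_image_diff[OF assms, of "\<lambda>w. H w u" "\<lambda>w. H w v"] by blast
    have "\<bar>Max ((\<lambda>w. H w u) ` W) - Max ((\<lambda>w. H w v) ` W)\<bar> powr p \<le> \<bar>H w u - H w v\<bar> powr p"
      using w p by (intro powr_mono2) auto
    also have "\<dots> \<le> (\<Sum>w\<in>W. \<bar>H w u - H w v\<bar> powr p)"
      using assms w by (intro member_le_sum[of w W "\<lambda>w. \<bar>H w u - H w v\<bar> powr p"]) auto
    finally show "(case e of (u, v) \<Rightarrow> \<bar>Max ((\<lambda>w. H w u) ` W) - Max ((\<lambda>w. H w v) ` W)\<bar> powr p)
       \<le> (\<Sum>w\<in>W. case e of (u, v) \<Rightarrow> \<bar>H w u - H w v\<bar> powr p)" by (simp add: e)
  qed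
  also have "\<dots> = (\<Sum>w\<in>W. \<Sum>(u, v)\<in>edge_pairs n A. \<bar>H w u - H w v\<bar> powr p)" by (rule sum.swap)
  finally show ?thesis unfolding energy_eq sum_divide_distrib[symmetric] by (intro divide_right_mono) auto
qed

text \<open>A function on level \<open>n\<close> is transported to level \<open>n + l\<close> by means of the partition of unity
  obtained by normalizing the bumps of its vertices. The increment of the result across an edge is
  bounded by a sum of products of an increment of \<open>F\<close> between nearby vertices and an increment of a nearby bump,
  so that energies multiply.\<close>

lemma refinement_energy:
  "\<exists>C>0. \<forall>n l F H d. 
     (\<forall>v\<in>level n. bump l v (H v) \<and> (\<forall>x. 0 \<le> H v x \<and> H v x \<le> 1) \<and> energy p (n + l) (level (n + l)) (H v) \<le> d) \<longrightarrow>
     energy p (n + l) (level (n + l)) (\<lambda>x. (\<Sum>v\<in>level n. F v * H v x) / (\<Sum>v\<in>level n. H v x))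
       \<le> C * energy p n (level n) F * d"
proof -
  let ?M = "Suc Mstar"
  obtain D where D: "D \<ge> 1" "\<And>w. card (near ?M w) \<le> D" using card_near_bounded by blast
  define C where "C = (2 powr p * real D powr p * real D powr p) * (real D * (real ?M powr p * real D) * real D)"
  have "energy p (n + l) (level (n + l)) (\<lambda>x. (\<Sum>v\<in>level n. F v * H v x) / (\<Sum>v\<in>level n. H v x))
       \<le> C * energy p n (level n) F * d"
    if H: "\<And>v. v \<in> level n \<Longrightarrow> bump l v (H v)" "\<And>v x. v \<in> level n \<Longrightarrow> 0 \<le> H v x" "\<And>v x. v \<in> level n \<Longrightarrow> H v x \<le> 1"
      and e: "\<And>v. v \<in> level n \<Longrightarrow> energy p (n + l) (level (n + l)) (H v) \<le> d" for n l F d and H :: "'t \<Rightarrow> 't \<Rightarrow> real"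
  proof -
    let ?anc = "\<lambda>x. (parent ^^ l) x"
    define S where "S x = (\<Sum>v\<in>level n. H v x)" for x
    define G where "G x = (\<Sum>v\<in>level n. F v * H v x) / S x" for x
    define A where "A v0 = (\<Sum>v\<in>near ?M v0. \<bar>F v - F v0\<bar> powr p)" for v0
    define T where "T v0 x x' = (\<Sum>v\<in>near ?M v0. \<bar>H v x - H v x'\<bar> powr p)" for v0 x x'
    define c where "c = 2 powr p * real D powr p * real D powr p"
    have A0: "0 \<le> A v" for v unfolding A_def by (intro sum_nonneg) auto
    have d0: "0 \<le> d"
    proof -
      obtain v where "v \<in> level n" using desc_nonempty[of n root] level_desc_root by blast
      then show ?thesis using e[of v] energy_nonneg[of p "n + l" "level (n + l)" "H v"] by linarith
    qed
    have near_level: "v \<in> level n" if "v \<in> near ?M v0" "v0 \<in> level n" for v v0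
      using height_near[OF that(1)] that(2) by simp
    have S1: "1 \<le> S x" if x: "x \<in> level (n + l)" for x
    proof -
      have a: "?anc x \<in> level n" using x by (simp add: height_ancestor)
      have "H (?anc x) x = 1" using H(1)[OF a] desc_self_ancestor[of l x] x by (auto simp: bump_def)
      then show ?thesis unfolding S_def using member_le_sum[OF a, of "\<lambda>v. H v x"] H(2) finite_level by simp
    qed
    have Hsupp: "v \<in> near Mstar (?anc x)" if "v \<in> level n" "x \<in> level (n + l)" "H v x \<noteq> 0" for v x
    proof -
      have "?anc x \<in> near Mstar v" using H(1)[OF that(1)] that by (auto simp: bump_def)
      then show ?thesis by (rule near_sym)
    qed
    have step: "\<bar>G x - G x'\<bar> powr p \<le> c * A (?anc x) * T (?anc x) x x'" if xx: "(x, x') \<in> edge_pairs (n + l) (level (n + l))" for x x'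
    proof -
      let ?v0 = "?anc x"
      let ?V = "near ?M ?v0"
      have x: "x \<in> level (n + l)" "x' \<in> level (n + l)" "adj x x'" using xx by auto
      have v0: "?v0 \<in> level n" using x by (simp add: height_ancestor)
      have adjv: "adj ?v0 (?anc x')" using x(3) by (rule adj_ancestor)
      have V: "?V \<subseteq> level n" using near_level v0 by blast
      have out: "H v x = 0" "H v x' = 0" if v: "v \<in> level n - ?V" for v
      proof -
        have "near Mstar ?v0 \<subseteq> ?V" by (rule near_mono) simp
        then show "H v x = 0" using Hsupp[of v x] v x by blast
        have "?anc x' \<in> near 1 ?v0" using adjv by (simp only: near_one mem_Collect_eq)
        then have "near Mstar (?anc x') \<subseteq> near (1 + Mstar) ?v0" using near_trans by blast
        then have "near Mstar (?anc x') \<subseteq> ?V" by simp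
        then show "H v x' = 0" using Hsupp[of v x'] v x by blast
      qed
      have SV: "S y = (\<Sum>v\<in>?V. H v y)" "G y = (\<Sum>v\<in>?V. F v * H v y) / S y" if "y = x \<or> y = x'" for y
        unfolding S_def G_def using out V finite_level that
        by (auto intro!: sum.mono_neutral_right arg_cong2[where f = "(/)"])
      define \<tau> where "\<tau> = (\<Sum>v\<in>?V. \<bar>H v x - H v x'\<bar>)"
      have \<tau>: "\<bar>S x - S x'\<bar> \<le> \<tau>" unfolding \<tau>_def SV(1)[of x, simplified] SV(1)[of x', simplified]
        by (simp add: sum_subtractf[symmetric] sum_abs)
      have \<tau>0: "0 \<le> \<tau>" unfolding \<tau>_def by (intro sum_nonneg) auto
      have Sx: "1 \<le> S x" "1 \<le> S x'" using S1 x by auto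
      have \<phi>: "\<bar>H v x / S x - H v x' / S x'\<bar> \<le> 2 * \<tau>" if v: "v \<in> ?V" for v
      proof -
        have hv: "0 \<le> H v x'" "H v x' \<le> S x'"
        proof -
          show "0 \<le> H v x'" using H(2) v V by blast
          show "H v x' \<le> S x'" unfolding S_def using member_le_sum[of v "level n" "\<lambda>v. H v x'"] H(2) finite_level v V by blast
        qed
        have "H v x / S x - H v x' / S x' = (H v x - H v x') / S x + (H v x' / S x') * ((S x' - S x) / S x)"
          using Sx by (simp add: field_simps)
        then have "\<bar>H v x / S x - H v x' / S x'\<bar> \<le> \<bar>H v x - H v x'\<bar> / S x + (H v x' / S x') * (\<bar>S x' - S x\<bar> / S x)"
          using Sx hv abs_triangle_ineq[of "(H v x - H v x') / S x" "(H v x' / S x') * ((S x' - S x) / S x)"]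
          by (simp add: abs_mult)
        also have "\<dots> \<le> \<bar>H v x - H v x'\<bar> / 1 + 1 * (\<bar>S x' - S x\<bar> / 1)"
          using Sx hv by (intro add_mono mult_mono divide_left_mono) auto
        also have "\<dots> \<le> \<tau> + \<tau>"
        proof (rule add_mono)
          show "\<bar>H v x - H v x'\<bar> / 1 \<le> \<tau>" 
            unfolding \<tau>_def using member_le_sum[OF v, of "\<lambda>v. \<bar>H v x - H v x'\<bar>"] finite_near by simp
        qed (use \<tau> in \<open>simp add: abs_minus_commute\<close>)
        finally show ?thesis by simp
      qed
      have "(\<Sum>v\<in>?V. F ?v0 * (H v y / S y)) = F ?v0" if "y = x \<or> y = x'" for y
      proof -
        have "S y \<noteq> 0" using Sx that by auto
        then show ?thesis using SV(1)[OF that] by (simp add: sum_distrib_left[symmetric] sum_divide_distrib[symmetric])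
      qed
      note one = this[of x, simplified] this[of x', simplified]
      \<comment> \<open>Both normalized families sum to one, so the value of \<open>F\<close> at \<open>?v0\<close> may be subtracted.\<close>
      have "G x - G x' = (\<Sum>v\<in>?V. F v * (H v x / S x)) - (\<Sum>v\<in>?V. F v * (H v x' / S x'))"
        using SV(2)[of x] SV(2)[of x'] by (simp add: sum_divide_distrib)
      also have "\<dots> = (\<Sum>v\<in>?V. F v * (H v x / S x)) - (\<Sum>v\<in>?V. F ?v0 * (H v x / S x))
         - ((\<Sum>v\<in>?V. F v * (H v x' / S x')) - (\<Sum>v\<in>?V. F ?v0 * (H v x' / S x')))"
        using one by simp
      also have "\<dots> = (\<Sum>v\<in>?V. (F v - F ?v0) * (H v x / S x - H v x' / S x'))"
        unfolding sum_subtractf[symmetric] by (intro sum.cong) (auto simp: algebra_simps)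
      finally have "\<bar>G x - G x'\<bar> \<le> (\<Sum>v\<in>?V. \<bar>F v - F ?v0\<bar> * \<bar>H v x / S x - H v x' / S x'\<bar>)"
        using sum_abs[of "\<lambda>v. (F v - F ?v0) * (H v x / S x - H v x' / S x')" ?V] by (simp add: abs_mult)
      also have "\<dots> \<le> (\<Sum>v\<in>?V. \<bar>F v - F ?v0\<bar> * (2 * \<tau>))"
        using \<phi> by (intro sum_mono mult_left_mono) auto
      also have "\<dots> = 2 * (\<Sum>v\<in>?V. \<bar>F v - F ?v0\<bar>) * \<tau>" by (simp add: sum_distrib_left sum_distrib_right mult_ac)
      finally have "\<bar>G x - G x'\<bar> powr p \<le> (2 * (\<Sum>v\<in>?V. \<bar>F v - F ?v0\<bar>) * \<tau>) powr p"
        using p by (intro powr_mono2) auto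
      also have "\<dots> = 2 powr p * (\<Sum>v\<in>?V. \<bar>F v - F ?v0\<bar>) powr p * \<tau> powr p"
        using \<tau>0 by (simp add: powr_mult sum_nonneg)
      also have "\<dots> \<le> 2 powr p * (real D powr p * A ?v0) * (real D powr p * T ?v0 x x')"
        unfolding \<tau>_def A_def T_def using p D finite_near
        by (intro mult_mono mult_left_mono sum_powr_le mult_nonneg_nonneg sum_nonneg) auto
      finally show ?thesis by (simp add: c_def mult_ac)
    qed
    have Tsum: "(\<Sum>(x, x')\<in>{e \<in> edge_pairs (n + l) (level (n + l)). ?anc (fst e) = v0}. T v0 x x') \<le> real D * (2 * d)"
      if v0: "v0 \<in> level n" for v0
    proof -
      have "(\<Sum>(x, x')\<in>{e \<in> edge_pairs (n + l) (level (n + l)). ?anc (fst e) = v0}. T v0 x x')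
         \<le> (\<Sum>(x, x')\<in>edge_pairs (n + l) (level (n + l)). T v0 x x')"
        by (intro sum_mono2 finite_edge_pairs) (auto simp: T_def intro!: sum_nonneg)
      also have "\<dots> = (\<Sum>e\<in>edge_pairs (n + l) (level (n + l)). \<Sum>v\<in>near ?M v0. case e of (x, x') \<Rightarrow> \<bar>H v x - H v x'\<bar> powr p)"
        by (intro sum.cong refl) (auto simp: T_def)
      also have "\<dots> = (\<Sum>v\<in>near ?M v0. \<Sum>(x, x')\<in>edge_pairs (n + l) (level (n + l)). \<bar>H v x - H v x'\<bar> powr p)"
        by (rule sum.swap)
      also have "\<dots> = (\<Sum>v\<in>near ?M v0. 2 * energy p (n + l) (level (n + l)) (H v))" by (simp add: energy_eq)
      also have "\<dots> \<le> (\<Sum>v\<in>near ?M v0. 2 * d)" using e near_level v0 by (intro sum_mono) auto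
      also have "\<dots> = real (card (near ?M v0)) * (2 * d)" by simp
      also have "\<dots> \<le> real D * (2 * d)" using D(2)[of v0] d0 by (intro mult_right_mono of_nat_mono) auto
      finally show ?thesis .
    qed
    have Asum: "(\<Sum>v0\<in>level n. A v0) \<le> real D * (real ?M powr p * real D) * energy p n (level n) F"
    proof -
      have "(\<Sum>v0\<in>level n. A v0) \<le> (\<Sum>v0\<in>level n. real D * (real ?M powr p * energy p n (near ?M v0) F))"
      proof (rule sum_mono)
        fix v0 assume v0: "v0 \<in> level n"
        have "A v0 \<le> (\<Sum>v\<in>near ?M v0. real ?M powr p * energy p n (near ?M v0) F)"
          unfolding A_def using near_increment[of p _ ?M v0 F] p v0 by (intro sum_mono) (auto simp del: near.simps)
        also have "\<dots> = real (card (near ?M v0)) * (real ?M powr p * energy p n (near ?M v0) F)" by simp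
        also have "\<dots> \<le> real D * (real ?M powr p * energy p n (near ?M v0) F)"
          using D(2)[of v0] energy_nonneg by (intro mult_right_mono of_nat_mono mult_nonneg_nonneg) auto
        finally show "A v0 \<le> real D * (real ?M powr p * energy p n (near ?M v0) F)" .
      qed
      also have "\<dots> = real D * real ?M powr p * (\<Sum>v0\<in>level n. energy p n (near ?M v0) F)"
        by (simp add: sum_distrib_left mult_ac)
      also have "\<dots> \<le> real D * real ?M powr p * (real D * energy p n (level n) F)"
      proof (intro mult_left_mono energy_overlap finite_level)
        show "near ?M i \<subseteq> level n" if "i \<in> level n" for i using near_level that by blast
        show "card {i \<in> level n. u \<in> near ?M i} \<le> D" for u
        proof -
          have "card {i \<in> level n. u \<in> near ?M i} \<le> card (near ?M u)"
            by (intro card_mono finite_near) (use near_sym in blast)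
          then show ?thesis using D(2)[of u] by simp
        qed
      qed auto
      finally show ?thesis by (simp add: mult_ac)
    qed
    have "(\<Sum>(x, x')\<in>edge_pairs (n + l) (level (n + l)). \<bar>G x - G x'\<bar> powr p)
       \<le> (\<Sum>(x, x')\<in>edge_pairs (n + l) (level (n + l)). c * A (?anc x) * T (?anc x) x x')"
      using step by (intro sum_mono) auto
    also have "\<dots> = (\<Sum>v0\<in>level n. \<Sum>(x, x')\<in>{e \<in> edge_pairs (n + l) (level (n + l)). ?anc (fst e) = v0}. c * A (?anc x) * T (?anc x) x x')"
      by (rule sum.group[symmetric, OF finite_edge_pairs finite_level]) (auto simp: height_ancestor)
    also have "\<dots> = (\<Sum>v0\<in>level n. c * A v0 * (\<Sum>(x, x')\<in>{e \<in> edge_pairs (n + l) (level (n + l)). ?anc (fst e) = v0}. T v0 x x'))"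
      unfolding sum_distrib_left by (intro sum.cong refl) auto
    also have "\<dots> \<le> (\<Sum>v0\<in>level n. c * A v0 * (real D * (2 * d)))"
      using Tsum A0 by (intro sum_mono mult_left_mono) (auto simp: c_def)
    also have "\<dots> = c * (real D * (2 * d)) * (\<Sum>v0\<in>level n. A v0)" by (simp add: sum_distrib_left mult_ac)
    also have "\<dots> \<le> c * (real D * (2 * d)) * (real D * (real ?M powr p * real D) * energy p n (level n) F)"
      using Asum d0 by (intro mult_left_mono) (auto simp: c_def)
    finally have "2 * energy p (n + l) (level (n + l)) G \<le> 2 * (C * energy p n (level n) F * d)"
      by (simp add: energy_eq[of p "n + l"] C_def c_def mult_ac)
    then show ?thesis by (simp add: G_def[abs_def] S_def)
  qed
  moreover have "0 < C" using D(1) by (simp add: C_def)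
  ultimately show ?thesis by (intro exI[of _ C] conjI allI impI) (assumption, simp)
qed

text \<open>Capacity functions are first put around all descendants \<open>j = 2 Mstar\<close> generations below
  \<open>w\<close>: a chain of \<open>3 Mstar\<close> cells of that level projects to one of \<open>Mstar\<close> cells at the
  level of \<open>w\<close>, which leaves room both for a neighbourhood on which the first function equals one and for
  the supports of the partition of unity.\<close>

lemma cap_const_submultiplicative_shift:
  "\<exists>C>0. \<forall>k l c d. cap_const Mstar p k < ennreal c \<longrightarrow> cap_const Mstar p l < ennreal d \<longrightarrow>
     cap_const Mstar p (2 * Mstar + k + l) \<le> ennreal (C * c * d)"
proof -
  let ?j = "2 * Mstar"
  obtain C1 where C1: "0 < C1" "\<forall>n l F H d.
     (\<forall>v\<in>level n. bump l v (H v) \<and> (\<forall>x. 0 \<le> H v x \<and> H v x \<le> 1) \<and> energy p (n + l) (level (n + l)) (H v) \<le> d) \<longrightarrow>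
     energy p (n + l) (level (n + l)) (\<lambda>x. (\<Sum>v\<in>level n. F v * H v x) / (\<Sum>v\<in>level n. H v x))
       \<le> C1 * energy p n (level n) F * d"
    using refinement_energy by (elim exE conjE) (rule that, assumption+)
  obtain D where D: "D \<ge> 1" "\<And>w. card (near Mstar w) \<le> D" using card_near_bounded by blast
  obtain D' where D': "D' \<ge> 1" "\<And>k w. real (card (desc k w)) \<le> D' / mscale ^ k" using card_desc_le by blast
  define N where "N = D' / mscale ^ ?j * real D"
  have N: "0 < N" using D D' mscale by (simp add: N_def)
  have "cap_const Mstar p (?j + k + l) \<le> ennreal (C1 * N * c * d)"
    if c: "cap_const Mstar p k < ennreal c" and d: "cap_const Mstar p l < ennreal d" for k l c d
  proof (rule cap_const_le)
    fix w
    have c0: "0 < c" using c by (metis ennreal_eq_0_iff not_less_zero not_le)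
    have d0: "0 < d" using d by (metis ennreal_eq_0_iff not_less_zero not_le)
    let ?n = "height w + ?j + k"
    have p0: "0 \<le> p" using p by simp
    obtain H1 where H1: "\<And>u. bump k u (H1 u)" "\<And>u v. 0 \<le> H1 u v \<and> H1 u v \<le> 1"
       "\<And>u. energy p (height u + k) (level (height u + k)) (H1 u) \<le> c"
      using ex_bump[OF c p0] by metis
    obtain H2 where H2: "\<And>u. bump l u (H2 u)" "\<And>u v. 0 \<le> H2 u v \<and> H2 u v \<le> 1"
       "\<And>u. energy p (height u + l) (level (height u + l)) (H2 u) \<le> d"
      using ex_bump[OF d p0] by metis
    define W where "W = (\<Union>z\<in>desc ?j w. near Mstar z)"
    have finW: "finite W" unfolding W_def using finite_desc finite_near by blast
    have W0: "W \<noteq> {}" unfolding W_def using desc_nonempty[of ?j w] near_self by blast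
    have hW: "height u = height w + ?j" if "u \<in> W" for u
      using that height_near unfolding W_def by (fastforce simp: desc_iff)
    have cardW: "real (card W) \<le> N"
    proof -
      have "card W \<le> (\<Sum>z\<in>desc ?j w. card (near Mstar z))" unfolding W_def by (rule card_UN_le[OF finite_desc])
      also have "\<dots> \<le> (\<Sum>z\<in>desc ?j w. D)" by (intro sum_mono D)
      finally have "real (card W) \<le> real (card (desc ?j w)) * real D" by (simp flip: of_nat_mult)
      also have "\<dots> \<le> N" unfolding N_def by (intro mult_right_mono D') auto
      finally show ?thesis .
    qed
    \<comment> \<open>The maximum equals one below the \<open>Mstar\<close>-neighbourhood of the descendants \<open>?j\<close> generations below \<open>w\<close>.\<close>
    define F where "F v = Max ((\<lambda>u. H1 u v) ` W)" for v
    have F_le: "F v \<le> 1" for v unfolding F_def using finW W0 H1(2) by (intro Max.boundedI) auto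
    have F_ge: "H1 u v \<le> F v" if "u \<in> W" for u v unfolding F_def using finW that by (intro Max_ge) auto
    have F1: "F v = 1" if v: "height v = ?n" "(parent ^^ k) v \<in> W" for v
    proof -
      have "v \<in> desc k ((parent ^^ k) v)" using v by (intro desc_self_ancestor) simp
      then have "H1 ((parent ^^ k) v) v = 1" using H1(1) by (auto simp: bump_def)
      then show ?thesis using F_ge[OF v(2), of v] F_le[of v] by simp
    qed
    have F0: "\<exists>u\<in>W. (parent ^^ k) v \<in> near Mstar u" if v: "height v = ?n" "F v \<noteq> 0" for v
    proof (rule ccontr)
      assume "\<not> ?thesis"
      then have "H1 u v = 0" if "u \<in> W" for u using H1(1)[of u] that v hW[OF that] by (auto simp: bump_def)
      then have "(\<lambda>u. H1 u v) ` W = {0}" using W0 by auto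
      then show False using v by (simp add: F_def)
    qed
    have eF: "energy p ?n (level ?n) F \<le> N * c"
    proof -
      have "energy p ?n (level ?n) F \<le> (\<Sum>u\<in>W. energy p ?n (level ?n) (H1 u))"
        unfolding F_def[abs_def] by (rule energy_Max_le[OF finW W0])
      also have "\<dots> \<le> (\<Sum>u\<in>W. c)" using H1(3) hW by (intro sum_mono) metis
      also have "\<dots> \<le> N * c" using cardW c0 by (simp add: mult_right_mono)
      finally show ?thesis .
    qed
    define S where "S x = (\<Sum>v\<in>level ?n. H2 v x)" for x
    define G where "G x = (\<Sum>v\<in>level ?n. F v * H2 v x) / S x" for x
    have "energy p (?n + l) (level (?n + l)) (H2 v) \<le> d" if "v \<in> level ?n" for v
      using H2(3)[of v] that by simp
    then have "energy p (?n + l) (level (?n + l)) G \<le> C1 * energy p ?n (level ?n) F * d"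
      unfolding G_def[abs_def] S_def using H2(1,2) by (intro C1(2)[rule_format]) blast
    also have "\<dots> \<le> C1 * (N * c) * d" using eF C1(1) d0 by (intro mult_right_mono mult_left_mono) auto
    finally have eG: "energy p (height w + (?j + k + l)) (level (height w + (?j + k + l))) G \<le> C1 * N * c * d"
      by (simp add: mult_ac add_ac)
    have key: "v \<in> near Mstar ((parent ^^ l) x)" if "height x = ?n + l" "height v = ?n" "H2 v x \<noteq> 0" for x v
    proof -
      have "(parent ^^ l) x \<in> near Mstar v" using H2(1)[of v] that by (auto simp: bump_def)
      then show ?thesis by (rule near_sym)
    qed
    have anc: "(parent ^^ (?j + k + l)) x = (parent ^^ ?j) ((parent ^^ k) ((parent ^^ l) x))" for x
      by (simp add: funpow_add)
    have "bump (?j + k + l) w G" unfolding bump_def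
    proof (intro conjI ballI allI impI)
      fix x assume x: "x \<in> desc (?j + k + l) w"
      have hx: "height x = ?n + l" using x by (simp add: desc_iff)
      let ?v0 = "(parent ^^ l) x"
      have v0: "(parent ^^ k) ?v0 \<in> desc ?j w"
        using x anc[of x] by (auto simp: desc_iff height_ancestor)
      have "F v * H2 v x = H2 v x" if v: "v \<in> level ?n" for v
      proof (cases "H2 v x = 0")
        case False
        have "v \<in> near Mstar ?v0" using key[OF hx _ False] v by simp
        then have "(parent ^^ k) v \<in> near Mstar ((parent ^^ k) ?v0)" by (rule near_ancestor)
        then have "(parent ^^ k) v \<in> W" using v0 by (auto simp: W_def)
        then show ?thesis using F1 v by simp
      qed simp
      then have GS: "G x = S x / S x" unfolding G_def S_def by (intro arg_cong2[where f="(/)"] sum.cong) auto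
      have "?v0 \<in> level ?n" using hx by (simp add: height_ancestor)
      moreover have "H2 ?v0 x = 1" using H2(1)[of ?v0] desc_self_ancestor[of l x] hx by (auto simp: bump_def)
      ultimately have "1 \<le> S x" unfolding S_def
        using member_le_sum[of ?v0 "level ?n" "\<lambda>v. H2 v x"] H2(2) finite_level by simp
      then show "G x = 1" using GS by simp
    next
      fix x assume x: "height x = height w + (?j + k + l)" "(parent ^^ (?j + k + l)) x \<notin> near Mstar w"
      have hx: "height x = ?n + l" using x by simp
      let ?v0 = "(parent ^^ l) x"
      have "F v * H2 v x = 0" if v: "v \<in> level ?n" for v
      proof (rule ccontr)
        assume "F v * H2 v x \<noteq> 0"
        then have nz: "F v \<noteq> 0" "H2 v x \<noteq> 0" by auto
        have "v \<in> near Mstar ?v0" using key[OF hx _ nz(2)] v by simp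
        then have 1: "(parent ^^ k) ?v0 \<in> near Mstar ((parent ^^ k) v)" using near_ancestor near_sym by blast
        obtain u where u: "u \<in> W" "(parent ^^ k) v \<in> near Mstar u" using F0 nz v by auto
        obtain z where z: "z \<in> desc ?j w" "u \<in> near Mstar z" using u by (auto simp: W_def)
        have "(parent ^^ k) ?v0 \<in> near (Mstar + Mstar + Mstar) z"
          using near_trans[OF near_trans[OF z(2) u(2)] 1] .
        then have "(parent ^^ k) ?v0 \<in> near (Mstar + ?j) z" by (simp add: mult_2 add.assoc)
        then have "(parent ^^ ?j) ((parent ^^ k) ?v0) \<in> near Mstar ((parent ^^ ?j) z)" by (rule near_contract)
        then show False using x(2) z(1) anc[of x] by (simp add: desc_iff)
      qed
      then have "(\<Sum>v\<in>level ?n. F v * H2 v x) = 0" by (intro sum.neutral) blast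
      then show "G x = 0" unfolding G_def by simp
    qed
    then show "\<exists>H. bump (?j + k + l) w H \<and>
         energy p (height w + (?j + k + l)) (level (height w + (?j + k + l))) H \<le> C1 * N * c * d" using eG by blast
  qed
  then show ?thesis using C1(1) N by (intro exI[of _ "C1 * N"]) auto
qed

end

section \<open>The scaling factor\<close>

lemma power_bounded_le_one:
  fixes x :: real
  assumes "\<And>k. x ^ k \<le> C"
  shows "x \<le> 1"
  using real_arch_pow[of x C] assms by (meson not_le)

text \<open>A positive sequence that is both sub- and supermultiplicative up to constants is comparable with
  a geometric one: every \<open>(c * a k) powr (1 / k)\<close> is at most every \<open>(C * a l) powr (1 / l)\<close>, so the
  supremum of the former separates the two families.\<close>

lemma quasi_multiplicative_geometric:
  fixes a :: "nat \<Rightarrow> real"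
  assumes a: "\<And>k. 0 < a k" and c: "0 < c" and C: "0 < C"
    and sub: "\<And>k l. a (k + l) \<le> C * a k * a l" and super: "\<And>k l. c * a k * a l \<le> a (k + l)"
  shows "\<exists>t>0. \<forall>k. t ^ k / C \<le> a k \<and> a k \<le> t ^ k / c"
proof -
  have low: "(c * a k) ^ Suc l \<le> c * a (k * Suc l)" for k l
  proof (induction l)
    case (Suc l)
    have "(c * a k) ^ Suc (Suc l) = (c * a k) * (c * a k) ^ Suc l" by simp
    also have "\<dots> \<le> (c * a k) * (c * a (k * Suc l))" using Suc a[of k] c by (intro mult_left_mono) auto
    also have "\<dots> = c * (c * a k * a (k * Suc l))" by simp
    also have "\<dots> \<le> c * a (k + k * Suc l)" using super c by (intro mult_left_mono) auto
    finally show ?case by simp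
  qed simp
  have up: "C * a (k * Suc l) \<le> (C * a k) ^ Suc l" for k l
  proof (induction l)
    case (Suc l)
    have "C * a (k + k * Suc l) \<le> C * (C * a k * a (k * Suc l))" using sub C by (intro mult_left_mono) auto
    also have "\<dots> = (C * a k) * (C * a (k * Suc l))" by simp
    also have "\<dots> \<le> (C * a k) * (C * a k) ^ Suc l" using Suc a[of k] C by (intro mult_left_mono) auto
    finally show ?case by simp
  qed simp
  have c0: "c * a 0 \<le> 1" using super[of 0 0] a[of 0] by simp
  have C0: "1 \<le> C * a 0" using sub[of 0 0] a[of 0] by simp
  have cC: "c \<le> C"
  proof -
    have "c * a 0 \<le> C * a 0" using c0 C0 by linarith
    then show ?thesis using a[of 0] by simp
  qed
  have cmp: "(c * a k) powr (1 / k) \<le> (C * a l) powr (1 / l)" if kl: "1 \<le> k" "1 \<le> l" for k l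
  proof -
    have "(c * a k) ^ l \<le> c * a (k * l)" using low[of k "l - 1"] kl by simp
    also have "\<dots> \<le> C * a (l * k)" using cC a[of "k * l"] by (simp add: mult.commute mult_right_mono)
    also have "\<dots> \<le> (C * a l) ^ k" using up[of l "k - 1"] kl by simp
    finally have "((c * a k) ^ l) powr (1 / (real k * real l)) \<le> ((C * a l) ^ k) powr (1 / (real k * real l))"
      using a[of k] c by (intro powr_mono2) auto
    then show ?thesis using kl a[of k] a[of l] c C
      by (simp add: powr_realpow[symmetric] powr_powr)
  qed
  define S where "S = (\<lambda>k. (c * a k) powr (1 / real k)) ` {1..}"
  have bdd: "bdd_above S" unfolding S_def using cmp[where l = 1] by (intro bdd_aboveI[of _ "(C * a 1) powr (1 / real 1)"]) auto
  have ne: "S \<noteq> {}" by (auto simp: S_def)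
  define t where "t = Sup S"
  have t1: "(c * a k) powr (1 / k) \<le> t" if "1 \<le> k" for k
    unfolding t_def using that by (intro cSup_upper bdd) (auto simp: S_def)
  have t2: "t \<le> (C * a l) powr (1 / l)" if "1 \<le> l" for l
    unfolding t_def using cmp that by (intro cSup_least ne) (auto simp: S_def)
  have t0: "0 < t" using t1[of 1] a[of 1] c by (simp add: order_less_le_trans[rotated])
  have "t ^ k / C \<le> a k \<and> a k \<le> t ^ k / c" for k
  proof (cases "k = 0")
    case True
    then show ?thesis using c0 C0 c C by (simp add: field_simps)
  next
    case False
    have "((c * a k) powr (1 / k)) ^ k \<le> t ^ k" using False by (intro power_mono t1) auto
    moreover have "((c * a k) powr (1 / k)) ^ k = c * a k"
      using False a[of k] c by (subst powr_realpow[symmetric]) (auto simp: powr_powr)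
    moreover have "t ^ k \<le> ((C * a k) powr (1 / k)) ^ k" using False t0 by (intro power_mono t2) auto
    moreover have "((C * a k) powr (1 / k)) ^ k = C * a k"
      using False a[of k] C by (subst powr_realpow[symmetric]) (auto simp: powr_powr)
    ultimately show ?thesis using c C by (simp add: field_simps)
  qed
  then show ?thesis using t0 by blast
qed

context homogeneous_framework
begin

lemma cap_const_real:
  obtains e where "\<And>k. 0 < e k" "\<And>k. cap_const Mstar p k = ennreal (e k)"
proof -
  obtain C where "\<And>k. cap_const Mstar p k \<le> ennreal (C * (rstar powr p / mscale) ^ k)"
    using cap_const_upper by blast
  then have "cap_const Mstar p k < \<top>" for k using order_le_less_trans ennreal_less_top by blast
  then have "cap_const Mstar p k = ennreal (enn2real (cap_const Mstar p k))" "0 < enn2real (cap_const Mstar p k)" for k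
    using cap_const_pos[of k] by (auto simp: enn2real_positive_iff)
  then show ?thesis using that[of "\<lambda>k. enn2real (cap_const Mstar p k)"] by blast
qed

text \<open>Conductive homogeneity makes the two families of constants reciprocal to each other.\<close>

lemma sigma_sys_cap_const:
  assumes e: "\<And>k. 0 < e k" "\<And>k. cap_const Mstar p k = ennreal (e k)"
  obtains s P C where "\<And>k. 0 < s k" "\<And>k. sigma_sys \<J> p k = ennreal (s k)" "0 < P" "0 < C"
    "\<And>k. s k * e k \<le> P" "\<And>k. 1 \<le> C * s k * e k"
proof -
  define P where "P = enn2real (SUP k. sigma_sys \<J> p k * cap_const Mstar p k)"
  have P: "sigma_sys \<J> p k * ennreal (e k) \<le> ennreal P" "0 \<le> P" for k
  proof -
    have "sigma_sys \<J> p k * cap_const Mstar p k \<le> (SUP k. sigma_sys \<J> p k * cap_const Mstar p k)"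
      by (rule SUP_upper) simp
    then show "sigma_sys \<J> p k * ennreal (e k) \<le> ennreal P" using J_product by (simp add: P_def e)
  qed (simp add: P_def)
  define s where "s k = enn2real (sigma_sys \<J> p k)" for k
  have s: "sigma_sys \<J> p k = ennreal (s k)" for k
  proof -
    have "sigma_sys \<J> p k \<noteq> \<top>"
    proof
      assume "sigma_sys \<J> p k = \<top>"
      then have "sigma_sys \<J> p k * ennreal (e k) = \<top>" using e(1)[of k] by (simp add: ennreal_top_mult)
      then show False using P(1)[of k] by (simp add: top_unique)
    qed
    then show ?thesis by (simp add: s_def less_top)
  qed
  have s0: "0 \<le> s k" for k by (simp add: s_def)
  have sP: "s k * e k \<le> P" for k
    using P(1)[of k] e(1)[of k] P(2) s0[of k] by (simp add: s ennreal_mult[symmetric])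
  obtain C where C: "0 < C" "\<And>k s. 0 < s \<Longrightarrow> sigma_sys \<J> p k \<le> ennreal s \<Longrightarrow> ennreal (1 / (C * s)) \<le> cap_const Mstar p k"
    using sigma_cap_lower by blast
  have low: "1 \<le> C * r * e k" if r: "0 < r" "s k \<le> r" for r k
  proof -
    have "ennreal (1 / (C * r)) \<le> ennreal (e k)" using C(2)[of r k] r by (simp add: s e ennreal_leI)
    then have "1 / (C * r) \<le> e k" using e(1)[of k] by (simp add: ennreal_le_iff)
    then show ?thesis using C(1) r(1) by (simp add: field_simps)
  qed
  have spos: "0 < s k" for k
  proof (rule ccontr)
    assume "\<not> 0 < s k"
    then have "s k = 0" using s0[of k] by simp
    then have "1 \<le> C * (1 / (2 * C * e k)) * e k" using C(1) e(1)[of k] by (intro low) auto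
    then show False using C(1) e(1)[of k] by (simp add: field_simps)
  qed
  have sC: "1 \<le> C * s k * e k" for k using low[of "s k" k] spos by simp
  have "0 < P" using sP[of 0] spos[of 0] e(1)[of 0] by (meson mult_pos_pos order_less_le_trans)
  then show ?thesis using that[of s P C] spos s C(1) sP sC by blast
qed

text \<open>Submultiplicativity is available for capacities only with a shift by \<open>2 * Mstar\<close> generations;
  supermultiplicativity, inherited from the reciprocal constants, absorbs the shift.\<close>

lemma cap_const_geometric:
  assumes e: "\<And>k. 0 < e k" "\<And>k. cap_const Mstar p k = ennreal (e k)"
  shows "\<exists>t>0. \<exists>c1>0. \<exists>c2>0. \<forall>k. c1 * t ^ k \<le> e k \<and> e k \<le> c2 * t ^ k"
proof -
  obtain s P C where s: "\<And>k. 0 < s k" "\<And>k. sigma_sys \<J> p k = ennreal (s k)" "0 < P" "0 < C"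
    "\<And>k. s k * e k \<le> P" "\<And>k. 1 \<le> C * s k * e k"
    using sigma_sys_cap_const[OF e] by metis
  obtain C1 where C1: "0 < C1" "\<And>k l s t. 0 \<le> s \<Longrightarrow> 0 \<le> t \<Longrightarrow> sigma_sys \<J> p k \<le> ennreal s \<Longrightarrow> sigma_sys \<J> p l \<le> ennreal t \<Longrightarrow>
      sigma_sys \<J> p (k + l) \<le> ennreal (C1 * s * t)"
    using sigma_submultiplicative by blast
  obtain C2 where C2: "0 < C2" "\<And>k l c d. cap_const Mstar p k < ennreal c \<Longrightarrow> cap_const Mstar p l < ennreal d \<Longrightarrow>
     cap_const Mstar p (2 * Mstar + k + l) \<le> ennreal (C2 * c * d)"
    using cap_const_submultiplicative_shift by blast
  define c where "c = 1 / (C * C1 * P * P)"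
  have c: "0 < c" using s C1 by (simp add: c_def)
  have super: "c * e k * e l \<le> e (k + l)" for k l
  proof -
    have "sigma_sys \<J> p (k + l) \<le> ennreal (C1 * s k * s l)"
      using s(1)[of k] s(1)[of l] by (intro C1(2)) (auto simp: s(2))
    then have "s (k + l) \<le> C1 * s k * s l" using s(1)[of k] s(1)[of l] C1(1) by (simp add: s(2) ennreal_le_iff)
    then have "C * s (k + l) * e (k + l) \<le> C * (C1 * s k * s l) * e (k + l)"
      using s(4) e(1)[of "k + l"] by (intro mult_right_mono mult_left_mono) auto
    then have "1 \<le> C * (C1 * s k * s l) * e (k + l)" using s(6)[of "k + l"] by linarith
    then have "e k * e l * 1 \<le> e k * e l * (C * (C1 * s k * s l) * e (k + l))"
      using e(1)[of k] e(1)[of l] by (intro mult_left_mono) auto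
    also have "\<dots> = C * C1 * e (k + l) * ((s k * e k) * (s l * e l))" by (simp add: mult_ac)
    also have "\<dots> \<le> C * C1 * e (k + l) * (P * P)"
      using s e C1 by (intro mult_left_mono mult_mono) (auto intro!: mult_nonneg_nonneg less_imp_le)
    finally show ?thesis using s C1 by (simp add: c_def field_simps)
  qed
  define D where "D = 4 * C2 / (c * e (2 * Mstar))"
  have D: "0 < D" using C2 c e by (simp add: D_def)
  have sub: "e (k + l) \<le> D * e k * e l" for k l
  proof -
    have "c * e (2 * Mstar) * e (k + l) \<le> e (2 * Mstar + (k + l))" by (rule super)
    also have "\<dots> \<le> C2 * (2 * e k) * (2 * e l)"
    proof -
      have "cap_const Mstar p (2 * Mstar + k + l) \<le> ennreal (C2 * (2 * e k) * (2 * e l))"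
        using e(1)[of k] e(1)[of l] by (intro C2(2)) (auto simp: e(2) ennreal_less_iff)
      then show ?thesis using e(1)[of k] e(1)[of l] C2(1) by (simp add: e(2) ennreal_le_iff add.assoc)
    qed
    finally show ?thesis using c e(1)[of "2 * Mstar"] by (simp add: D_def field_simps)
  qed
  obtain t where t: "0 < t" "\<And>k. t ^ k / D \<le> e k \<and> e k \<le> t ^ k / c"
    using quasi_multiplicative_geometric[OF e(1) c D sub super] by blast
  show ?thesis using t c D by (intro exI[of _ t] conjI exI[of _ "1 / D"] exI[of _ "1 / c"]) auto
qed

text \<open>The predicate in the definite description that defines \<^const>\<open>sigma\<close>.\<close>

definition is_scaling_factor :: "real \<Rightarrow> bool" where
  "is_scaling_factor s \<longleftrightarrow> 0 < s \<and>
     (\<exists>c1>0. \<exists>c2>0. \<exists>\<J>. covering_system \<J> \<and>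
        (\<forall>k. ennreal (c1 / s ^ k) \<le> cap_const Mstar p k \<and>
             cap_const Mstar p k \<le> ennreal (c2 / s ^ k) \<and>
             ennreal (c1 * s ^ k) \<le> sigma_sys \<J> p k \<and>
             sigma_sys \<J> p k \<le> ennreal (c2 * s ^ k)))"

lemma ex_scaling_factor: "\<exists>s. is_scaling_factor s"
proof -
  obtain e where e: "\<And>k. 0 < e k" "\<And>k. cap_const Mstar p k = ennreal (e k)" using cap_const_real by metis
  obtain s P C where s: "\<And>k. 0 < s k" "\<And>k. sigma_sys \<J> p k = ennreal (s k)" "0 < P" "0 < C"
    "\<And>k. s k * e k \<le> P" "\<And>k. 1 \<le> C * s k * e k"
    using sigma_sys_cap_const[OF e] by metis
  obtain t c1 c2 where t: "0 < t" "0 < c1" "0 < c2" "\<And>k. c1 * t ^ k \<le> e k" "\<And>k. e k \<le> c2 * t ^ k"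
    using cap_const_geometric[OF e] by blast
  define d1 where "d1 = min c1 (1 / (C * c2))"
  define d2 where "d2 = max c2 (P / c1)"
  have "ennreal (d1 / (1 / t) ^ k) \<le> cap_const Mstar p k \<and> cap_const Mstar p k \<le> ennreal (d2 / (1 / t) ^ k) \<and>
     ennreal (d1 * (1 / t) ^ k) \<le> sigma_sys \<J> p k \<and> sigma_sys \<J> p k \<le> ennreal (d2 * (1 / t) ^ k)" for k
  proof -
    have tk: "0 < t ^ k" using t(1) by simp
    have "d1 * t ^ k \<le> c1 * t ^ k" using tk by (intro mult_right_mono) (auto simp: d1_def)
    then have 1: "d1 * t ^ k \<le> e k" using t(4)[of k] by linarith
    have "c2 * t ^ k \<le> d2 * t ^ k" using tk by (intro mult_right_mono) (auto simp: d2_def)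
    then have 2: "e k \<le> d2 * t ^ k" using t(5)[of k] by linarith
    have 3: "d1 / t ^ k \<le> s k"
    proof -
      have "C * s k * e k \<le> C * s k * (c2 * t ^ k)" using s(1)[of k] s(4) t(5)[of k] by (intro mult_left_mono) auto
      then have "1 \<le> C * s k * (c2 * t ^ k)" using s(6)[of k] by linarith
      then have "1 / (C * c2) / t ^ k \<le> s k" using s(4) t(3) tk by (simp add: field_simps)
      moreover have "d1 / t ^ k \<le> 1 / (C * c2) / t ^ k" using tk by (intro divide_right_mono) (auto simp: d1_def)
      ultimately show ?thesis by linarith
    qed
    have 4: "s k \<le> d2 / t ^ k"
    proof -
      have "s k * (c1 * t ^ k) \<le> s k * e k" using s(1)[of k] t(4)[of k] by (intro mult_left_mono) auto
      then have "s k * (c1 * t ^ k) \<le> P" using s(5)[of k] by linarith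
      then have "s k \<le> P / c1 / t ^ k" using t(2) tk by (simp add: field_simps)
      moreover have "P / c1 / t ^ k \<le> d2 / t ^ k" using tk by (intro divide_right_mono) (auto simp: d2_def)
      ultimately show ?thesis by linarith
    qed
    show ?thesis using 1 2 3 4 by (simp add: e(2) s(2) power_divide ennreal_leI)
  qed
  moreover have "0 < d1" "0 < d2" using t s by (auto simp: d1_def d2_def)
  ultimately have "is_scaling_factor (1 / t)" using t(1) J_system
    unfolding is_scaling_factor_def by (intro conjI exI[of _ d1] exI[of _ d2] exI[of _ \<J>]) auto
  then show ?thesis by blast
qed

lemma scaling_factor_bounds:
  assumes s: "is_scaling_factor s" and e: "\<And>k. 0 < e k" "\<And>k. cap_const Mstar p k = ennreal (e k)"
  shows "0 < s" and "\<exists>c1>0. \<exists>c2>0. \<forall>k. c1 / s ^ k \<le> e k \<and> e k \<le> c2 / s ^ k"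
proof -
  show s0: "0 < s" using s by (simp add: is_scaling_factor_def)
  obtain c1 c2 where c: "0 < c1" "0 < c2" and *: "\<And>k. ennreal (c1 / s ^ k) \<le> ennreal (e k)" "\<And>k. ennreal (e k) \<le> ennreal (c2 / s ^ k)"
    using s unfolding is_scaling_factor_def e(2) by blast
  have "c1 / s ^ k \<le> e k \<and> e k \<le> c2 / s ^ k" for k
    using *[of k] c s0 e(1)[of k] by (simp add: ennreal_le_iff)
  then show "\<exists>c1>0. \<exists>c2>0. \<forall>k. c1 / s ^ k \<le> e k \<and> e k \<le> c2 / s ^ k" using c by blast
qed

lemma scaling_factor_unique:
  assumes "is_scaling_factor s" "is_scaling_factor t"
  shows "s = t"
proof -
  obtain e where e: "\<And>k. 0 < e k" "\<And>k. cap_const Mstar p k = ennreal (e k)" using cap_const_real by metis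
  have "t \<le> s" if st: "is_scaling_factor s" "is_scaling_factor t" for s t
  proof -
    have pos: "0 < s" "0 < t" using scaling_factor_bounds(1)[OF _ e] st by auto
    obtain c1 where c1: "0 < c1" "\<And>k. c1 / s ^ k \<le> e k" using scaling_factor_bounds(2)[OF st(1) e] by blast
    obtain c2 where c2: "0 < c2" "\<And>k. e k \<le> c2 / t ^ k" using scaling_factor_bounds(2)[OF st(2) e] by blast
    have "t / s \<le> 1"
    proof (rule power_bounded_le_one)
      fix k
      have "c1 / s ^ k \<le> c2 / t ^ k" using c1(2)[of k] c2(2)[of k] by linarith
      then show "(t / s) ^ k \<le> c2 / c1" using pos c1(1) by (simp add: power_divide field_simps)
    qed
    then show ?thesis using pos by simp
  qed
  then show ?thesis using assms by (meson antisym)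
qed

lemma sigma_scaling_factor: "is_scaling_factor (sigma p)"
proof -
  have "sigma p = (THE s. is_scaling_factor s)" by (simp add: sigma_def is_scaling_factor_def)
  moreover have "is_scaling_factor (THE s. is_scaling_factor s)"
    using ex_scaling_factor scaling_factor_unique by (metis theI)
  ultimately show ?thesis by simp
qed

lemma sigma_pos: "0 < sigma p"
  using sigma_scaling_factor by (simp add: is_scaling_factor_def)

lemma sigma_sys_le_sigma: "\<exists>C>0. \<forall>k. sigma_sys \<J> p k \<le> ennreal (C * sigma p ^ k)"
proof -
  obtain e where e: "\<And>k. 0 < e k" "\<And>k. cap_const Mstar p k = ennreal (e k)" using cap_const_real by metis
  obtain s P C where s: "\<And>k. 0 < s k" "\<And>k. sigma_sys \<J> p k = ennreal (s k)" "0 < P" "0 < C"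
    "\<And>k. s k * e k \<le> P" "\<And>k. 1 \<le> C * s k * e k"
    using sigma_sys_cap_const[OF e] by metis
  obtain c1 where c1: "0 < c1" "\<And>k. c1 / sigma p ^ k \<le> e k"
    using scaling_factor_bounds(2)[OF sigma_scaling_factor e] by blast
  have "s k \<le> P / c1 * sigma p ^ k" for k
  proof -
    have "s k * (c1 / sigma p ^ k) \<le> s k * e k" using s(1)[of k] c1(2)[of k] by (intro mult_left_mono) auto
    then have "s k * (c1 / sigma p ^ k) \<le> P" using s(5)[of k] by linarith
    then show ?thesis using c1(1) sigma_pos by (simp add: field_simps)
  qed
  then show ?thesis using s(3) c1(1) by (intro exI[of _ "P / c1"]) (auto simp: s(2) intro!: ennreal_leI)
qed

text \<open>The walk dimension is at least \<open>p\<close>, hence positive. This makes the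
  increments of averages between consecutive generations summable.\<close>

lemma mscale_less_sigma: "mscale / sigma p < 1"
proof -
  obtain e where e: "\<And>k. 0 < e k" "\<And>k. cap_const Mstar p k = ennreal (e k)" using cap_const_real by metis
  obtain c1 where c1: "0 < c1" "\<And>k. c1 / sigma p ^ k \<le> e k"
    using scaling_factor_bounds(2)[OF sigma_scaling_factor e] by blast
  obtain C where C: "0 < C" "\<And>k. cap_const Mstar p k \<le> ennreal (C * (rstar powr p / mscale) ^ k)"
    using cap_const_upper by blast
  have rp: "0 < rstar powr p" "rstar powr p < 1" using rstar p by (auto simp: powr01_less_one)
  have "mscale / sigma p / rstar powr p \<le> 1"
  proof (rule power_bounded_le_one)
    fix k
    have "e k \<le> C * (rstar powr p / mscale) ^ k"
      using C(1) C(2)[of k] e(1)[of k] rp mscale by (simp add: e(2) ennreal_le_iff)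
    then have "c1 / sigma p ^ k \<le> C * (rstar powr p / mscale) ^ k" using c1(2)[of k] by linarith
    then show "(mscale / sigma p / rstar powr p) ^ k \<le> C / c1"
      using c1(1) sigma_pos rp mscale by (simp add: power_divide field_simps)
  qed
  then have "mscale / sigma p \<le> rstar powr p" using rp(1) pos_divide_le_eq[of "rstar powr p" "mscale / sigma p" 1] by (simp only: mult_1)
  then show ?thesis using rp by linarith
qed

lemma powr_dw: "(rstar ^ n) powr dw p = (mscale / sigma p) ^ n"
proof -
  have "ln rstar < 0" using rstar by simp
  then have "rstar powr (ln (sigma p) / ln (1 / rstar)) = 1 / sigma p"
    using rstar sigma_pos by (simp add: powr_def ln_div exp_minus inverse_eq_divide)
  then have 1: "rstar powr dw p = mscale / sigma p"
    using rstar by (simp add: dw_def df_eq_Q powr_add mscale_def)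
  have "(rstar ^ n) powr dw p = (rstar powr dw p) ^ n"
    using rstar by (simp add: powr_realpow[symmetric] powr_powr mult.commute)
  then show ?thesis using 1 by simp
qed

lemma dw_pos: "0 < dw p"
proof (rule ccontr)
  assume "\<not> 0 < dw p"
  then have "1 \<le> rstar powr dw p" using rstar powr_mono'[of "dw p" 0 rstar] by simp
  then show False using powr_dw[of 1] mscale_less_sigma by simp
qed

end

section \<open>A discrete Poincare inequality\<close>

context basic_geometric_framework
begin

lemma finite_Desc: "finite A \<Longrightarrow> finite (Desc k A)"
  unfolding Desc_def using finite_desc by blast

lemma sum_Desc:
  assumes "finite A"
  shows "(\<Sum>u\<in>Desc (j + k) A. g u) = (\<Sum>v\<in>Desc j A. \<Sum>u\<in>desc k v. g u)"
  unfolding Desc_Desc[symmetric] Desc_def[of k] using assms finite_Desc finite_desc desc_disjoint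
  by (intro sum.UNION_disjoint) auto

end

text \<open>Each \<open>\<bar>a j\<bar>\<close> is at most \<open>r ^ j\<close> times the \<open>p\<close>-th root of the weighted sum, and the geometric series converges. Thus
  \<open>p\<close>-th powers of sums are controlled at the price of geometric weights whose ratio may be chosen close to one.\<close>

lemma sum_powr_weighted:
  fixes a :: "nat \<Rightarrow> real"
  assumes p: "0 < p" and r: "0 < r" "r < 1"
  shows "\<bar>\<Sum>j<k. a j\<bar> powr p \<le> (1 / (1 - r)) powr p * (\<Sum>j<k. (1 / r powr p) ^ j * \<bar>a j\<bar> powr p)"
proof -
  let ?Y = "\<Sum>j<k. (1 / r powr p) ^ j * \<bar>a j\<bar> powr p"
  have Y: "0 \<le> ?Y" by (intro sum_nonneg) auto
  have rj: "(r ^ j) powr p = (r powr p) ^ j" for j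
    using r by (simp add: powr_realpow[symmetric] powr_powr mult.commute)
  have "\<bar>a j\<bar> \<le> r ^ j * ?Y powr (1 / p)" if j: "j < k" for j
  proof -
    have "(1 / r powr p) ^ j * \<bar>a j\<bar> powr p \<le> ?Y"
      using j by (intro member_le_sum[of j "{..<k}" "\<lambda>j. (1 / r powr p) ^ j * \<bar>a j\<bar> powr p"]) auto
    also have "(1 / r powr p) ^ j * \<bar>a j\<bar> powr p = \<bar>a j / r ^ j\<bar> powr p"
      using r by (simp add: powr_divide rj power_divide)
    finally have "\<bar>a j / r ^ j\<bar> \<le> ?Y powr (1 / p)" unfolding abs_powr_le_iff[OF p Y] .
    then show ?thesis using r by (simp add: field_simps)
  qed
  then have "\<bar>\<Sum>j<k. a j\<bar> \<le> (\<Sum>j<k. r ^ j * ?Y powr (1 / p))"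
    by (intro order_trans[OF sum_abs] sum_mono) auto
  also have "\<dots> = (\<Sum>j<k. r ^ j) * ?Y powr (1 / p)" by (simp add: sum_distrib_right)
  also have "\<dots> \<le> 1 / (1 - r) * ?Y powr (1 / p)"
  proof (intro mult_right_mono)
    have "(\<Sum>j<k. r ^ j) \<le> (\<Sum>j. r ^ j)" using r by (intro sum_le_suminf summable_geometric) auto
    then show "(\<Sum>j<k. r ^ j) \<le> 1 / (1 - r)" using r by (simp add: suminf_geometric)
  qed auto
  finally show ?thesis using p r Y by (intro abs_powr_le_of_le_mult) auto
qed

context homogeneous_framework
begin

lemma edge_estimate_sigma:
  "\<exists>C>0. \<exists>L. \<forall>k a b f. adj a b \<longrightarrow>
      \<bar>discrete_avg k f a - discrete_avg k f b\<bar> powr p \<le> C * sigma p ^ k * energy p (height a + k) (Desc k (near L a)) f"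
proof -
  obtain C L where C: "0 < C" "\<And>k s a b f. 0 \<le> s \<Longrightarrow> sigma_sys \<J> p k \<le> ennreal s \<Longrightarrow> adj a b \<Longrightarrow>
      \<bar>discrete_avg k f a - discrete_avg k f b\<bar> powr p \<le> C * s * energy p (height a + k) (Desc k (near L a)) f"
    using edge_estimate by blast
  obtain C' where C': "0 < C'" "\<And>k. sigma_sys \<J> p k \<le> ennreal (C' * sigma p ^ k)" using sigma_sys_le_sigma by blast
  have "\<bar>discrete_avg k f a - discrete_avg k f b\<bar> powr p
     \<le> C * C' * sigma p ^ k * energy p (height a + k) (Desc k (near L a)) f" if "adj a b" for k a b f
    using C(2)[OF _ C'(2) that] C'(1) sigma_pos by (simp add: mult.assoc)
  then show ?thesis using C(1) C'(1) by (intro exI[of _ "C * C'"] conjI exI[of _ L]) auto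
qed

lemma Desc_near_subset:
  assumes "j \<le> height u"
  shows "Desc k (near L u) \<subseteq> Desc (j + k) (near L ((parent ^^ j) u))"
proof
  fix x assume x: "x \<in> Desc k (near L u)"
  then have 1: "(parent ^^ k) x \<in> near L u" "k \<le> height x" by (auto simp: Desc_iff)
  have "(parent ^^ j) ((parent ^^ k) x) \<in> near L ((parent ^^ j) u)" using 1(1) by (rule near_ancestor)
  moreover have "j + k \<le> height x" using height_near[OF 1(1)] 1(2) assms by (simp add: height_ancestor)
  ultimately show "x \<in> Desc (j + k) (near L ((parent ^^ j) u))" by (simp add: Desc_iff funpow_add)
qed

text \<open>The children of a vertex form a connected graph of bounded size, so their averages differ from each
  other, and from their common mean, by a bounded number of edge increments.\<close>

lemma child_estimate:
  "\<exists>C>0. \<exists>L. \<forall>k b c f. c \<in> children b \<longrightarrow>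
      \<bar>discrete_avg k f c - discrete_avg (Suc k) f b\<bar> powr p
        \<le> C * sigma p ^ k * energy p (height b + Suc k) (Desc (Suc k) (near L b)) f"
proof -
  obtain C L where C: "0 < C" "\<And>k a b f. adj a b \<Longrightarrow>
      \<bar>discrete_avg k f a - discrete_avg k f b\<bar> powr p \<le> C * sigma p ^ k * energy p (height a + k) (Desc k (near L a)) f"
    using edge_estimate_sigma by blast
  obtain D where D: "D \<ge> 1" "\<And>k w. real (card (desc k w)) \<le> D / mscale ^ k" using card_desc_le by blast
  define N where "N = D / mscale"
  have N: "0 < N" using D mscale by (simp add: N_def)
  have desc1: "desc 1 w = children w" for w by simp
  have cardN: "real (card (children w)) \<le> N" for w using D(2)[of 1 w] by (simp add: N_def)
  have "\<bar>discrete_avg k f c - discrete_avg (Suc k) f b\<bar> powr p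
        \<le> N\<^sup>2 powr p * C * sigma p ^ k * energy p (height b + Suc k) (Desc (Suc k) (near L b)) f"
    if c: "c \<in> children b" for k b c f
  proof -
    define X where "X = C * sigma p ^ k * energy p (height b + Suc k) (Desc (Suc k) (near L b)) f"
    have X: "0 \<le> X" using C(1) sigma_pos energy_nonneg by (simp add: X_def)
    have p0: "0 < p" using p by simp
    have lev: "children b \<subseteq> level (Suc (height b))" using height_children by auto
    have con: "connected (\<Union>v\<in>children b. K v)" using K_children[of b] connected_cells[of b] by (rule subst)
    have "\<bar>discrete_avg k f c' - discrete_avg k f c\<bar> \<le> N\<^sup>2 * X powr (1 / p)" if c': "c' \<in> children b" for c'
    proof -
      have "\<bar>discrete_avg k f c' - discrete_avg k f c\<bar> \<le> (real (card (children b)))\<^sup>2 * X powr (1 / p)"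
      proof (rule jump_bound[OF finite_children lev con c' c])
        fix u v assume uv: "u \<in> children b" "v \<in> children b" "adj u v"
        have u: "height u = Suc (height b)" "(parent ^^ 1) u = b" using uv(1) height_children by (auto simp: children_iff)
        have "Desc k (near L u) \<subseteq> Desc (1 + k) (near L b)" using Desc_near_subset[of 1 u k L] u by simp
        then have "energy p (height u + k) (Desc k (near L u)) f \<le> energy p (height u + k) (Desc (Suc k) (near L b)) f"
          by (intro energy_mono) simp
        then have "C * sigma p ^ k * energy p (height u + k) (Desc k (near L u)) f \<le> X"
          unfolding X_def using C(1) sigma_pos u(1) by (intro mult_left_mono) auto
        then have "\<bar>discrete_avg k f u - discrete_avg k f v\<bar> powr p \<le> X" using C(2)[OF uv(3), of k f] by linarith
        then show "\<bar>discrete_avg k f u - discrete_avg k f v\<bar> \<le> X powr (1 / p)"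
          using abs_powr_le_iff[OF p0 X] by blast
      qed simp
      also have "\<dots> \<le> N\<^sup>2 * X powr (1 / p)" using cardN by (intro mult_right_mono power_mono) auto
      finally show ?thesis .
    qed
    then have "\<bar>discrete_avg 1 (discrete_avg k f) b - discrete_avg k f c\<bar> \<le> N\<^sup>2 * X powr (1 / p)"
      by (rule discrete_avg_diff_le) (simp only: desc1)
    then have "\<bar>discrete_avg k f c - discrete_avg (Suc k) f b\<bar> \<le> N\<^sup>2 * X powr (1 / p)"
      using discrete_avg_add[of 1 k f b] by (simp add: abs_minus_commute)
    then have "\<bar>discrete_avg k f c - discrete_avg (Suc k) f b\<bar> powr p \<le> N\<^sup>2 powr p * X"
      using p0 X by (intro abs_powr_le_of_le_mult) auto
    then show ?thesis by (simp add: X_def mult.assoc)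
  qed
  moreover have "0 < N\<^sup>2 powr p * C" using C(1) N by simp
  ultimately show ?thesis by blast
qed

text \<open>A vertex \<open>x\<close> descends from a neighbour of \<open>b\<close> only if \<open>b\<close> is near the ancestor of \<open>x\<close>.\<close>

lemma overlap_near_Desc:
  obtains D :: nat where "1 \<le> D" "\<And>n V k j f. V \<subseteq> level n \<Longrightarrow>
     (\<Sum>b\<in>Desc j V. energy p (n + (j + k)) (Desc k (near L b)) f)
       \<le> real D * energy p (n + (j + k)) (Desc (j + k) (\<Union>w\<in>V. near L w)) f"
proof -
  obtain D where D: "D \<ge> 1" "\<And>w. card (near L w) \<le> D" using card_near_bounded by blast
  have "(\<Sum>b\<in>Desc j V. energy p (n + (j + k)) (Desc k (near L b)) f)
       \<le> real D * energy p (n + (j + k)) (Desc (j + k) (\<Union>w\<in>V. near L w)) f" if V: "V \<subseteq> level n" for n V k j f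
  proof (rule energy_overlap)
    show "finite (Desc j V)" using finite_Desc finite_subset[OF V finite_level] by blast
    show "Desc k (near L b) \<subseteq> Desc (j + k) (\<Union>w\<in>V. near L w)" if b: "b \<in> Desc j V" for b
    proof -
      have "Desc k (near L b) \<subseteq> Desc (j + k) (near L ((parent ^^ j) b))"
        using b by (intro Desc_near_subset) (simp add: Desc_iff)
      also have "\<dots> \<subseteq> Desc (j + k) (\<Union>w\<in>V. near L w)" using b by (intro Desc_mono) (auto simp: Desc_iff)
      finally show ?thesis .
    qed
    fix x
    have "card {b \<in> Desc j V. x \<in> Desc k (near L b)} \<le> card (near L ((parent ^^ k) x))"
      by (rule card_mono[OF finite_near]) (auto simp: Desc_iff intro: near_sym)
    then show "card {b \<in> Desc j V. x \<in> Desc k (near L b)} \<le> D" using D(2) by (meson order_trans)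
  qed
  then show ?thesis using that[OF D(1)] by blast
qed

text \<open>The oscillation of \<open>f\<close> on the descendants of \<open>w\<close> is split into the increments between consecutive
  generations. Passing \<open>j\<close> generations down divides the energy constant by \<open>sigma p ^ j\<close> and multiplies the measure
  by about \<open>mscale ^ j\<close>, so the contributions decay geometrically because the walk dimension is positive.\<close>

lemma discrete_poincare:
  "\<exists>C>0. \<exists>L. \<forall>n k V f. V \<subseteq> level n \<longrightarrow>
     (\<Sum>u\<in>Desc k V. measure m (K u) * \<bar>f u - discrete_avg k f ((parent ^^ k) u)\<bar> powr p)
       \<le> C * mscale ^ n * sigma p ^ k * energy p (n + k) (Desc k (\<Union>w\<in>V. near L w)) f"
proof -
  obtain C L where C: "0 < C" "\<And>k b c f. c \<in> children b \<Longrightarrow>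
      \<bar>discrete_avg k f c - discrete_avg (Suc k) f b\<bar> powr p
        \<le> C * sigma p ^ k * energy p (height b + Suc k) (Desc (Suc k) (near L b)) f"
    using child_estimate by blast
  obtain a b1 where b1: "0 < b1" "\<And>w. measure m (K w) \<le> b1 * mscale ^ height w"
    using cell_measure_bounds by metis
  obtain D where D1: "1 \<le> D" and D: "\<And>n V k j f. V \<subseteq> level n \<Longrightarrow>
     (\<Sum>b\<in>Desc j V. energy p (n + (j + k)) (Desc k (near L b)) f)
       \<le> real D * energy p (n + (j + k)) (Desc (j + k) (\<Union>w\<in>V. near L w)) f"
    using overlap_near_Desc[of L] by blast
  define \<theta> where "\<theta> = mscale / sigma p"
  have \<theta>: "0 < \<theta>" "\<theta> < 1" using mscale sigma_pos mscale_less_sigma by (auto simp: \<theta>_def)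
  define r where "r = \<theta> powr (1 / (2 * p))"
  have r: "0 < r" "r < 1" using \<theta> p by (auto simp: r_def powr01_less_one)
  define q where "q = 1 / r powr p * \<theta>"
  have "r powr p = \<theta> powr (1 / 2)" using p by (simp add: r_def powr_powr)
  then have "q = \<theta> powr 1 / \<theta> powr (1 / 2)" using \<theta> by (simp add: q_def)
  also have "\<dots> = \<theta> powr (1 / 2)" by (subst powr_diff[symmetric]) simp
  finally have q: "0 < q" "q < 1" using \<theta> by (auto simp: powr01_less_one)
  have incr: "(\<Sum>u\<in>Desc (j + Suc i) V. measure m (K u) *
        \<bar>discrete_avg i f ((parent ^^ i) u) - discrete_avg (Suc i) f ((parent ^^ Suc i) u)\<bar> powr p)
      \<le> C * b1 * real D * mscale ^ (n + j) * sigma p ^ i * energy p (n + (j + Suc i)) (Desc (j + Suc i) (\<Union>w\<in>V. near L w)) f"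
    if V: "V \<subseteq> level n" for n V i j f
  proof -
    have finV: "finite V" using finite_subset[OF V finite_level] .
    let ?d = "\<lambda>c b. \<bar>discrete_avg i f c - discrete_avg (Suc i) f b\<bar> powr p"
    let ?e = "\<lambda>b. energy p (n + (j + Suc i)) (Desc (Suc i) (near L b)) f"
    have "(\<Sum>u\<in>Desc (j + Suc i) V. measure m (K u) * ?d ((parent ^^ i) u) ((parent ^^ Suc i) u))
        = (\<Sum>b\<in>Desc j V. \<Sum>u\<in>desc (Suc i) b. measure m (K u) * ?d ((parent ^^ i) u) ((parent ^^ Suc i) u))"
      by (rule sum_Desc[OF finV])
    also have "\<dots> \<le> (\<Sum>b\<in>Desc j V. b1 * mscale ^ (n + j) * (C * sigma p ^ i * ?e b))"
    proof (rule sum_mono)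
      fix b assume b: "b \<in> Desc j V"
      have hb: "height b = n + j" using Desc_level[OF V, of j] b by auto
      have "(\<Sum>u\<in>desc (Suc i) b. measure m (K u) * ?d ((parent ^^ i) u) ((parent ^^ Suc i) u))
          \<le> (\<Sum>u\<in>desc (Suc i) b. measure m (K u) * (C * sigma p ^ i * ?e b))"
      proof (intro sum_mono mult_left_mono)
        fix u assume u: "u \<in> desc (Suc i) b"
        then have pu: "parent ((parent ^^ i) u) = b" and hu: "height u = height b + Suc i"
            unfolding desc_iff by simp_all
        have "height ((parent ^^ i) u) = Suc (height b)" using hu by (simp add: height_ancestor)
        then have "(parent ^^ i) u \<noteq> root" by (metis height_eq_0_iff nat.distinct(1))
        then have "(parent ^^ i) u \<in> children b" using pu by (simp add: children_iff)
        from C(2)[OF this, of i f] show "?d ((parent ^^ i) u) ((parent ^^ Suc i) u) \<le> C * sigma p ^ i * ?e b"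
          using pu hb by (simp add: add.assoc)
      qed simp
      also have "\<dots> = measure m (K b) * (C * sigma p ^ i * ?e b)"
        unfolding sum_distrib_right[symmetric] using measure_desc[of b "Suc i"] by simp
      also have "\<dots> \<le> b1 * mscale ^ (n + j) * (C * sigma p ^ i * ?e b)"
        using b1(2)[of b] hb C(1) sigma_pos energy_nonneg by (intro mult_right_mono) auto
      finally show "(\<Sum>u\<in>desc (Suc i) b. measure m (K u) * ?d ((parent ^^ i) u) ((parent ^^ Suc i) u))
          \<le> b1 * mscale ^ (n + j) * (C * sigma p ^ i * ?e b)" .
    qed
    also have "\<dots> = b1 * mscale ^ (n + j) * C * sigma p ^ i * (\<Sum>b\<in>Desc j V. ?e b)"
      by (simp add: sum_distrib_left mult.assoc)
    also have "\<dots> \<le> b1 * mscale ^ (n + j) * C * sigma p ^ i *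
        (real D * energy p (n + (j + Suc i)) (Desc (j + Suc i) (\<Union>w\<in>V. near L w)) f)"
      using D[OF V, of j "Suc i" f] b1 mscale C(1) sigma_pos by (intro mult_left_mono) auto
    finally show ?thesis by (simp add: mult_ac)
  qed
  define A where "A = (1 / (1 - r)) powr p * (C * b1 * real D / sigma p) * (1 / (1 - q))"
  have A: "0 < A" using r C b1 sigma_pos q D1 by (simp add: A_def)
  have "(\<Sum>u\<in>Desc k V. measure m (K u) * \<bar>f u - discrete_avg k f ((parent ^^ k) u)\<bar> powr p)
       \<le> A * mscale ^ n * sigma p ^ k * energy p (n + k) (Desc k (\<Union>w\<in>V. near L w)) f"
    if V: "V \<subseteq> level n" for n k V f
  proof -
    let ?a = "\<lambda>u j. discrete_avg (k - Suc j) f ((parent ^^ (k - Suc j)) u) - discrete_avg (k - j) f ((parent ^^ (k - j)) u)"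
    let ?en = "energy p (n + k) (Desc k (\<Union>w\<in>V. near L w)) f"
    have tele: "f u - discrete_avg k f ((parent ^^ k) u) = (\<Sum>j<k. ?a u j)" for u
      using sum_lessThan_telescope[of "\<lambda>j. discrete_avg (k - j) f ((parent ^^ (k - j)) u)" k] by simp
    have "(\<Sum>u\<in>Desc k V. measure m (K u) * \<bar>f u - discrete_avg k f ((parent ^^ k) u)\<bar> powr p)
       \<le> (\<Sum>u\<in>Desc k V. measure m (K u) * ((1 / (1 - r)) powr p * (\<Sum>j<k. (1 / r powr p) ^ j * \<bar>?a u j\<bar> powr p)))"
      unfolding tele using p r by (intro sum_mono mult_left_mono sum_powr_weighted) auto
    also have "\<dots> = (1 / (1 - r)) powr p * (\<Sum>u\<in>Desc k V. \<Sum>j<k. (1 / r powr p) ^ j * (measure m (K u) * \<bar>?a u j\<bar> powr p))"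
      by (simp add: sum_distrib_left mult_ac)
    also have "\<dots> = (1 / (1 - r)) powr p * (\<Sum>j<k. (1 / r powr p) ^ j * (\<Sum>u\<in>Desc k V. measure m (K u) * \<bar>?a u j\<bar> powr p))"
      by (subst sum.swap) (simp add: sum_distrib_left)
    also have "\<dots> \<le> (1 / (1 - r)) powr p * (\<Sum>j<k. q ^ j * (C * b1 * real D / sigma p * mscale ^ n * sigma p ^ k * ?en))"
    proof (intro mult_left_mono sum_mono)
      fix j assume "j \<in> {..<k}"
      then have j: "j + Suc (k - Suc j) = k" "Suc (k - Suc j) = k - j" by auto
      have "(\<Sum>u\<in>Desc k V. measure m (K u) * \<bar>?a u j\<bar> powr p)
        \<le> C * b1 * real D * mscale ^ (n + j) * sigma p ^ (k - Suc j) * ?en"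
      proof -
        have "(\<Sum>u\<in>Desc (j + Suc (k - Suc j)) V. measure m (K u) *
            \<bar>discrete_avg (k - Suc j) f ((parent ^^ (k - Suc j)) u) - discrete_avg (Suc (k - Suc j)) f ((parent ^^ Suc (k - Suc j)) u)\<bar> powr p)
          \<le> C * b1 * real D * mscale ^ (n + j) * sigma p ^ (k - Suc j) *
             energy p (n + (j + Suc (k - Suc j))) (Desc (j + Suc (k - Suc j)) (\<Union>w\<in>V. near L w)) f"
          by (rule incr[OF V])
        then show ?thesis unfolding j(1) unfolding j(2) .
      qed
      then have "(1 / r powr p) ^ j * (\<Sum>u\<in>Desc k V. measure m (K u) * \<bar>?a u j\<bar> powr p)
        \<le> (1 / r powr p) ^ j * (C * b1 * real D * mscale ^ (n + j) * sigma p ^ (k - Suc j) * ?en)"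
        by (intro mult_left_mono) auto
      also have "\<dots> = q ^ j * (C * b1 * real D / sigma p * mscale ^ n * sigma p ^ k * ?en)"
      proof -
        have "sigma p ^ k = sigma p ^ (k - Suc j) * sigma p * sigma p ^ j"
          using j by (metis power_Suc2 power_add add.commute)
        then show ?thesis using sigma_pos
          by (simp add: q_def \<theta>_def power_mult_distrib power_divide power_add field_simps)
      qed
      finally show "(1 / r powr p) ^ j * (\<Sum>u\<in>Desc k V. measure m (K u) * \<bar>?a u j\<bar> powr p)
        \<le> q ^ j * (C * b1 * real D / sigma p * mscale ^ n * sigma p ^ k * ?en)" .
    qed simp
    also have "\<dots> = (1 / (1 - r)) powr p * ((\<Sum>j<k. q ^ j) * (C * b1 * real D / sigma p * mscale ^ n * sigma p ^ k * ?en))"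
      by (simp only: sum_distrib_right)
    also have "\<dots> \<le> (1 / (1 - r)) powr p * (1 / (1 - q) * (C * b1 * real D / sigma p * mscale ^ n * sigma p ^ k * ?en))"
    proof (intro mult_left_mono mult_right_mono)
      have "(\<Sum>j<k. q ^ j) \<le> (\<Sum>j. q ^ j)" using q by (intro sum_le_suminf summable_geometric) auto
      then show "(\<Sum>j<k. q ^ j) \<le> 1 / (1 - q)" using q by (simp add: suminf_geometric)
      show "0 \<le> C * b1 * real D / sigma p * mscale ^ n * sigma p ^ k * ?en"
        using C b1 sigma_pos mscale energy_nonneg by (intro mult_nonneg_nonneg divide_nonneg_nonneg) auto
    qed simp
    also have "\<dots> = A * mscale ^ n * sigma p ^ k * ?en" by (simp add: A_def mult_ac)
    finally show ?thesis .
  qed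
  then show ?thesis using A by blast
qed

lemma near_average_sum:
  "\<exists>C>0. \<exists>L. \<forall>n k W f. W \<subseteq> level n \<longrightarrow>
     (\<Sum>w\<in>W. \<Sum>v\<in>near M w. \<bar>discrete_avg k f w - discrete_avg k f v\<bar> powr p)
       \<le> C * sigma p ^ k * energy p (n + k) (Desc k (\<Union>w\<in>W. near L w)) f"
proof -
  obtain C L where C: "0 < C" "\<And>k a b f. adj a b \<Longrightarrow>
      \<bar>discrete_avg k f a - discrete_avg k f b\<bar> powr p \<le> C * sigma p ^ k * energy p (height a + k) (Desc k (near L a)) f"
    using edge_estimate_sigma by blast
  obtain D1 where D1: "D1 \<ge> 1" "\<And>w. card (near M w) \<le> D1" using card_near_bounded by blast
  obtain D where DL: "1 \<le> D" and D: "\<And>n V k j f. V \<subseteq> level n \<Longrightarrow>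
     (\<Sum>b\<in>Desc j V. energy p (n + (j + k)) (Desc k (near (M + L) b)) f)
       \<le> real D * energy p (n + (j + k)) (Desc (j + k) (\<Union>w\<in>V. near (M + L) w)) f"
    using overlap_near_Desc[of "M + L"] by blast
  have p0: "0 < p" using p by simp
  have single: "\<bar>discrete_avg k f w - discrete_avg k f v\<bar> powr p
      \<le> real (Suc M) powr p * (C * sigma p ^ k * energy p (height w + k) (Desc k (near (M + L) w)) f)"
    if v: "v \<in> near M w" for k f w v
  proof -
    let ?X = "C * sigma p ^ k * energy p (height w + k) (Desc k (near (M + L) w)) f"
    have X: "0 \<le> ?X" using C(1) sigma_pos energy_nonneg by simp
    have "\<bar>discrete_avg k f w - discrete_avg k f v\<bar> \<le> real i * ?X powr (1 / p)" if "v \<in> near i w" "i \<le> M" for i v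
      using that
    proof (induction i arbitrary: v)
      case (Suc i)
      then obtain u where u: "u \<in> near i w" "adj u v" by (auto simp: near.simps)
      have "u \<in> near M w" using u(1) near_mono[of i M w] Suc.prems by auto
      then have "near L u \<subseteq> near (M + L) w" using near_trans by blast
      then have "energy p (height u + k) (Desc k (near L u)) f \<le> energy p (height w + k) (Desc k (near (M + L) w)) f"
        using height_near[OF u(1)] by (simp add: energy_mono Desc_mono)
      then have "C * sigma p ^ k * energy p (height u + k) (Desc k (near L u)) f \<le> ?X"
        using C(1) sigma_pos by (intro mult_left_mono) auto
      then have "\<bar>discrete_avg k f u - discrete_avg k f v\<bar> powr p \<le> ?X" using C(2)[OF u(2), of k f] by linarith
      then have "\<bar>discrete_avg k f u - discrete_avg k f v\<bar> \<le> ?X powr (1 / p)" using abs_powr_le_iff[OF p0 X] by blast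
      moreover have "\<bar>discrete_avg k f w - discrete_avg k f u\<bar> \<le> real i * ?X powr (1 / p)" using Suc.IH u Suc.prems by simp
      ultimately show ?case by (simp add: algebra_simps)
    qed simp
    from this[OF v order_refl] have "\<bar>discrete_avg k f w - discrete_avg k f v\<bar> \<le> real (Suc M) * ?X powr (1 / p)"
      by (rule order_trans) (intro mult_right_mono; simp)
    then show ?thesis using X p0 by (intro abs_powr_le_of_le_mult) auto
  qed
  have "(\<Sum>w\<in>W. \<Sum>v\<in>near M w. \<bar>discrete_avg k f w - discrete_avg k f v\<bar> powr p)
       \<le> real D1 * real (Suc M) powr p * C * real D * sigma p ^ k * energy p (n + k) (Desc k (\<Union>w\<in>W. near (M + L) w)) f"
    if W: "W \<subseteq> level n" for n k W f
  proof -
    let ?e = "\<lambda>w. energy p (n + k) (Desc k (near (M + L) w)) f"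
    have "(\<Sum>w\<in>W. \<Sum>v\<in>near M w. \<bar>discrete_avg k f w - discrete_avg k f v\<bar> powr p)
      \<le> (\<Sum>w\<in>W. real D1 * (real (Suc M) powr p * (C * sigma p ^ k * ?e w)))"
    proof (rule sum_mono)
      fix w assume w: "w \<in> W"
      have "(\<Sum>v\<in>near M w. \<bar>discrete_avg k f w - discrete_avg k f v\<bar> powr p)
         \<le> (\<Sum>v\<in>near M w. real (Suc M) powr p * (C * sigma p ^ k * ?e w))"
        using single[of _ w k f] w W by (intro sum_mono) auto
      also have "\<dots> = real (card (near M w)) * (real (Suc M) powr p * (C * sigma p ^ k * ?e w))" by simp
      also have "\<dots> \<le> real D1 * (real (Suc M) powr p * (C * sigma p ^ k * ?e w))"
        using D1(2)[of w] C(1) sigma_pos energy_nonneg by (intro mult_right_mono of_nat_mono) auto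
      finally show "(\<Sum>v\<in>near M w. \<bar>discrete_avg k f w - discrete_avg k f v\<bar> powr p)
         \<le> real D1 * (real (Suc M) powr p * (C * sigma p ^ k * ?e w))" .
    qed
    also have "\<dots> = real D1 * real (Suc M) powr p * C * sigma p ^ k * (\<Sum>w\<in>W. ?e w)" by (simp add: sum_distrib_left mult_ac)
    also have "\<dots> \<le> real D1 * real (Suc M) powr p * C * sigma p ^ k * (real D * energy p (n + k) (Desc k (\<Union>w\<in>W. near (M + L) w)) f)"
      using D[OF W, of 0 k f] C(1) sigma_pos by (intro mult_left_mono) (auto simp: Desc_def[of 0])
    finally show ?thesis by (simp add: mult_ac)
  qed
  moreover have "0 < real D1 * real (Suc M) powr p * C * real D" using C(1) D1(1) DL by simp
  ultimately show ?thesis by blast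
qed

end

section \<open>Convergence of cell averages\<close>

context regular_framework
begin

interpretation M: prob_space m by (rule prob)

text \<open>Conditional expectation with respect to the cells of level \<open>n\<close>; on the null set where cells overlap,
  the means of all cells containing the point are added.\<close>

definition avg_fun :: "nat \<Rightarrow> ('a \<Rightarrow> real) \<Rightarrow> 'a \<Rightarrow> real" where
  "avg_fun n f x = (\<Sum>w\<in>level n. indicator (K w) x * cell_avg f w)"

lemma integrable_cell: "integrable m f \<Longrightarrow> integrable m (\<lambda>x. indicator (K w) x * f x :: real)"
  using integrable_mult_indicator[OF K_sets, of f] by simp

lemma integrable_indicator_cell: "integrable m (\<lambda>x. indicator (K w) x :: real)"
  by (intro integrable_real_indicator K_sets) (simp add: M.emeasure_eq_measure)

lemma cell_avg_eq: "cell_avg f w = (LINT x|m. indicator (K w) x * f x) / measure m (K w)"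
  by (simp add: cell_avg_def set_lebesgue_integral_def)

lemma cell_avg_mult: "cell_avg f w * measure m (K w) = (LINT x|m. indicator (K w) x * f x)"
  using measure_K_pos[of w] by (simp add: cell_avg_eq)

lemma cell_avg_diff: "integrable m f \<Longrightarrow> integrable m g \<Longrightarrow> cell_avg (\<lambda>x. f x - g x) w = cell_avg f w - cell_avg g w"
  by (simp add: cell_avg_eq right_diff_distrib integrable_cell diff_divide_distrib)

lemma cell_avg_add: "integrable m f \<Longrightarrow> integrable m g \<Longrightarrow> cell_avg (\<lambda>x. f x + g x) w = cell_avg f w + cell_avg g w"
  by (simp add: cell_avg_eq distrib_left integrable_cell add_divide_distrib)

lemma cell_avg_scale: "cell_avg (\<lambda>x. f x * c) w = cell_avg f w * c"
  by (simp add: cell_avg_eq mult.assoc[symmetric])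

lemma integrable_avg_fun: "integrable m (avg_fun n f)"
  unfolding avg_fun_def by (intro Bochner_Integration.integrable_sum integrable_mult_left integrable_indicator_cell)

lemma avg_fun_AE: "AE x in m. \<forall>w. x \<in> K w \<longrightarrow> avg_fun (height w) f x = cell_avg f w"
  using AE_unique_cell
proof eventually_elim
  fix x assume u: "\<forall>u v. height u = height v \<longrightarrow> x \<in> K u \<longrightarrow> x \<in> K v \<longrightarrow> u = v"
  show "\<forall>w. x \<in> K w \<longrightarrow> avg_fun (height w) f x = cell_avg f w"
  proof (intro allI impI)
    fix w assume w: "x \<in> K w"
    have "avg_fun (height w) f x = (\<Sum>v\<in>level (height w). if v = w then cell_avg f w else 0)"
      unfolding avg_fun_def using u w by (intro sum.cong) (auto simp: indicator_def)
    then show "avg_fun (height w) f x = cell_avg f w" using finite_level by simp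
  qed
qed

lemma sum_cells_AE: "AE x in m. (\<Sum>w\<in>level n. indicator (K w) x) = (1 :: real)"
  using AE_indicator_sum[of "level n" n, OF subset_refl] by eventually_elim (simp add: K_level)

text \<open>Averaging is a contraction of \<open>L\<^sup>1\<close>, so convergence needs to be known only on a dense class.\<close>

lemma avg_fun_L1:
  assumes f: "integrable m f"
  shows "(LINT x|m. \<bar>avg_fun n f x\<bar>) \<le> (LINT x|m. \<bar>f x\<bar>)"
proof -
  have "(LINT x|m. \<bar>avg_fun n f x\<bar>) \<le> (LINT x|m. (\<Sum>w\<in>level n. indicator (K w) x * \<bar>cell_avg f w\<bar>))"
  proof (rule integral_mono)
    show "integrable m (\<lambda>x. \<Sum>w\<in>level n. indicator (K w) x * \<bar>cell_avg f w\<bar>)"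
      by (intro Bochner_Integration.integrable_sum integrable_mult_left integrable_indicator_cell)
    show "\<bar>avg_fun n f x\<bar> \<le> (\<Sum>w\<in>level n. indicator (K w) x * \<bar>cell_avg f w\<bar>)" for x
      unfolding avg_fun_def by (rule order_trans[OF sum_abs]) (simp add: abs_mult)
  qed (use integrable_avg_fun in auto)
  also have "\<dots> = (\<Sum>w\<in>level n. measure m (K w) * \<bar>cell_avg f w\<bar>)"
    by (subst Bochner_Integration.integral_sum) (auto intro!: integrable_mult_left integrable_indicator_cell simp: mult.commute)
  also have "\<dots> \<le> (\<Sum>w\<in>level n. LINT x|m. indicator (K w) x * \<bar>f x\<bar>)"
  proof (rule sum_mono)
    fix w
    have "measure m (K w) * \<bar>cell_avg f w\<bar> = \<bar>LINT x|m. indicator (K w) x * f x\<bar>"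
      using cell_avg_mult[of f w] by (metis abs_mult abs_of_nonneg measure_nonneg mult.commute)
    also have "\<dots> \<le> (LINT x|m. \<bar>indicator (K w) x * f x\<bar>)" by (rule integral_abs_bound)
    also have "\<dots> = (LINT x|m. indicator (K w) x * \<bar>f x\<bar>)" by (simp add: abs_mult)
    finally show "measure m (K w) * \<bar>cell_avg f w\<bar> \<le> (LINT x|m. indicator (K w) x * \<bar>f x\<bar>)" .
  qed
  also have "\<dots> = (LINT x|m. (\<Sum>w\<in>level n. indicator (K w) x * \<bar>f x\<bar>))"
    using f by (intro Bochner_Integration.integral_sum[symmetric] integrable_cell) auto
  also have "\<dots> = (LINT x|m. \<bar>f x\<bar>)"
  proof (rule integral_cong_AE)
    show "AE x in m. (\<Sum>w\<in>level n. indicator (K w) x * \<bar>f x\<bar>) = \<bar>f x\<bar>"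
      using sum_cells_AE[of n] by eventually_elim (simp add: sum_distrib_right[symmetric])
    show "(\<lambda>x. \<Sum>w\<in>level n. indicator (K w) x * \<bar>f x\<bar>) \<in> borel_measurable m"
      using f by (intro borel_measurable_integrable Bochner_Integration.integrable_sum integrable_cell) auto
  qed (use f in auto)
  finally show ?thesis .
qed

definition avg_conv :: "('a \<Rightarrow> real) \<Rightarrow> bool" where
  "avg_conv f \<longleftrightarrow> integrable m f \<and> (\<lambda>n. LINT x|m. \<bar>avg_fun n f x - f x\<bar>) \<longlonglongrightarrow> 0"

lemma avg_convI:
  assumes f: "integrable m f"
    and e: "\<And>\<epsilon>. 0 < \<epsilon> \<Longrightarrow> \<exists>g. avg_conv g \<and> (LINT x|m. \<bar>f x - g x\<bar>) \<le> \<epsilon>"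
  shows "avg_conv f"
  unfolding avg_conv_def
proof (intro conjI f LIMSEQ_I)
  fix r :: real assume r: "0 < r"
  obtain g where g: "avg_conv g" "(LINT x|m. \<bar>f x - g x\<bar>) \<le> r / 4" using e[of "r / 4"] r by auto
  have gi: "integrable m g" using g by (simp add: avg_conv_def)
  have fg: "integrable m (\<lambda>x. f x - g x)" using f gi by simp
  obtain N where N: "\<And>n. N \<le> n \<Longrightarrow> norm ((LINT x|m. \<bar>avg_fun n g x - g x\<bar>) - 0) < r / 4"
    using LIMSEQ_D[of "\<lambda>n. LINT x|m. \<bar>avg_fun n g x - g x\<bar>" 0 "r / 4"] g(1) r by (auto simp: avg_conv_def)
  have "norm ((LINT x|m. \<bar>avg_fun n f x - f x\<bar>) - 0) < r" if n: "N \<le> n" for n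
  proof -
    have diff: "avg_fun n f x - avg_fun n g x = avg_fun n (\<lambda>x. f x - g x) x" for x
      unfolding avg_fun_def sum_subtractf[symmetric] by (simp add: cell_avg_diff[OF f gi] right_diff_distrib)
    have "(LINT x|m. \<bar>avg_fun n f x - f x\<bar>)
       \<le> (LINT x|m. \<bar>avg_fun n (\<lambda>x. f x - g x) x\<bar> + \<bar>avg_fun n g x - g x\<bar> + \<bar>f x - g x\<bar>)"
    proof (rule integral_mono)
      show "\<bar>avg_fun n f x - f x\<bar> \<le> \<bar>avg_fun n (\<lambda>x. f x - g x) x\<bar> + \<bar>avg_fun n g x - g x\<bar> + \<bar>f x - g x\<bar>" for x
        unfolding diff[symmetric] by linarith
    qed (use f gi fg integrable_avg_fun in auto)
    also have "\<dots> = (LINT x|m. \<bar>avg_fun n (\<lambda>x. f x - g x) x\<bar>) + (LINT x|m. \<bar>avg_fun n g x - g x\<bar>) + (LINT x|m. \<bar>f x - g x\<bar>)"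
      using f gi fg integrable_avg_fun by simp
    also have "\<dots> \<le> r / 4 + r / 4 + r / 4"
      using avg_fun_L1[OF fg, of n] g(2) N[OF n] by (intro add_mono) auto
    also have "\<dots> < r" using r by simp
    finally have "(LINT x|m. \<bar>avg_fun n f x - f x\<bar>) < r" .
    moreover have "0 \<le> (LINT x|m. \<bar>avg_fun n f x - f x\<bar>)" by simp
    ultimately show ?thesis by simp
  qed
  then show "\<exists>N. \<forall>n\<ge>N. norm ((LINT x|m. \<bar>avg_fun n f x - f x\<bar>) - 0) < r" by blast
qed

lemma avg_conv_dominated:
  assumes s: "\<And>i. avg_conv (s i)" and w: "integrable m w" "\<And>i x. \<bar>s i x\<bar> \<le> w x" and l: "\<And>x. (\<lambda>i. s i x) \<longlonglongrightarrow> f x"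
  shows "avg_conv f"
proof -
  have si: "integrable m (s i)" for i using s by (simp add: avg_conv_def)
  have fm: "f \<in> borel_measurable m" by (rule borel_measurable_LIMSEQ_real[where u = s]) (rule l, rule borel_measurable_integrable[OF si])
  have fw: "\<bar>f x\<bar> \<le> w x" for x
    using tendsto_rabs[OF l[of x]] w(2) by (intro LIMSEQ_le_const2) auto
  have fi: "integrable m f" using fw by (intro Bochner_Integration.integrable_bound[OF w(1) fm]) (auto intro: order_trans[OF _ abs_ge_self])
  have lim: "(\<lambda>i. LINT x|m. \<bar>f x - s i x\<bar>) \<longlonglongrightarrow> (LINT x|m. 0)"
  proof (rule integral_dominated_convergence[where w = "\<lambda>x. 2 * w x"])
    show "AE x in m. (\<lambda>i. \<bar>f x - s i x\<bar>) \<longlonglongrightarrow> 0"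
    proof (rule AE_I2)
      fix x show "(\<lambda>i. \<bar>f x - s i x\<bar>) \<longlonglongrightarrow> 0"
        using tendsto_rabs[OF tendsto_diff[OF tendsto_const[of "f x"] l[of x]]] by simp
    qed
    show "AE x in m. norm \<bar>f x - s i x\<bar> \<le> 2 * w x" for i
    proof (rule AE_I2)
      fix x show "norm \<bar>f x - s i x\<bar> \<le> 2 * w x" using fw[of x] w(2)[of i x] by simp
    qed
  qed (use w(1) fi si in auto)
  show ?thesis
  proof (rule avg_convI[OF fi])
    fix \<epsilon> :: real assume e: "0 < \<epsilon>"
    have "\<forall>\<^sub>F i in sequentially. (LINT x|m. \<bar>f x - s i x\<bar>) < \<epsilon>" using lim e by (intro order_tendstoD) auto
    then obtain i where "(LINT x|m. \<bar>f x - s i x\<bar>) < \<epsilon>" using eventually_happens'[OF sequentially_bot] by blast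
    then show "\<exists>g. avg_conv g \<and> (LINT x|m. \<bar>f x - g x\<bar>) \<le> \<epsilon>" using s by (intro exI[of _ "s i"]) auto
  qed
qed

lemma avg_conv_add:
  assumes "avg_conv f" "avg_conv g"
  shows "avg_conv (\<lambda>x. f x + g x)"
proof -
  have i: "integrable m f" "integrable m g" using assms by (auto simp: avg_conv_def)
  have lim: "(\<lambda>n. (LINT x|m. \<bar>avg_fun n f x - f x\<bar>) + (LINT x|m. \<bar>avg_fun n g x - g x\<bar>)) \<longlonglongrightarrow> 0 + 0"
    using assms by (intro tendsto_add) (auto simp: avg_conv_def)
  have "(\<lambda>n. LINT x|m. \<bar>avg_fun n (\<lambda>x. f x + g x) x - (f x + g x)\<bar>) \<longlonglongrightarrow> 0"
  proof (rule tendsto_sandwich[OF _ _ tendsto_const])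
    show "(\<lambda>n. (LINT x|m. \<bar>avg_fun n f x - f x\<bar>) + (LINT x|m. \<bar>avg_fun n g x - g x\<bar>)) \<longlonglongrightarrow> 0"
      using lim by simp
    show "\<forall>\<^sub>F n in sequentially. (LINT x|m. \<bar>avg_fun n (\<lambda>x. f x + g x) x - (f x + g x)\<bar>)
        \<le> (LINT x|m. \<bar>avg_fun n f x - f x\<bar>) + (LINT x|m. \<bar>avg_fun n g x - g x\<bar>)"
    proof (rule always_eventually, rule allI)
      fix n
      have add: "avg_fun n (\<lambda>x. f x + g x) x = avg_fun n f x + avg_fun n g x" for x
        unfolding avg_fun_def sum.distrib[symmetric] by (simp add: cell_avg_add[OF i] distrib_left)
      have "(LINT x|m. \<bar>avg_fun n (\<lambda>x. f x + g x) x - (f x + g x)\<bar>)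
         \<le> (LINT x|m. \<bar>avg_fun n f x - f x\<bar> + \<bar>avg_fun n g x - g x\<bar>)"
      proof (rule integral_mono)
        show "\<bar>avg_fun n (\<lambda>x. f x + g x) x - (f x + g x)\<bar> \<le> \<bar>avg_fun n f x - f x\<bar> + \<bar>avg_fun n g x - g x\<bar>" for x
          unfolding add by linarith
      qed (use i integrable_avg_fun in auto)
      also have "\<dots> = (LINT x|m. \<bar>avg_fun n f x - f x\<bar>) + (LINT x|m. \<bar>avg_fun n g x - g x\<bar>)"
        using i integrable_avg_fun by simp
      finally show "(LINT x|m. \<bar>avg_fun n (\<lambda>x. f x + g x) x - (f x + g x)\<bar>)
        \<le> (LINT x|m. \<bar>avg_fun n f x - f x\<bar>) + (LINT x|m. \<bar>avg_fun n g x - g x\<bar>)" .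
    qed
  qed simp
  then show ?thesis using i by (simp add: avg_conv_def)
qed

lemma avg_conv_scale:
  assumes "avg_conv f"
  shows "avg_conv (\<lambda>x. f x * c)"
proof -
  have i: "integrable m f" using assms by (auto simp: avg_conv_def)
  have "\<bar>avg_fun n (\<lambda>x. f x * c) x - f x * c\<bar> = \<bar>avg_fun n f x - f x\<bar> * \<bar>c\<bar>" for n x
    unfolding avg_fun_def cell_avg_scale
    by (simp add: mult.assoc[symmetric] sum_distrib_right[symmetric] left_diff_distrib[symmetric] abs_mult)
  then have "(\<lambda>n. LINT x|m. \<bar>avg_fun n (\<lambda>x. f x * c) x - f x * c\<bar>) = (\<lambda>n. (LINT x|m. \<bar>avg_fun n f x - f x\<bar>) * \<bar>c\<bar>)"
    by simp
  moreover have "(\<lambda>n. (LINT x|m. \<bar>avg_fun n f x - f x\<bar>) * \<bar>c\<bar>) \<longlonglongrightarrow> 0 * \<bar>c\<bar>"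
    using assms by (intro tendsto_mult tendsto_const) (auto simp: avg_conv_def)
  ultimately show ?thesis using i by (simp add: avg_conv_def)
qed

text \<open>Averaging over the cells of a fine level reproduces the indicator of a union of coarser cells exactly.\<close>

lemma avg_conv_cells:
  assumes V: "V \<subseteq> level n"
  shows "avg_conv (indicator (\<Union>v\<in>V. K v))"
proof -
  let ?A = "\<Union>v\<in>V. K v"
  have finV: "finite V" using finite_subset[OF V finite_level] .
  have As: "?A \<in> sets m" using finV K_sets by blast
  have Ai: "integrable m (indicator ?A :: 'a \<Rightarrow> real)" using As by (intro integrable_real_indicator) (simp_all add: M.emeasure_eq_measure)
  have avg: "cell_avg (indicator ?A) w = (if (parent ^^ k) w \<in> V then 1 else 0)" if w: "height w = n + k" for w k
  proof -
    have "AE x in m. indicator (K w) x * indicator ?A x = (if (parent ^^ k) w \<in> V then indicator (K w) x else (0::real))"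
      using AE_unique_cell
    proof eventually_elim
      fix x assume u: "\<forall>u v. height u = height v \<longrightarrow> x \<in> K u \<longrightarrow> x \<in> K v \<longrightarrow> u = v"
      show "indicator (K w) x * indicator ?A x = (if (parent ^^ k) w \<in> V then indicator (K w) x else (0::real))"
      proof (cases "x \<in> K w")
        case True
        then have a: "x \<in> K ((parent ^^ k) w)" using K_ancestor by blast
        have "x \<in> ?A \<longleftrightarrow> (parent ^^ k) w \<in> V"
        proof
          assume "x \<in> ?A"
          then obtain v where v: "v \<in> V" "x \<in> K v" by blast
          have "height v = height ((parent ^^ k) w)" using v V w by (auto simp: height_ancestor)
          then have "v = (parent ^^ k) w" using u v a by blast
          then show "(parent ^^ k) w \<in> V" using v by simp
        qed (use a in blast)
        then show ?thesis by (simp add: indicator_def)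
      qed simp
    qed
    then have "(LINT x|m. indicator (K w) x * indicator ?A x) = (LINT x|m. (if (parent ^^ k) w \<in> V then indicator (K w) x else (0::real)))"
      using As by (intro integral_cong_AE) (auto simp del: sets_m)
    also have "\<dots> = (if (parent ^^ k) w \<in> V then measure m (K w) else 0)" by simp
    finally show ?thesis using measure_K_pos[of w] by (simp add: cell_avg_eq)
  qed
  have "(LINT x|m. \<bar>avg_fun N (indicator ?A) x - indicator ?A x\<bar>) = 0" if N: "n \<le> N" for N
  proof -
    obtain k where k: "N = n + k" using N le_Suc_ex by blast
    have "AE x in m. \<bar>avg_fun N (indicator ?A) x - indicator ?A x\<bar> = (0::real)"
      using AE_unique_cell avg_fun_AE[of "indicator ?A"]
    proof eventually_elim
      fix x assume u: "\<forall>u v. height u = height v \<longrightarrow> x \<in> K u \<longrightarrow> x \<in> K v \<longrightarrow> u = v"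
        and a: "\<forall>w. x \<in> K w \<longrightarrow> avg_fun (height w) (indicator ?A) x = cell_avg (indicator ?A) w"
      obtain w where w: "height w = N" "x \<in> K w" using K_level[of N] level_iff by blast
      have 1: "avg_fun N (indicator ?A) x = (if (parent ^^ k) w \<in> V then 1 else 0)" using a avg[of w k] w k by auto
      have b: "x \<in> K ((parent ^^ k) w)" using K_ancestor w by blast
      have "x \<in> ?A \<longleftrightarrow> (parent ^^ k) w \<in> V"
      proof
        assume "x \<in> ?A"
        then obtain v where v: "v \<in> V" "x \<in> K v" by blast
        have "height v = height ((parent ^^ k) w)" using v V w k by (auto simp: height_ancestor)
        then have "v = (parent ^^ k) w" using u v b by blast
        then show "(parent ^^ k) w \<in> V" using v by simp
      qed (use b in blast)
      then show "\<bar>avg_fun N (indicator ?A) x - indicator ?A x\<bar> = (0::real)" using 1 by (simp add: indicator_def)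
    qed
    then have "(LINT x|m. \<bar>avg_fun N (indicator ?A) x - indicator ?A x\<bar>) = (LINT x|m. 0)"
      using Ai integrable_avg_fun by (intro integral_cong_AE) auto
    then show ?thesis by simp
  qed
  then have "(\<lambda>N. LINT x|m. \<bar>avg_fun N (indicator ?A) x - indicator ?A x\<bar>) \<longlonglongrightarrow> 0"
    by (intro tendsto_eventually eventually_sequentiallyI[of n])
  then show ?thesis using Ai by (simp add: avg_conv_def)
qed

text \<open>The indicator of an open set is the pointwise limit of those of the unions of the cells of level \<open>n\<close> contained in it.\<close>

lemma avg_conv_open:
  assumes U: "open U"
  shows "avg_conv (indicator U)"
proof -
  obtain c2 where c2: "0 < c2" "\<And>w. diameter (K w) \<le> c2 * rstar ^ height w" using geometry_constants by metis
  define V where "V n = {w \<in> level n. K w \<subseteq> U}" for n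
  define S where "S n = (\<Union>w\<in>V n. K w)" for n
  have SU: "S n \<subseteq> U" for n by (auto simp: S_def V_def)
  have ev: "\<forall>\<^sub>F n in sequentially. x \<in> S n" if x: "x \<in> U" for x
  proof -
    obtain \<epsilon> where e: "0 < \<epsilon>" "ball x \<epsilon> \<subseteq> U" using U x openE by blast
    from eventually_rstar_power_less[OF e(1), of c2] show ?thesis
    proof eventually_elim
      fix n assume n: "c2 * rstar ^ n < \<epsilon>"
      obtain w where w: "height w = n" "x \<in> K w" using K_level[of n] level_iff by blast
      have "K w \<subseteq> ball x \<epsilon>"
      proof
        fix y assume "y \<in> K w"
        then have "dist x y \<le> diameter (K w)" by (rule dist_cell_le_diameter[OF w(2)])
        also have "\<dots> < \<epsilon>" using c2(2)[of w] n w by simp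
        finally show "y \<in> ball x \<epsilon>" by simp
      qed
      then show "x \<in> S n" using e w by (auto simp: S_def V_def)
    qed
  qed
  show ?thesis
  proof (rule avg_conv_dominated[where s = "\<lambda>n. indicator (S n)" and w = "\<lambda>_. 1"])
    show "avg_conv (indicator (S n))" for n unfolding S_def by (rule avg_conv_cells[of _ n]) (auto simp: V_def)
    show "(\<lambda>i. indicator (S i) x) \<longlonglongrightarrow> (indicator U x :: real)" for x
    proof (cases "x \<in> U")
      case True
      then show ?thesis using ev[OF True] by (intro tendsto_eventually) (auto elim: eventually_mono)
    next
      case False
      then have "indicator (S i) x = (indicator U x :: real)" for i using SU by (auto simp: indicator_def)
      then show ?thesis by simp
    qed
  qed (auto simp: indicator_def)
qed

text \<open>Sets with convergent averages form a Dynkin system that contains the intersection-stable open sets.\<close>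

lemma avg_conv_indicator:
  assumes A: "A \<in> sets m"
  shows "avg_conv (indicator A)"
proof -
  have "Int_stable {U :: 'a set. open U}" "{U :: 'a set. open U} \<subseteq> Pow UNIV" by (auto simp: Int_stable_def)
  moreover have "A \<in> sigma_sets UNIV {U :: 'a set. open U}" using A by (simp add: borel_def)
  ultimately show ?thesis
  proof (induction rule: sigma_sets_induct_disjoint)
    case (basic A)
    then show ?case using avg_conv_open by simp
  next
    case empty
    show ?case by (rule avg_conv_open[OF open_empty])
  next
    case (compl A)
    have "avg_conv (\<lambda>x. indicator UNIV x + indicator A x * (- 1))"
      using avg_conv_open[of UNIV] compl by (intro avg_conv_add avg_conv_scale) auto
    moreover have "(\<lambda>x. indicator UNIV x + indicator A x * (- 1)) = (indicator (UNIV - A) :: 'a \<Rightarrow> real)"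
      by (auto simp: indicator_def)
    ultimately show ?case by simp
  next
    case (union A)
    have fin: "avg_conv (indicator (\<Union>i<n. A i))" for n
    proof (induction n)
      case 0
      show ?case unfolding lessThan_0 UN_empty by (rule avg_conv_open[OF open_empty])
    next
      case (Suc n)
      have "avg_conv (\<lambda>x. indicator (\<Union>i<n. A i) x + indicator (A n) x)"
        using Suc union by (intro avg_conv_add) auto
      moreover have "(\<lambda>x. indicator (\<Union>i<n. A i) x + indicator (A n) x) = (indicator (\<Union>i<Suc n. A i) :: 'a \<Rightarrow> real)"
      proof
        fix x
        have "A i \<inter> A n = {}" if "i < n" for i using that by (intro disjoint_family_onD[OF union(1)]) auto
        then have "\<not> (x \<in> A n \<and> x \<in> (\<Union>i<n. A i))" by blast
        then show "indicator (\<Union>i<n. A i) x + indicator (A n) x = (indicator (\<Union>i<Suc n. A i) x :: real)"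
          by (auto simp: indicator_def lessThan_Suc)
      qed
      ultimately show ?case by simp
    qed
    show ?case
    proof (rule avg_conv_dominated[where s = "\<lambda>n. indicator (\<Union>i<n. A i)" and w = "\<lambda>_. 1", OF fin])
      show "(\<lambda>n. indicator (\<Union>i<n. A i) x) \<longlonglongrightarrow> (indicator (\<Union>i. A i) x :: real)" for x
        by (rule LIMSEQ_indicator_UN)
    qed (auto simp: indicator_def)
  qed
qed

lemma avg_conv_integrable: "integrable m f \<Longrightarrow> avg_conv f"
proof (induction rule: integrable_induct)
  case (base A c)
  then show ?case using avg_conv_scale[OF avg_conv_indicator[of A], of c] by simp
next
  case (add f g)
  then show ?case using avg_conv_add by blast
next
  case (lim f s)
  show ?case
  proof (rule avg_conv_dominated)
    show "integrable m (\<lambda>x. 2 * \<bar>f x\<bar>)" using lim.hyps(4) by simp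
    show "avg_conv (s i)" for i by (rule lim.IH)
    show "\<bar>s i x\<bar> \<le> 2 * \<bar>f x\<bar>" for i x using lim.hyps(3)[of x i] by simp
    show "(\<lambda>i. s i x) \<longlonglongrightarrow> f x" for x using lim.hyps(2)[of x] by simp
  qed
qed

lemma discrete_avg_cell_avg:
  assumes f: "integrable m f"
  shows "discrete_avg k (cell_avg f) w = cell_avg f w"
proof -
  have "(\<Sum>v\<in>desc k w. cell_avg f v * measure m (K v)) = (\<Sum>v\<in>desc k w. LINT x|m. indicator (K v) x * f x)"
    by (simp only: cell_avg_mult)
  also have "\<dots> = (LINT x|m. (\<Sum>v\<in>desc k w. indicator (K v) x * f x))"
    using f by (intro Bochner_Integration.integral_sum[symmetric] integrable_cell)
  also have "\<dots> = (LINT x|m. indicator (K w) x * f x)"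
  proof (rule integral_cong_AE)
    have lev: "desc k w \<subseteq> level (height w + k)" by (auto simp: desc_iff)
    show "AE x in m. (\<Sum>v\<in>desc k w. indicator (K v) x * f x) = indicator (K w) x * f x"
      using AE_indicator_sum[OF lev, where 'b = real]
      by eventually_elim (simp add: sum_distrib_right[symmetric] K_desc[symmetric])
    show "(\<lambda>x. \<Sum>v\<in>desc k w. indicator (K v) x * f x) \<in> borel_measurable m"
      using f by (intro borel_measurable_integrable Bochner_Integration.integrable_sum integrable_cell)
    show "(\<lambda>x. indicator (K w) x * f x) \<in> borel_measurable m"
      using f by (intro borel_measurable_integrable integrable_cell)
  qed
  finally show ?thesis unfolding discrete_avg_eq by (simp add: cell_avg_eq)
qed

lemma avg_fun_AE_subseq:
  assumes f: "integrable m f" and P: "\<exists>\<^sub>F N in sequentially. P N"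
  shows "\<exists>r :: nat \<Rightarrow> nat. strict_mono r \<and> (\<forall>i. P (r i)) \<and> (AE x in m. (\<lambda>i. avg_fun (r i) f x) \<longlonglongrightarrow> f x)"
proof -
  have "infinite {N. P N}" using P by (simp add: frequently_cofinite[symmetric] cofinite_eq_sequentially)
  from infinite_enumerate[OF this] obtain r :: "nat \<Rightarrow> nat" where r: "strict_mono r" "\<And>i. P (r i)" by auto
  have "(\<lambda>n. LINT x|m. \<bar>avg_fun n f x - f x\<bar>) \<longlonglongrightarrow> 0" using avg_conv_integrable[OF f] by (simp add: avg_conv_def)
  then have l: "(\<lambda>i. LINT x|m. norm (avg_fun (r i) f x - f x)) \<longlonglongrightarrow> 0"
    using LIMSEQ_subseq_LIMSEQ[OF _ r(1)] by (fastforce simp: o_def)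
  have "integrable m (\<lambda>x. avg_fun (r i) f x - f x)" for i using f integrable_avg_fun by simp
  from tendsto_L1_AE_subseq[OF this l] obtain s where
    s: "strict_mono s" "AE x in m. (\<lambda>i. avg_fun (r (s i)) f x - f x) \<longlonglongrightarrow> 0" by blast
  have "AE x in m. (\<lambda>i. avg_fun ((r \<circ> s) i) f x) \<longlonglongrightarrow> f x"
    using s(2) by eventually_elim (simp add: LIM_zero_iff)
  then show ?thesis using strict_mono_o[OF r(1) s(1)] r(2) by (intro exI[of _ "r \<circ> s"]) auto
qed

end

section \<open>The Poincare inequality and the main estimate\<close>

context homogeneous_framework
begin

interpretation M: prob_space m by (rule prob)

lemma nn_integral_indicator_sum:
  assumes "finite A" "\<And>u. 0 \<le> c u"
  shows "(\<integral>\<^sup>+x. (\<Sum>u\<in>A. ennreal (c u) * indicator (K u) x) \<partial>m) = ennreal (\<Sum>u\<in>A. measure m (K u) * c u)"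
proof -
  have "(\<integral>\<^sup>+x. (\<Sum>u\<in>A. ennreal (c u) * indicator (K u) x) \<partial>m) = (\<Sum>u\<in>A. ennreal (c u) * emeasure m (K u))"
    by (subst nn_integral_sum) (auto simp: nn_integral_cmult_indicator simp del: sets_m)
  also have "\<dots> = (\<Sum>u\<in>A. ennreal (measure m (K u) * c u))"
    using assms by (intro sum.cong) (auto simp: M.emeasure_eq_measure ennreal_mult mult.commute)
  also have "\<dots> = ennreal (\<Sum>u\<in>A. measure m (K u) * c u)" using assms by (intro sum_ennreal) auto
  finally show ?thesis .
qed

text \<open>The discrete inequality for the cell averages of level \<open>N\<close> passes to the limit along a subsequence on
  which the averages converge almost everywhere, by Fatou's lemma. A bound for infinitely many
  \<open>N\<close> is enough to choose the subsequence, and this is what a limit inferior provides.\<close>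

lemma poincare:
  "\<exists>C>0. \<exists>L. \<forall>n V f t. V \<subseteq> level n \<longrightarrow> integrable m f \<longrightarrow>
     (\<exists>\<^sub>F N in sequentially. n \<le> N \<and> scaled_energy p N (Desc (N - n) (\<Union>w\<in>V. near L w)) f \<le> t) \<longrightarrow>
     (\<Sum>w\<in>V. \<integral>\<^sup>+x\<in>K w. ennreal (\<bar>f x - cell_avg f w\<bar> powr p) \<partial>m) \<le> ennreal (C * (mscale / sigma p) ^ n * t)"
proof -
  obtain C L where C: "0 < C" "\<And>n k V f. V \<subseteq> level n \<Longrightarrow>
     (\<Sum>u\<in>Desc k V. measure m (K u) * \<bar>f u - discrete_avg k f ((parent ^^ k) u)\<bar> powr p)
       \<le> C * mscale ^ n * sigma p ^ k * energy p (n + k) (Desc k (\<Union>w\<in>V. near L w)) f"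
    using discrete_poincare by blast
  have "(\<Sum>w\<in>V. \<integral>\<^sup>+x\<in>K w. ennreal (\<bar>f x - cell_avg f w\<bar> powr p) \<partial>m) \<le> ennreal (C * (mscale / sigma p) ^ n * t)"
    if V: "V \<subseteq> level n" and f: "integrable m f"
      and fr: "\<exists>\<^sub>F N in sequentially. n \<le> N \<and> scaled_energy p N (Desc (N - n) (\<Union>w\<in>V. near L w)) f \<le> t"
    for n V f t
  proof -
    let ?g = "cell_avg f"
    let ?B = "ennreal (C * (mscale / sigma p) ^ n * t)"
    have finV: "finite V" using finite_subset[OF V finite_level] .
    have fm: "f \<in> borel_measurable m" using f by (rule borel_measurable_integrable)
    obtain r where r: "\<And>i. n \<le> r i" "\<And>i. scaled_energy p (r i) (Desc (r i - n) (\<Union>w\<in>V. near L w)) f \<le> t"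
      "AE x in m. (\<lambda>i. avg_fun (r i) f x) \<longlonglongrightarrow> f x"
      using avg_fun_AE_subseq[OF f fr] by blast
    define \<Phi> where "\<Phi> h x = (\<Sum>w\<in>V. ennreal (\<bar>h x - ?g w\<bar> powr p) * indicator (K w) x)" for h x
    have meas: "\<Phi> h \<in> borel_measurable m" if "h \<in> borel_measurable m" for h
      using that unfolding \<Phi>_def by measurable
    have am: "avg_fun N f \<in> borel_measurable m" for N using integrable_avg_fun by (rule borel_measurable_integrable)
    have bound: "(\<integral>\<^sup>+x. \<Phi> (avg_fun (r i) f) x \<partial>m) \<le> ?B" for i
    proof -
      define k where "k = r i - n"
      have ri: "r i = n + k" using r(1)[of i] by (simp add: k_def)
      let ?c = "\<lambda>u. \<bar>?g u - ?g ((parent ^^ k) u)\<bar> powr p"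
      have finD: "finite (Desc k V)" using finite_Desc finV by blast
      have "AE x in m. \<Phi> (avg_fun (r i) f) x \<le> (\<Sum>u\<in>Desc k V. ennreal (?c u) * indicator (K u) x)"
        using AE_unique_cell avg_fun_AE[of f]
      proof eventually_elim
        fix x assume u: "\<forall>u v. height u = height v \<longrightarrow> x \<in> K u \<longrightarrow> x \<in> K v \<longrightarrow> u = v"
          and a: "\<forall>w. x \<in> K w \<longrightarrow> avg_fun (height w) f x = ?g w"
        show "\<Phi> (avg_fun (r i) f) x \<le> (\<Sum>u\<in>Desc k V. ennreal (?c u) * indicator (K u) x)"
        proof (cases "\<exists>w\<in>V. x \<in> K w")
          case False
          then have "\<Phi> (avg_fun (r i) f) x = 0" unfolding \<Phi>_def by (intro sum.neutral) auto
          then show ?thesis by simp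
        next
          case True
          then obtain w where w: "w \<in> V" "x \<in> K w" by blast
          obtain v where v: "v \<in> desc k w" "x \<in> K v" using w K_desc[of w k] by blast
          have hv: "height v = r i" "(parent ^^ k) v = w" using v w V ri by (auto simp: desc_iff)
          have vD: "v \<in> Desc k V" using v w by (auto simp: Desc_def)
          have "\<Phi> (avg_fun (r i) f) x = (\<Sum>w'\<in>V. if w' = w then ennreal (?c v) else 0)"
            unfolding \<Phi>_def
          proof (rule sum.cong[OF refl])
            fix w' assume w': "w' \<in> V"
            have "w \<in> level n" "w' \<in> level n" using w w' V by blast+
            then have "height w' = height w" by simp
            then have "x \<in> K w' \<longleftrightarrow> w' = w" using u w by blast
            moreover have "avg_fun (r i) f x = ?g v" using a v(2) hv(1) by metis
            ultimately show "ennreal (\<bar>avg_fun (r i) f x - ?g w'\<bar> powr p) * indicator (K w') x = (if w' = w then ennreal (?c v) else 0)"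
              using hv(2) by (auto simp: indicator_def)
          qed
          also have "\<dots> = ennreal (?c v) * indicator (K v) x" using finV w v by simp
          also have "\<dots> \<le> (\<Sum>u\<in>Desc k V. ennreal (?c u) * indicator (K u) x)"
            using finD vD by (intro member_le_sum[of v "Desc k V" "\<lambda>u. ennreal (?c u) * indicator (K u) x"]) auto
          finally show ?thesis .
        qed
      qed
      then have "(\<integral>\<^sup>+x. \<Phi> (avg_fun (r i) f) x \<partial>m) \<le> (\<integral>\<^sup>+x. (\<Sum>u\<in>Desc k V. ennreal (?c u) * indicator (K u) x) \<partial>m)"
        by (rule nn_integral_mono_AE)
      also have "\<dots> = ennreal (\<Sum>u\<in>Desc k V. measure m (K u) * ?c u)"
        by (rule nn_integral_indicator_sum[OF finD]) simp
      also have "\<dots> \<le> ?B"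
      proof (rule ennreal_leI)
        have "(\<Sum>u\<in>Desc k V. measure m (K u) * ?c u)
          \<le> C * mscale ^ n * sigma p ^ k * energy p (n + k) (Desc k (\<Union>w\<in>V. near L w)) ?g"
          using C(2)[OF V, of ?g k] by (simp add: discrete_avg_cell_avg[OF f])
        also have "\<dots> = C * (mscale / sigma p) ^ n * scaled_energy p (r i) (Desc (r i - n) (\<Union>w\<in>V. near L w)) f"
          using sigma_pos by (simp add: scaled_energy_def ri power_add power_divide)
        also have "\<dots> \<le> C * (mscale / sigma p) ^ n * t"
          using r(2)[of i] C(1) mscale sigma_pos by (intro mult_left_mono) auto
        finally show "(\<Sum>u\<in>Desc k V. measure m (K u) * ?c u) \<le> C * (mscale / sigma p) ^ n * t" .
      qed
      finally show ?thesis .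
    qed
    have "(\<Sum>w\<in>V. \<integral>\<^sup>+x\<in>K w. ennreal (\<bar>f x - ?g w\<bar> powr p) \<partial>m) = (\<integral>\<^sup>+x. \<Phi> f x \<partial>m)"
      unfolding \<Phi>_def using fm by (subst nn_integral_sum) (auto simp del: sets_m)
    also have "\<dots> = (\<integral>\<^sup>+x. liminf (\<lambda>i. \<Phi> (avg_fun (r i) f) x) \<partial>m)"
    proof (rule nn_integral_cong_AE)
      show "AE x in m. \<Phi> f x = liminf (\<lambda>i. \<Phi> (avg_fun (r i) f) x)"
        using r(3)
      proof eventually_elim
        fix x assume l: "(\<lambda>i. avg_fun (r i) f x) \<longlonglongrightarrow> f x"
        have "(\<lambda>i. \<Phi> (avg_fun (r i) f) x) \<longlonglongrightarrow> \<Phi> f x" unfolding \<Phi>_def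
        proof (rule tendsto_sum)
          fix w assume "w \<in> V"
          have "(\<lambda>i. \<bar>avg_fun (r i) f x - ?g w\<bar> powr p) \<longlonglongrightarrow> \<bar>f x - ?g w\<bar> powr p"
            using p by (intro tendsto_powr' tendsto_rabs tendsto_diff l tendsto_const) auto
          then have "(\<lambda>i. ennreal (\<bar>avg_fun (r i) f x - ?g w\<bar> powr p)) \<longlonglongrightarrow> ennreal (\<bar>f x - ?g w\<bar> powr p)"
            by (rule tendsto_ennrealI)
          then show "(\<lambda>i. ennreal (\<bar>avg_fun (r i) f x - ?g w\<bar> powr p) * indicator (K w) x)
              \<longlonglongrightarrow> ennreal (\<bar>f x - ?g w\<bar> powr p) * indicator (K w) x"
            by (cases "x \<in> K w") auto
        qed
        then show "\<Phi> f x = liminf (\<lambda>i. \<Phi> (avg_fun (r i) f) x)"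
          using lim_imp_Liminf[OF sequentially_bot] by metis
      qed
    qed
    also have "\<dots> \<le> liminf (\<lambda>i. \<integral>\<^sup>+x. \<Phi> (avg_fun (r i) f) x \<partial>m)"
      by (rule nn_integral_liminf) (rule meas[OF am])
    also have "\<dots> \<le> limsup (\<lambda>i. \<integral>\<^sup>+x. \<Phi> (avg_fun (r i) f) x \<partial>m)"
      by (rule Liminf_le_Limsup[OF sequentially_bot])
    also have "\<dots> \<le> ?B" using bound by (intro Limsup_bounded) auto
    finally show ?thesis .
  qed
  then show ?thesis using C(1) by (intro exI[of _ C] conjI exI[of _ L]) blast+
qed

lemma abs_diff_powr_le:
  fixes a b c d :: real
  shows "\<bar>a - d\<bar> powr p \<le> 3 powr p * (\<bar>a - b\<bar> powr p + \<bar>b - c\<bar> powr p + \<bar>d - c\<bar> powr p)"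
proof -
  let ?M = "max \<bar>a - b\<bar> (max \<bar>b - c\<bar> \<bar>d - c\<bar>)"
  have "\<bar>a - d\<bar> \<le> \<bar>a - b\<bar> + \<bar>b - c\<bar> + \<bar>d - c\<bar>" by linarith
  also have "\<dots> \<le> ?M + ?M + ?M" by (intro add_mono) auto
  finally have "\<bar>a - d\<bar> \<le> 3 * ?M" by simp
  then have "\<bar>a - d\<bar> powr p \<le> (3 * ?M) powr p" using p by (intro powr_mono2) auto
  also have "\<dots> = 3 powr p * ?M powr p" by (simp add: powr_mult)
  also have "?M powr p \<le> \<bar>a - b\<bar> powr p + \<bar>b - c\<bar> powr p + \<bar>d - c\<bar> powr p"
    by (cases "?M = \<bar>a - b\<bar>"; cases "?M = \<bar>b - c\<bar>") (auto simp: max_def split: if_splits)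
  finally show ?thesis by simp
qed

lemma near_dist:
  assumes c2: "\<And>w. diameter (K w) \<le> c2 * rstar ^ height w" and x: "x \<in> K w" and y: "y \<in> K v" and v: "v \<in> near M w"
  shows "dist x y \<le> real (Suc M) * (c2 * rstar ^ height w)"
  using y v
proof (induction M arbitrary: v y)
  have dK: "dist a b \<le> c2 * rstar ^ height u" if "a \<in> K u" "b \<in> K u" for a b u
    using dist_cell_le_diameter[OF that] c2[of u] by simp
  {
    case 0
    then show ?case using dK[OF x] by auto
  next
    case (Suc M)
    then obtain u where u: "u \<in> near M w" "adj u v" by (auto simp: near.simps)
    then obtain z where z: "z \<in> K u" "z \<in> K v" by (auto simp: adj_def)
    have "dist x y \<le> dist x z + dist z y" by (rule dist_triangle)
    also have "\<dots> \<le> real (Suc M) * (c2 * rstar ^ height w) + c2 * rstar ^ height v"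
      using Suc.IH[OF z(1) u(1)] dK[OF z(2) Suc.prems(1)] by simp
    also have "\<dots> = real (Suc (Suc M)) * (c2 * rstar ^ height w)"
      using height_near[OF Suc.prems(2)] by (simp add: algebra_simps)
    finally show ?case .
  }
qed

text \<open>Every radius is at least a multiple of the size of the cells of a level on which balls of that radius are
  covered by the \<open>Suc Mstar\<close>-neighbourhoods of cells; large radii belong to the root.\<close>

lemma radius_level:
  assumes "0 < c" "0 < r"
  shows "\<exists>n. (n = 0 \<or> r \<le> c * rstar ^ n) \<and> c * rstar * rstar ^ n < r"
proof -
  have ex: "\<exists>k. c * rstar * rstar ^ k < r"
    using eventually_happens'[OF sequentially_bot eventually_rstar_power_less[OF assms(2)]] by blast
  define n where "n = (LEAST k. c * rstar * rstar ^ k < r)"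
  have 1: "c * rstar * rstar ^ n < r" unfolding n_def using ex by (rule LeastI_ex)
  have 2: "r \<le> c * rstar ^ n" if "n \<noteq> 0"
  proof -
    obtain k where k: "n = Suc k" using \<open>n \<noteq> 0\<close> not0_implies_Suc by blast
    have "\<not> c * rstar * rstar ^ k < r" using not_less_Least[of k "\<lambda>k. c * rstar * rstar ^ k < r"] k by (simp add: n_def)
    then show ?thesis by (simp add: k mult.assoc)
  qed
  show ?thesis using 1 2 by (intro exI[of _ n]) (cases "n = 0"; simp)
qed

definition ball_energy :: "'a set \<Rightarrow> ('a \<Rightarrow> real) \<Rightarrow> real \<Rightarrow> ennreal" where
  "ball_energy A f r = (\<integral>\<^sup>+x\<in>A. ennreal (1 / measure m (ball x r)) *
     (\<integral>\<^sup>+y\<in>ball x r. ennreal (\<bar>f x - f y\<bar> powr p / r powr dw p) \<partial>m) \<partial>m)"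

text \<open>The double integral over pairs at distance less than \<open>r\<close> splits into oscillations on cells, bounded by the
  Poincare inequality, and differences of averages of nearby cells, bounded by edge increments.
  Replacing balls by cells inside the integrals also makes all integrands measurable.\<close>

lemma ball_energy_estimate:
  "\<exists>C>0. \<exists>R>0. \<forall>r>0. \<forall>A f t. integrable m f \<longrightarrow>
     (\<exists>\<^sub>F N in sequentially. scaled_energy p N (meeting N (\<Union>x\<in>A. ball x (R * r))) f \<le> t) \<longrightarrow>
     ball_energy A f r \<le> ennreal (C * t)"
proof -
  let ?M = "Suc Mstar"
  obtain c where c: "0 < c" "\<And>w x y. x \<in> K w \<Longrightarrow> height w = 0 \<or> dist x y < c * rstar ^ height w \<Longrightarrow>
            \<exists>v\<in>near ?M w. y \<in> K v"
    using far_cells_dist by metis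
  obtain c2 where c2: "0 < c2" "\<And>w. diameter (K w) \<le> c2 * rstar ^ height w" using geometry_constants by metis
  obtain a b where b: "0 < b" "\<And>w. measure m (K w) \<le> b * mscale ^ height w" using cell_measure_bounds by metis
  obtain D where D: "D \<ge> 1" "\<And>w. card (near ?M w) \<le> D" using card_near_bounded by blast
  obtain C1 L1 where C1: "0 < C1" "\<And>n V f t. V \<subseteq> level n \<Longrightarrow> integrable m f \<Longrightarrow>
     \<exists>\<^sub>F N in sequentially. n \<le> N \<and> scaled_energy p N (Desc (N - n) (\<Union>w\<in>V. near L1 w)) f \<le> t \<Longrightarrow>
     (\<Sum>w\<in>V. \<integral>\<^sup>+x\<in>K w. ennreal (\<bar>f x - cell_avg f w\<bar> powr p) \<partial>m) \<le> ennreal (C1 * (mscale / sigma p) ^ n * t)"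
    using poincare by blast
  obtain C2 L2 where C2: "0 < C2" "\<And>n k W f. W \<subseteq> level n \<Longrightarrow>
     (\<Sum>w\<in>W. \<Sum>v\<in>near ?M w. \<bar>discrete_avg k f w - discrete_avg k f v\<bar> powr p)
       \<le> C2 * sigma p ^ k * energy p (n + k) (Desc k (\<Union>w\<in>W. near L2 w)) f"
    using near_average_sum[of ?M] by blast
  define c' where "c' = c * rstar"
  define c'' where "c'' = min c' 1"
  define L where "L = ?M + L1 + L2"
  define R where "R = (real (Suc L) * c2 + 1) / c'"
  define B where "B = (CA / c'' powr Q) * (1 / c' powr dw p)"
  define C where "C = B * 3 powr p * b * (2 * real D * C1 + b * C2)"
  have c': "0 < c'" "0 < c''" using c rstar by (auto simp: c'_def c''_def)
  have R: "0 < R" using c2 c' by (simp add: R_def add_nonneg_pos)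
  have B: "0 < B" using CA c' by (simp add: B_def)
  have Cpos: "0 < C" using B b C1 C2 by (simp add: C_def add_nonneg_pos)
  have est: "ball_energy A f r \<le> ennreal (C * t)"
    if r: "0 < r" and f: "integrable m f"
      and fr: "\<exists>\<^sub>F N in sequentially. scaled_energy p N (meeting N (\<Union>x\<in>A. ball x (R * r))) f \<le> t"
    for r A f t
  proof -
    let ?g = "cell_avg f"
    have fm[measurable]: "f \<in> borel_measurable m" using f by (rule borel_measurable_integrable)
    have t0: "0 \<le> t"
    proof -
      obtain N where "scaled_energy p N (meeting N (\<Union>x\<in>A. ball x (R * r))) f \<le> t"
        using frequently_ex[OF fr] by blast
      moreover have "0 \<le> scaled_energy p N (meeting N (\<Union>x\<in>A. ball x (R * r))) f"
        unfolding scaled_energy_def using sigma_pos energy_nonneg by (intro mult_nonneg_nonneg) auto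
      ultimately show ?thesis by linarith
    qed
    obtain n where n: "n = 0 \<or> r \<le> c * rstar ^ n" "c' * rstar ^ n < r"
      using radius_level[OF c(1) r] by (auto simp: c'_def)
    define \<theta> where "\<theta> = (mscale / sigma p) ^ n"
    have \<theta>: "0 < \<theta>" using mscale sigma_pos by (simp add: \<theta>_def)
    have mn: "0 < mscale ^ n" using mscale by simp
    define W where "W = meeting n A"
    \<comment> \<open>\<open>W\<close> are the cells met by \<open>x\<close>, and \<open>V\<close> those met by \<open>x\<close> or \<open>y\<close>.\<close>
    define V where "V = (\<Union>w\<in>W. near ?M w)"
    have W: "W \<subseteq> level n" by (auto simp: W_def meeting_def)
    have finW: "finite W" using finite_subset[OF W finite_level] .
    have V: "V \<subseteq> level n" using W height_near unfolding V_def by fastforce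
    have finV: "finite V" using finite_subset[OF V finite_level] .
    have WV: "W \<subseteq> V" using near_self by (auto simp: V_def)
    \<comment> \<open>All cells that enter the discrete energies lie within \<open>R * r\<close> of \<open>A\<close>.\<close>
    have far: "Desc k (\<Union>w\<in>W. near L w) \<subseteq> meeting (n + k) (\<Union>x\<in>A. ball x (R * r))" for k
    proof
      fix u assume u: "u \<in> Desc k (\<Union>w\<in>W. near L w)"
      then obtain w where w: "w \<in> W" "(parent ^^ k) u \<in> near L w" "k \<le> height u" by (auto simp: Desc_iff)
      have hw: "height w = n" using w(1) W by auto
      have hu: "height u = n + k" using height_near[OF w(2)] w(3) hw by (simp add: height_ancestor)
      obtain x where x: "x \<in> A" "x \<in> K w" using w(1) by (auto simp: W_def meeting_def)
      obtain y where y: "y \<in> K u" using K_nonempty by blast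
      then have "y \<in> K ((parent ^^ k) u)" using K_ancestor by blast
      then have "dist x y \<le> real (Suc L) * (c2 * rstar ^ n)" using near_dist[OF c2(2) x(2) _ w(2)] hw by simp
      also have "\<dots> < (real (Suc L) * c2 + 1) * rstar ^ n" using rstar by (simp add: algebra_simps)
      also have "\<dots> = R * (c' * rstar ^ n)" using c' by (simp add: R_def)
      also have "\<dots> \<le> R * r" using n(2) R by (intro mult_left_mono) auto
      finally have "y \<in> ball x (R * r)" by simp
      then have "K u \<inter> (\<Union>x\<in>A. ball x (R * r)) \<noteq> {}" using x(1) y by blast
      then show "u \<in> meeting (n + k) (\<Union>x\<in>A. ball x (R * r))" using hu by (simp add: meeting_def)
    qed
    have frn: "\<exists>\<^sub>F N in sequentially. n \<le> N \<and> scaled_energy p N (meeting N (\<Union>x\<in>A. ball x (R * r))) f \<le> t"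
      using frequently_eventually_frequently[OF fr eventually_ge_at_top[of n]] by (simp add: conj_commute)
    have se_mono: "scaled_energy p N U f \<le> scaled_energy p N U' f" if "U \<subseteq> U'" for N U U'
      unfolding scaled_energy_def using sigma_pos that by (intro mult_left_mono energy_mono) auto
    define T where "T v = (\<integral>\<^sup>+x\<in>K v. ennreal (\<bar>f x - ?g v\<bar> powr p) \<partial>m)" for v
    have sumT: "(\<Sum>v\<in>V. T v) \<le> ennreal (C1 * \<theta> * t)"
      unfolding T_def \<theta>_def
    proof (rule C1(2)[OF V f])
      have sub: "(\<Union>v\<in>V. near L1 v) \<subseteq> (\<Union>w\<in>W. near L w)"
      proof
        fix u assume "u \<in> (\<Union>v\<in>V. near L1 v)"
        then obtain w v where w: "w \<in> W" "v \<in> near ?M w" "u \<in> near L1 v" by (auto simp: V_def)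
        have "u \<in> near (?M + L1) w" using near_trans[OF w(2,3)] .
        also have "\<dots> \<subseteq> near L w" by (rule near_mono) (simp add: L_def)
        finally show "u \<in> (\<Union>w\<in>W. near L w)" using w(1) by blast
      qed
      show "\<exists>\<^sub>F N in sequentially. n \<le> N \<and> scaled_energy p N (Desc (N - n) (\<Union>w\<in>V. near L1 w)) f \<le> t"
        using frn
      proof (rule frequently_elim1)
        fix N assume N: "n \<le> N \<and> scaled_energy p N (meeting N (\<Union>x\<in>A. ball x (R * r))) f \<le> t"
        have "Desc (N - n) (\<Union>w\<in>V. near L1 w) \<subseteq> meeting N (\<Union>x\<in>A. ball x (R * r))"
          using order_trans[OF Desc_mono[OF sub] far[of "N - n"]] N by simp
        then show "n \<le> N \<and> scaled_energy p N (Desc (N - n) (\<Union>w\<in>V. near L1 w)) f \<le> t"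
          using N se_mono order_trans by blast
      qed
    qed
    define \<tau> where "\<tau> v = enn2real (T v)" for v
    have T\<tau>: "T v = ennreal (\<tau> v)" if "v \<in> V" for v
    proof -
      have "T v \<le> (\<Sum>v\<in>V. T v)" using that finV by (intro member_le_sum) auto
      also note sumT
      finally have "T v < \<top>" using ennreal_less_top by (rule le_less_trans)
      then show ?thesis by (simp add: \<tau>_def less_top)
    qed
    have \<tau>0: "0 \<le> \<tau> v" for v by (simp add: \<tau>_def)
    have sum\<tau>: "(\<Sum>v\<in>V. \<tau> v) \<le> C1 * \<theta> * t"
    proof -
      have "ennreal (\<Sum>v\<in>V. \<tau> v) = (\<Sum>v\<in>V. ennreal (\<tau> v))" by (rule sum_ennreal[symmetric]) (rule \<tau>0)
      also have "\<dots> = (\<Sum>v\<in>V. T v)" by (intro sum.cong refl T\<tau>[symmetric])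
      also note sumT
      finally show ?thesis using C1 \<theta> t0 by (simp add: ennreal_le_iff)
    qed
    define G where "G = (\<Sum>w\<in>W. \<Sum>v\<in>near ?M w. \<bar>?g w - ?g v\<bar> powr p)"
    have G: "G \<le> C2 * t / sigma p ^ n"
    proof -
      obtain N where N: "n \<le> N" "scaled_energy p N (meeting N (\<Union>x\<in>A. ball x (R * r))) f \<le> t"
        using frequently_ex[OF frn] by blast
      define k where "k = N - n"
      have Nk: "N = n + k" using N by (simp add: k_def)
      have "G \<le> C2 * sigma p ^ k * energy p (n + k) (Desc k (\<Union>w\<in>W. near L2 w)) ?g"
        using C2(2)[OF W, of k ?g] by (simp add: G_def discrete_avg_cell_avg[OF f])
      also have "\<dots> = C2 / sigma p ^ n * scaled_energy p N (Desc k (\<Union>w\<in>W. near L2 w)) f"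
        using sigma_pos by (simp add: scaled_energy_def Nk power_add)
      also have "\<dots> \<le> C2 / sigma p ^ n * t"
      proof (intro mult_left_mono)
        have "(\<Union>w\<in>W. near L2 w) \<subseteq> (\<Union>w\<in>W. near L w)" using near_mono[of L2 L] by (auto simp: L_def)
        then have "Desc k (\<Union>w\<in>W. near L2 w) \<subseteq> meeting N (\<Union>x\<in>A. ball x (R * r))"
          using order_trans[OF Desc_mono far[of k]] Nk by simp
        then show "scaled_energy p N (Desc k (\<Union>w\<in>W. near L2 w)) f \<le> t" using N se_mono order_trans by blast
      qed (use C2 sigma_pos in auto)
      finally show ?thesis by simp
    qed
    define B1 where "B1 = CA / c'' powr Q / mscale ^ n"
    define B2 where "B2 = 1 / c' powr dw p / \<theta>"
    have B1: "0 \<le> B1" and B2: "0 \<le> B2" using CA c' mn \<theta> by (auto simp: B1_def B2_def)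
    have mball: "1 / measure m (ball x r) \<le> B1" for x
    proof -
      have r1: "rstar ^ n \<le> 1" using rstar by (intro power_le_one) auto
      have s: "0 < c'' * rstar ^ n" "c'' * rstar ^ n \<le> r"
      proof -
        show "0 < c'' * rstar ^ n" using c' rstar by simp
        have "c'' * rstar ^ n \<le> c' * rstar ^ n" using rstar by (intro mult_right_mono) (auto simp: c''_def)
        then show "c'' * rstar ^ n \<le> r" using n(2) by linarith
      qed
      have "c'' * rstar ^ n \<le> 1 * 1" using r1 rstar by (intro mult_mono) (auto simp: c''_def)
      then have "(c'' * rstar ^ n) powr Q / CA \<le> measure m (ball x (c'' * rstar ^ n))" using ahlfors[of "c'' * rstar ^ n" x] s by simp
      also have "\<dots> \<le> measure m (ball x r)" using s by (intro M.finite_measure_mono subset_ball) auto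
      finally have "c'' powr Q * mscale ^ n / CA \<le> measure m (ball x r)" using c' by (simp add: powr_mscale)
      moreover have "0 < c'' powr Q * mscale ^ n / CA" using c' mn CA by simp
      ultimately have "1 / measure m (ball x r) \<le> 1 / (c'' powr Q * mscale ^ n / CA)"
        by (intro divide_left_mono mult_pos_pos) auto
      then show ?thesis by (simp add: B1_def)
    qed
    have rdw: "z / r powr dw p \<le> B2 * z" if "0 \<le> z" for z
    proof -
      have "(c' * rstar ^ n) powr dw p \<le> r powr dw p" using n(2) dw_pos c' rstar by (intro powr_mono2) auto
      then have "c' powr dw p * \<theta> \<le> r powr dw p" using c' rstar powr_dw[of n] by (simp add: powr_mult \<theta>_def)
      moreover have "0 < c' powr dw p * \<theta>" using c' \<theta> by simp
      ultimately have "z / r powr dw p \<le> z / (c' powr dw p * \<theta>)" using that r c' \<theta> by (intro divide_left_mono mult_pos_pos) auto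
      then show ?thesis by (simp add: B2_def)
    qed
    define B3 where "B3 = B2 * 3 powr p"
    have B3: "0 \<le> B3" using B2 by (simp add: B3_def)
    define Y where "Y w z = (\<Sum>v\<in>near ?M w. B3 * (measure m (K v) * (z + \<bar>?g w - ?g v\<bar> powr p) + \<tau> v))" for w z
    have inner: "(\<integral>\<^sup>+y\<in>ball x r. ennreal (\<bar>f x - f y\<bar> powr p / r powr dw p) \<partial>m) \<le> ennreal (Y w (\<bar>f x - ?g w\<bar> powr p))"
      if w: "w \<in> W" "x \<in> K w" for x w
    proof -
      have hw: "height w = n" using w(1) W by auto
      let ?a = "\<lambda>v. \<bar>f x - ?g w\<bar> powr p + \<bar>?g w - ?g v\<bar> powr p"
      have "(\<integral>\<^sup>+y\<in>ball x r. ennreal (\<bar>f x - f y\<bar> powr p / r powr dw p) \<partial>m)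
        \<le> (\<integral>\<^sup>+y. (\<Sum>v\<in>near ?M w. ennreal (B3 * ?a v) * indicator (K v) y + ennreal B3 * (ennreal (\<bar>f y - ?g v\<bar> powr p) * indicator (K v) y)) \<partial>m)"
      proof (rule nn_integral_mono)
        fix y
        show "ennreal (\<bar>f x - f y\<bar> powr p / r powr dw p) * indicator (ball x r) y
           \<le> (\<Sum>v\<in>near ?M w. ennreal (B3 * ?a v) * indicator (K v) y + ennreal B3 * (ennreal (\<bar>f y - ?g v\<bar> powr p) * indicator (K v) y))"
        proof (cases "y \<in> ball x r")
          case True
          have "height w = 0 \<or> dist x y < c * rstar ^ height w" using True n(1) hw by auto
          then obtain v where v: "v \<in> near ?M w" "y \<in> K v" using c(2)[OF w(2)] by blast
          have "\<bar>f x - f y\<bar> powr p / r powr dw p \<le> B2 * \<bar>f x - f y\<bar> powr p" by (rule rdw) simp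
          also have "\<dots> \<le> B2 * (3 powr p * (?a v + \<bar>f y - ?g v\<bar> powr p))"
            using B2 abs_diff_powr_le[of "f x" "f y" "?g w" "?g v"] by (intro mult_left_mono) auto
          also have "\<dots> = B3 * ?a v + B3 * \<bar>f y - ?g v\<bar> powr p" by (simp add: B3_def algebra_simps)
          finally have "ennreal (\<bar>f x - f y\<bar> powr p / r powr dw p) \<le> ennreal (B3 * ?a v + B3 * \<bar>f y - ?g v\<bar> powr p)"
            by (rule ennreal_leI)
          also have "\<dots> = ennreal (B3 * ?a v) * indicator (K v) y + ennreal B3 * (ennreal (\<bar>f y - ?g v\<bar> powr p) * indicator (K v) y)"
            using v(2) B3 by (simp add: ennreal_plus ennreal_mult)
          also have "\<dots> \<le> (\<Sum>v\<in>near ?M w. ennreal (B3 * ?a v) * indicator (K v) y + ennreal B3 * (ennreal (\<bar>f y - ?g v\<bar> powr p) * indicator (K v) y))"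
            using v(1) finite_near by (intro member_le_sum[of v "near ?M w" "\<lambda>v. ennreal (B3 * ?a v) * indicator (K v) y + ennreal B3 * (ennreal (\<bar>f y - ?g v\<bar> powr p) * indicator (K v) y)"]) auto
          finally show ?thesis using True by simp
        qed simp
      qed
      also have "\<dots> = (\<Sum>v\<in>near ?M w. ennreal (B3 * ?a v) * emeasure m (K v) + ennreal B3 * T v)"
        unfolding T_def
        by (subst nn_integral_sum) (auto simp: nn_integral_add nn_integral_cmult nn_integral_cmult_indicator simp del: sets_m)
      also have "\<dots> = (\<Sum>v\<in>near ?M w. ennreal (B3 * (measure m (K v) * ?a v + \<tau> v)))"
      proof (rule sum.cong[OF refl])
        fix v assume "v \<in> near ?M w"
        then have "v \<in> V" using w(1) by (auto simp: V_def)
        then show "ennreal (B3 * ?a v) * emeasure m (K v) + ennreal B3 * T v = ennreal (B3 * (measure m (K v) * ?a v + \<tau> v))"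
          using B3 \<tau>0[of v] by (simp add: T\<tau> M.emeasure_eq_measure ennreal_mult[symmetric] ennreal_plus[symmetric] algebra_simps del: ennreal_plus)
      qed
      also have "\<dots> = ennreal (Y w (\<bar>f x - ?g w\<bar> powr p))"
        unfolding Y_def using B3 \<tau>0 by (intro sum_ennreal) (auto intro!: mult_nonneg_nonneg add_nonneg_nonneg)
      finally show ?thesis .
    qed
    \<comment> \<open>The bound for the inner integral is affine in \<open>\<bar>f x - ?g w\<bar> powr p\<close>, so that the outer integral is again an oscillation.\<close>
    define \<alpha> where "\<alpha> w = (\<Sum>v\<in>near ?M w. B3 * measure m (K v))" for w
    define \<beta> where "\<beta> w = (\<Sum>v\<in>near ?M w. B3 * (measure m (K v) * \<bar>?g w - ?g v\<bar> powr p + \<tau> v))" for w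
    have \<alpha>0: "0 \<le> \<alpha> w" for w unfolding \<alpha>_def using B3 by (intro sum_nonneg) auto
    have \<beta>0: "0 \<le> \<beta> w" for w unfolding \<beta>_def using B3 \<tau>0 by (intro sum_nonneg mult_nonneg_nonneg add_nonneg_nonneg) auto
    have Y: "Y w z = \<alpha> w * z + \<beta> w" for w z
      unfolding Y_def \<alpha>_def \<beta>_def sum_distrib_right sum.distrib[symmetric] by (intro sum.cong) (auto simp: algebra_simps)
    have "ball_energy A f r \<le> (\<integral>\<^sup>+x. (\<Sum>w\<in>W. ennreal (B1 * \<alpha> w) * (ennreal (\<bar>f x - ?g w\<bar> powr p) * indicator (K w) x) + ennreal (B1 * \<beta> w) * indicator (K w) x) \<partial>m)"
      unfolding ball_energy_def
    proof (rule nn_integral_mono)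
      fix x
      let ?h = "\<lambda>w. ennreal (B1 * \<alpha> w) * (ennreal (\<bar>f x - ?g w\<bar> powr p) * indicator (K w) x) + ennreal (B1 * \<beta> w) * indicator (K w) x"
      let ?i = "\<integral>\<^sup>+y\<in>ball x r. ennreal (\<bar>f x - f y\<bar> powr p / r powr dw p) \<partial>m"
      show "ennreal (1 / measure m (ball x r)) * ?i * indicator A x \<le> (\<Sum>w\<in>W. ?h w)"
      proof (cases "x \<in> A")
        case True
        obtain w where w: "height w = n" "x \<in> K w" using K_level[of n] level_iff by blast
        then have wW: "w \<in> W" using True by (auto simp: W_def meeting_def)
        let ?z = "\<bar>f x - ?g w\<bar> powr p"
        have "ennreal (1 / measure m (ball x r)) * ?i \<le> ennreal B1 * ennreal (Y w ?z)"
          using mball[of x] inner[OF wW w(2)] by (intro mult_mono ennreal_leI) auto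
        also have "\<dots> = ennreal (B1 * \<alpha> w) * ennreal ?z + ennreal (B1 * \<beta> w)"
          using B1 \<alpha>0[of w] \<beta>0[of w]
          by (simp add: Y ennreal_mult[symmetric] ennreal_plus[symmetric] algebra_simps del: ennreal_plus)
        also have "\<dots> = ?h w" using w(2) by simp
        also have "\<dots> \<le> (\<Sum>w\<in>W. ?h w)" using wW finW by (intro member_le_sum[of w W ?h]) auto
        finally show ?thesis using True by simp
      qed simp
    qed
    also have "\<dots> = (\<Sum>w\<in>W. ennreal (B1 * \<alpha> w) * T w + ennreal (B1 * \<beta> w) * emeasure m (K w))"
      unfolding T_def
      by (subst nn_integral_sum) (auto simp: nn_integral_add nn_integral_cmult nn_integral_cmult_indicator simp del: sets_m)
    also have "\<dots> = (\<Sum>w\<in>W. ennreal (B1 * (\<alpha> w * \<tau> w + \<beta> w * measure m (K w))))"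
    proof (rule sum.cong[OF refl])
      fix w assume "w \<in> W"
      then have "w \<in> V" using WV by blast
      then show "ennreal (B1 * \<alpha> w) * T w + ennreal (B1 * \<beta> w) * emeasure m (K w) = ennreal (B1 * (\<alpha> w * \<tau> w + \<beta> w * measure m (K w)))"
        using B1 \<alpha>0[of w] \<beta>0[of w] \<tau>0[of w]
        by (simp add: T\<tau> M.emeasure_eq_measure ennreal_mult[symmetric] ennreal_plus[symmetric] algebra_simps del: ennreal_plus)
    qed
    also have "\<dots> = ennreal (\<Sum>w\<in>W. B1 * (\<alpha> w * \<tau> w + \<beta> w * measure m (K w)))"
      using B1 \<alpha>0 \<beta>0 \<tau>0 by (intro sum_ennreal) (auto intro!: mult_nonneg_nonneg add_nonneg_nonneg)
    also have "\<dots> \<le> ennreal (C * t)"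
    proof (rule ennreal_leI)
      let ?bn = "b * mscale ^ n"
      have bn: "0 \<le> ?bn" using b mn by simp
      have mK: "measure m (K v) \<le> ?bn" if "height v = n" for v using b(2)[of v] that by simp
      have wn: "height w = n" if "w \<in> W" for w using that W by auto
      have nn: "height v = n" if "w \<in> W" "v \<in> near ?M w" for v w using height_near[OF that(2)] wn[OF that(1)] by simp
      have 1: "(\<Sum>w\<in>W. \<alpha> w * \<tau> w) \<le> B3 * ?bn * real D * (C1 * \<theta> * t)"
      proof -
        have "\<alpha> w \<le> B3 * ?bn * real D" if w: "w \<in> W" for w
        proof -
          have "\<alpha> w \<le> (\<Sum>v\<in>near ?M w. B3 * ?bn)" unfolding \<alpha>_def using mK nn w B3 by (intro sum_mono mult_left_mono) auto
          also have "\<dots> = real (card (near ?M w)) * (B3 * ?bn)" by simp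
          also have "\<dots> \<le> real D * (B3 * ?bn)" using D(2)[of w] mult_nonneg_nonneg[OF B3 bn] by (intro mult_right_mono of_nat_mono)
          finally show ?thesis by (simp add: mult_ac)
        qed
        then have "(\<Sum>w\<in>W. \<alpha> w * \<tau> w) \<le> (\<Sum>w\<in>W. B3 * ?bn * real D * \<tau> w)" using \<tau>0 by (intro sum_mono mult_right_mono) auto
        also have "\<dots> = B3 * ?bn * real D * (\<Sum>w\<in>W. \<tau> w)" by (simp add: sum_distrib_left)
        also have "(\<Sum>w\<in>W. \<tau> w) \<le> (\<Sum>v\<in>V. \<tau> v)" using finV WV \<tau>0 by (intro sum_mono2) auto
        also note sum\<tau>
        finally show ?thesis using B3 bn by (simp add: mult_left_mono)
      qed
      have 2: "(\<Sum>w\<in>W. \<beta> w) \<le> B3 * (?bn * (C2 * t / sigma p ^ n) + real D * (C1 * \<theta> * t))"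
      proof -
        have "(\<Sum>w\<in>W. \<beta> w) \<le> (\<Sum>w\<in>W. \<Sum>v\<in>near ?M w. B3 * (?bn * \<bar>?g w - ?g v\<bar> powr p + \<tau> v))"
          unfolding \<beta>_def using mK nn B3 by (intro sum_mono mult_left_mono add_mono mult_right_mono) auto
        also have "\<dots> = B3 * (?bn * G + (\<Sum>w\<in>W. \<Sum>v\<in>near ?M w. \<tau> v))"
          unfolding G_def by (simp add: sum_distrib_left sum.distrib distrib_left mult.assoc)
        also have "(\<Sum>w\<in>W. \<Sum>v\<in>near ?M w. \<tau> v) \<le> real D * (\<Sum>v\<in>V. \<tau> v)"
        proof -
          have "(\<Sum>w\<in>W. \<Sum>v\<in>near ?M w. \<tau> v) = (\<Sum>w\<in>W. \<Sum>v\<in>V. if v \<in> near ?M w then \<tau> v else 0)"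
          proof (rule sum.cong[OF refl])
            fix w assume "w \<in> W"
            then have "near ?M w = {v \<in> V. v \<in> near ?M w}" by (auto simp: V_def)
            then have "(\<Sum>v\<in>near ?M w. \<tau> v) = (\<Sum>v\<in>{v \<in> V. v \<in> near ?M w}. \<tau> v)" by (rule arg_cong)
            then show "(\<Sum>v\<in>near ?M w. \<tau> v) = (\<Sum>v\<in>V. if v \<in> near ?M w then \<tau> v else 0)"
              by (simp only: sum.inter_filter[OF finV])
          qed
          also have "\<dots> = (\<Sum>v\<in>V. \<Sum>w\<in>W. if v \<in> near ?M w then \<tau> v else 0)" by (rule sum.swap)
          also have "\<dots> = (\<Sum>v\<in>V. real (card {w \<in> W. v \<in> near ?M w}) * \<tau> v)"
            by (intro sum.cong refl) (simp add: sum.inter_filter[OF finW, symmetric])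
          also have "\<dots> \<le> (\<Sum>v\<in>V. real D * \<tau> v)"
          proof (intro sum_mono mult_right_mono of_nat_mono \<tau>0)
            fix v
            have "card {w \<in> W. v \<in> near ?M w} \<le> card (near ?M v)" by (rule card_mono[OF finite_near]) (use near_sym in blast)
            then show "card {w \<in> W. v \<in> near ?M w} \<le> D" using D(2)[of v] by simp
          qed
          finally show ?thesis by (simp add: sum_distrib_left)
        qed
        also have "real D * (\<Sum>v\<in>V. \<tau> v) \<le> real D * (C1 * \<theta> * t)" using sum\<tau> by (intro mult_left_mono) auto
        also have "?bn * G \<le> ?bn * (C2 * t / sigma p ^ n)" using G bn by (intro mult_left_mono)
        finally show ?thesis using B3 by (simp add: mult_left_mono)
      qed
      have "(\<Sum>w\<in>W. B1 * (\<alpha> w * \<tau> w + \<beta> w * measure m (K w))) \<le> (\<Sum>w\<in>W. B1 * (\<alpha> w * \<tau> w + \<beta> w * ?bn))"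
        using B1 \<beta>0 mK wn by (intro sum_mono mult_left_mono add_left_mono) auto
      also have "\<dots> = B1 * ((\<Sum>w\<in>W. \<alpha> w * \<tau> w) + (\<Sum>w\<in>W. \<beta> w) * ?bn)"
        by (simp add: sum_distrib_left sum_distrib_right sum.distrib distrib_left)
      also have "\<dots> \<le> B1 * (B3 * ?bn * real D * (C1 * \<theta> * t) + B3 * (?bn * (C2 * t / sigma p ^ n) + real D * (C1 * \<theta> * t)) * ?bn)"
        using 1 2 B1 bn by (intro mult_left_mono add_mono mult_right_mono) auto
      also have "\<dots> = C * t"
      proof -
        have "\<theta> * sigma p ^ n = mscale ^ n" using sigma_pos by (simp add: \<theta>_def power_divide)
        then have "mscale ^ n / sigma p ^ n = \<theta>" using sigma_pos by (simp add: field_simps)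
        then have e: "?bn * (C2 * t / sigma p ^ n) = b * C2 * \<theta> * t" by (metis times_divide_eq_right mult.assoc mult.commute)
        have "B1 * (?bn * \<theta>) * B3 = B * 3 powr p * b"
          using mn \<theta> mscale(1) by (simp add: B1_def B3_def B2_def B_def)
        moreover have "C * t = (B * 3 powr p * b) * ((2 * real D * C1 + b * C2) * t)" by (simp only: C_def mult.assoc)
        ultimately have "C * t = (B1 * (?bn * \<theta>) * B3) * ((2 * real D * C1 + b * C2) * t)" by (simp only:)
        also have "\<dots> = B1 * (B3 * ?bn * real D * (C1 * \<theta> * t) + B3 * (b * C2 * \<theta> * t + real D * (C1 * \<theta> * t)) * ?bn)"
          by (simp add: algebra_simps)
        finally show ?thesis unfolding e by simp
      qed
      finally show "(\<Sum>w\<in>W. B1 * (\<alpha> w * \<tau> w + \<beta> w * measure m (K w))) \<le> C * t" .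
    qed
    finally show ?thesis .
  qed
  show ?thesis by (intro exI[of _ C] conjI Cpos exI[of _ R] R allI impI est)
qed

end

section \<open>Local and global Korevaar-Schoen bounds\<close>

lemma ennreal_powr_inverse: "0 < p \<Longrightarrow> ennreal_powr (ennreal_powr x (1 / p)) p = x"
  by (cases x) (auto simp: ennreal_powr_def powr_powr)

lemma eventually_at_right_scale:
  fixes R :: real
  assumes "0 < R" "eventually P (at_right 0)"
  shows "eventually (\<lambda>r. P (R * r)) (at_right 0)"
proof -
  obtain b where b: "0 < b" "\<And>y. 0 < y \<Longrightarrow> y < b \<Longrightarrow> P y"
    using assms(2) unfolding eventually_at_right[OF zero_less_one] by auto
  then show ?thesis unfolding eventually_at_right[OF zero_less_one]
    using assms(1) by (intro exI[of _ "b / R"]) (auto simp: field_simps)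
qed

context homogeneous_framework
begin

interpretation M: prob_space m by (rule prob)

text \<open>The restriction of \<open>f\<close> to \<open>F\<close>, extended by zero, is integrable because \<open>m\<close> is finite.\<close>

lemma integrable_restriction:
  assumes "in_Lp m p F f"
  shows "integrable m (\<lambda>x. indicator F x * f x :: real)"
proof (rule integrableI_bounded)
  let ?g = "\<lambda>x. indicator F x * f x"
  show gm: "?g \<in> borel_measurable m" using assms by (simp add: in_Lp_def set_borel_measurable_def)
  have "(\<integral>\<^sup>+x. ennreal (norm (?g x)) \<partial>m) \<le> (\<integral>\<^sup>+x. 1 + ennreal (\<bar>?g x\<bar> powr p) \<partial>m)"
  proof (rule nn_integral_mono)
    fix x
    have "\<bar>?g x\<bar> \<le> 1 + \<bar>?g x\<bar> powr p"
    proof (cases "\<bar>?g x\<bar> \<le> 1")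
      case False
      then have "\<bar>?g x\<bar> powr 1 \<le> \<bar>?g x\<bar> powr p" using p by (intro powr_mono) auto
      then show ?thesis using False by simp
    qed (auto intro: order_trans)
    then have "ennreal (norm (?g x)) \<le> ennreal (1 + \<bar>?g x\<bar> powr p)" by (intro ennreal_leI) simp
    then show "ennreal (norm (?g x)) \<le> 1 + ennreal (\<bar>?g x\<bar> powr p)" by simp
  qed
  also have "\<dots> = 1 + (\<integral>\<^sup>+x. ennreal (\<bar>?g x\<bar> powr p) \<partial>m)"
    using gm M.emeasure_space_1 by (subst nn_integral_add) auto
  also have "(\<integral>\<^sup>+x. ennreal (\<bar>?g x\<bar> powr p) \<partial>m) = (\<integral>\<^sup>+x\<in>F. ennreal (\<bar>f x\<bar> powr p) \<partial>m)"
    using p by (intro nn_integral_cong) (auto simp: indicator_def)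
  also have "1 + \<dots> < \<infinity>" using assms by (simp add: in_Lp_def)
  finally show "(\<integral>\<^sup>+x. ennreal (norm (?g x)) \<partial>m) < \<infinity>" .
qed

text \<open>Near a set whose closure lies in the open set \<open>F\<close>, all balls and all small cells involved stay
  inside \<open>F\<close>, so that \<open>f\<close> and its restriction to \<open>F\<close> have the same integrals and the same averages.\<close>

lemma scaled_energy_restriction:
  assumes F: "open F" and A: "closure A \<subseteq> F"
  shows "\<exists>\<delta>>0. (\<Union>x\<in>A. ball x \<delta>) \<subseteq> F \<and> (\<forall>s\<le>\<delta>. \<forall>f. \<forall>\<^sub>F N in sequentially.
     scaled_energy p N (meeting N (\<Union>x\<in>A. ball x s)) (\<lambda>x. indicator F x * f x)
       = scaled_energy p N (meeting N (\<Union>x\<in>A. ball x s)) f)"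
proof -
  have "compact (closure A)" using compact_space compact_Int_closed[of UNIV "closure A"] by simp
  then obtain e where e: "0 < e" "(\<Union>x\<in>closure A. ball x e) \<subseteq> F"
    using compact_subset_open_imp_ball_epsilon_subset[OF _ F A] by blast
  obtain c2 where c2: "0 < c2" "\<And>w. diameter (K w) \<le> c2 * rstar ^ height w" using geometry_constants by metis
  have small: "\<forall>\<^sub>F k in sequentially. c2 * rstar ^ k < e / 2" using e(1) by (intro eventually_rstar_power_less) simp
  have "\<forall>\<^sub>F N in sequentially.
     scaled_energy p N (meeting N (\<Union>x\<in>A. ball x s)) (\<lambda>x. indicator F x * f x)
       = scaled_energy p N (meeting N (\<Union>x\<in>A. ball x s)) f" if s: "s \<le> e / 2" for s f
    using small
  proof eventually_elim
    fix N assume N: "c2 * rstar ^ N < e / 2"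
    have "cell_avg (\<lambda>x. indicator F x * f x) w = cell_avg f w" if w: "w \<in> meeting N (\<Union>x\<in>A. ball x s)" for w
    proof -
      obtain x y where xy: "x \<in> A" "dist x y < s" "y \<in> K w" and hw: "height w = N" using w by (auto simp: meeting_def)
      have "K w \<subseteq> F"
      proof
        fix z assume z: "z \<in> K w"
        have "dist y z \<le> diameter (K w)" using xy(3) z by (rule dist_cell_le_diameter)
        then have "dist y z < e / 2" using c2(2)[of w] N hw by simp
        then have "z \<in> ball x e" using xy(2) s dist_triangle[of x z y] by simp
        moreover have "x \<in> closure A" using xy(1) closure_subset by blast
        ultimately show "z \<in> F" using e(2) by blast
      qed
      then have eq: "indicator (K w) x * (indicator F x * f x) = indicator (K w) x * f x" for x
        by (auto simp: indicator_def)
      show ?thesis unfolding cell_avg_eq eq ..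
    qed
    then show "scaled_energy p N (meeting N (\<Union>x\<in>A. ball x s)) (\<lambda>x. indicator F x * f x)
       = scaled_energy p N (meeting N (\<Union>x\<in>A. ball x s)) f"
      unfolding scaled_energy_def by (intro arg_cong2[where f = "(*)"] refl energy_cong)
  qed
  moreover have "(\<Union>x\<in>A. ball x (e / 2)) \<subseteq> F"
  proof -
    have "(\<Union>x\<in>A. ball x (e / 2)) \<subseteq> (\<Union>x\<in>closure A. ball x e)"
      using closure_subset e(1) by (intro UN_mono subset_ball) auto
    then show ?thesis using e(2) by blast
  qed
  ultimately show ?thesis using e(1) by (intro exI[of _ "e / 2"]) auto
qed

lemma liminf_frequently:
  assumes "liminf (\<lambda>N. ennreal (u N)) < ennreal t"
  shows "\<exists>\<^sub>F N in sequentially. u N \<le> t"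
proof (rule ccontr)
  assume "\<not> ?thesis"
  then have "\<forall>\<^sub>F N in sequentially. t \<le> u N" by (simp add: not_frequently not_le eventually_mono less_imp_le)
  then have "\<forall>\<^sub>F N in sequentially. ennreal t \<le> ennreal (u N)" by eventually_elim (rule ennreal_leI)
  then have "ennreal t \<le> liminf (\<lambda>N. ennreal (u N))" by (rule Liminf_bounded)
  then show False using assms by simp
qed

text \<open>For small \<open>r\<close> the estimate at radius \<open>r\<close> involves the limit inferior at radius \<open>R * r\<close>, and rescaling the
  radius does not change a limit superior at \<open>0\<close>. Over the whole space every level contributes its full energy.\<close>

theorem korevaar_schoen_bounds:
  "\<exists>C>0.
     (\<forall>A F f. A \<in> sets borel \<and> open F \<and> closure A \<subseteq> F \<and> in_Lp m p F f \<longrightarrow>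
        Limsup (at_right 0) (\<lambda>r. \<integral>\<^sup>+x\<in>A. ennreal (1 / measure m (ball x r)) *
            (\<integral>\<^sup>+y\<in>ball x r. ennreal (\<bar>f x - f y\<bar> powr p / r powr dw p) \<partial>m) \<partial>m)
        \<le> ennreal C * Limsup (at_right 0) (\<lambda>r. liminf (\<lambda>n. ennreal
            (scaled_energy p n (meeting n (\<Union>x\<in>A. ball x r)) f)))) \<and>
     (\<forall>f. in_Lp m p UNIV f \<longrightarrow>
        (SUP r\<in>{0<..}. \<integral>\<^sup>+x. ennreal (1 / measure m (ball x r)) *
            (\<integral>\<^sup>+y\<in>ball x r. ennreal (\<bar>f x - f y\<bar> powr p / r powr dw p) \<partial>m) \<partial>m)
        \<le> ennreal C * ennreal_powr (Np p f) p)"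
proof -
  define h where "h A f r = liminf (\<lambda>n. ennreal (scaled_energy p n (meeting n (\<Union>x\<in>A. ball x r)) f))" for A f r
  obtain C R where C: "0 < C" and R: "0 < R" and main: "\<And>r A f t. 0 < r \<Longrightarrow> integrable m f \<Longrightarrow>
     \<exists>\<^sub>F N in sequentially. scaled_energy p N (meeting N (\<Union>x\<in>A. ball x (R * r))) f \<le> t \<Longrightarrow>
     ball_energy A f r \<le> ennreal (C * t)"
  proof -
    obtain C R where C: "0 < C" "0 < R" and est: "\<forall>r>0. \<forall>A f t. integrable m f \<longrightarrow>
       (\<exists>\<^sub>F N in sequentially. scaled_energy p N (meeting N (\<Union>x\<in>A. ball x (R * r))) f \<le> t) \<longrightarrow> ball_energy A f r \<le> ennreal (C * t)"
      using ball_energy_estimate by (elim exE conjE) (rule that, assumption, assumption, assumption)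
    show ?thesis by (rule that[OF C]) (rule est[rule_format])
  qed
  have lim: "ball_energy A f r \<le> ennreal C * y" if r: "0 < r" and f: "integrable m f" and y: "h A f (R * r) < y" for A f r y
  proof (cases y)
    case (real t)
    have "\<exists>\<^sub>F N in sequentially. scaled_energy p N (meeting N (\<Union>x\<in>A. ball x (R * r))) f \<le> t"
      using y unfolding h_def real by (rule liminf_frequently)
    then have "ball_energy A f r \<le> ennreal (C * t)" using main r f by blast
    then show ?thesis using C real by (simp add: ennreal_mult)
  next
    case top
    then show ?thesis using C by (simp add: ennreal_mult_top)
  qed
  have mult_lim: "z \<le> ennreal C * x" if *: "\<And>y. x < y \<Longrightarrow> z \<le> ennreal C * y" for x z
  proof (cases x)
    case (real t)
    show ?thesis
    proof (rule ennreal_le_epsilon)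
      fix e :: real assume e: "0 < e"
      have "z \<le> ennreal C * ennreal (t + e / C)" using real e C by (intro *) (auto simp: ennreal_less_iff)
      also have "\<dots> = ennreal C * x + ennreal e"
        using real e C by (simp add: ennreal_mult[symmetric] ennreal_plus[symmetric] distrib_left del: ennreal_plus)
      finally show "z \<le> ennreal C * x + ennreal e" .
    qed
  next
    case top
    then show ?thesis using C by (simp add: ennreal_mult_top)
  qed
  have local: "Limsup (at_right 0) (ball_energy A f) \<le> ennreal C * Limsup (at_right 0) (h A f)"
    if F: "open F" "closure A \<subseteq> F" and f: "in_Lp m p F f" for A F f
  proof (rule mult_lim)
    fix y assume y: "Limsup (at_right 0) (h A f) < y"
    let ?g = "\<lambda>x. indicator F x * f x"
    obtain \<delta> where \<delta>: "0 < \<delta>" "(\<Union>x\<in>A. ball x \<delta>) \<subseteq> F"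
      and se: "\<And>s f. s \<le> \<delta> \<Longrightarrow> \<forall>\<^sub>F N in sequentially. scaled_energy p N (meeting N (\<Union>x\<in>A. ball x s)) (\<lambda>x. indicator F x * f x)
       = scaled_energy p N (meeting N (\<Union>x\<in>A. ball x s)) f"
    proof -
      obtain \<delta> where \<delta>: "0 < \<delta>" "(\<Union>x\<in>A. ball x \<delta>) \<subseteq> F" and se: "\<forall>s\<le>\<delta>. \<forall>f. \<forall>\<^sub>F N in sequentially.
          scaled_energy p N (meeting N (\<Union>x\<in>A. ball x s)) (\<lambda>x. indicator F x * f x)
            = scaled_energy p N (meeting N (\<Union>x\<in>A. ball x s)) f"
        using scaled_energy_restriction[OF F] by (elim exE conjE) (rule that, assumption, assumption, assumption)
      show ?thesis by (rule that[OF \<delta>]) (rule se[rule_format])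
    qed
    have hg: "h A ?g s = h A f s" if "s \<le> \<delta>" for s
      unfolding h_def by (rule Liminf_eq) (use se[OF that, of f] in eventually_elim, simp)
    have Ig: "ball_energy A ?g r = ball_energy A f r" if r: "r \<le> \<delta>" for r
    proof -
      have bF: "ball x r \<subseteq> F" if "x \<in> A" for x using \<delta>(2) subset_ball[OF r, of x] that by blast
      have xF: "x \<in> F" if "x \<in> A" for x using \<delta> that centre_in_ball[of x \<delta>] by blast
      have "(\<integral>\<^sup>+y\<in>ball x r. ennreal (\<bar>?g x - ?g y\<bar> powr p / r powr dw p) \<partial>m)
          = (\<integral>\<^sup>+y\<in>ball x r. ennreal (\<bar>f x - f y\<bar> powr p / r powr dw p) \<partial>m)" if x: "x \<in> A" for x
        using bF[OF x] xF[OF x] by (intro nn_integral_cong) (auto simp: indicator_def)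
      then show ?thesis unfolding ball_energy_def by (intro nn_integral_cong) (auto simp: indicator_def)
    qed
    have "\<forall>\<^sub>F r in at_right 0. h A f (R * r) < y"
      using eventually_at_right_scale[OF R Limsup_lessD[OF y]] .
    moreover have \<delta>ev: "\<forall>\<^sub>F r in at_right 0. r \<le> \<delta>"
      using \<delta>(1) by (auto simp: eventually_at_right[OF zero_less_one] intro!: exI[of _ \<delta>])
    moreover have "\<forall>\<^sub>F r in at_right 0. R * r \<le> \<delta>"
      by (rule eventually_at_right_scale[OF R \<delta>ev])
    moreover have "\<forall>\<^sub>F r in at_right (0::real). 0 < r" by (simp add: eventually_at_right_less)
    ultimately have "\<forall>\<^sub>F r in at_right 0. ball_energy A f r \<le> ennreal C * y"
    proof eventually_elim
      fix r assume r: "h A f (R * r) < y" "R * r \<le> \<delta>" "r \<le> \<delta>" "0 < r"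
      have "ball_energy A ?g r \<le> ennreal C * y"
        using r hg[of "R * r"] by (intro lim integrable_restriction[OF f]) auto
      then show "ball_energy A f r \<le> ennreal C * y" using Ig[OF r(3)] by simp
    qed
    then show "Limsup (at_right 0) (ball_energy A f) \<le> ennreal C * y" by (rule Limsup_bounded)
  qed
  have global: "ball_energy UNIV f r \<le> ennreal C * ennreal_powr (Np p f) p" if f: "in_Lp m p UNIV f" and r: "0 < r" for f r
  proof (rule mult_lim)
    fix y assume y: "ennreal_powr (Np p f) p < y"
    have "ennreal_powr (Np p f) p = (SUP n. ennreal (scaled_energy p n (level n) f))"
      unfolding Np_def using p by (intro ennreal_powr_inverse) simp
    moreover have "meeting n (\<Union>x\<in>UNIV. ball x (R * r)) = level n" for n
    proof -
      have U: "(\<Union>x\<in>UNIV. ball x (R * r)) = (UNIV :: 'a set)" 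
      proof (rule subset_antisym[OF subset_UNIV subsetI])
        fix x :: 'a
        have "x \<in> ball x (R * r)" using R r by simp
        then show "x \<in> (\<Union>x\<in>UNIV. ball x (R * r))" by blast
      qed
      show ?thesis unfolding U by (auto simp: meeting_def K_nonempty)
    qed
    ultimately have "h UNIV f (R * r) \<le> ennreal_powr (Np p f) p"
      unfolding h_def by (simp only:) (intro order_trans[OF Liminf_le_Limsup[OF sequentially_bot]] Limsup_bounded always_eventually allI SUP_upper UNIV_I)
    then show "ball_energy UNIV f r \<le> ennreal C * y"
      using y r integrable_restriction[OF f] by (intro lim) auto
  qed
  show ?thesis
  proof (intro exI[of _ C] conjI C allI impI)
    fix A F and f :: "'a \<Rightarrow> real"
    assume "A \<in> sets borel \<and> open F \<and> closure A \<subseteq> F \<and> in_Lp m p F f"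
    then show "Limsup (at_right 0) (\<lambda>r. \<integral>\<^sup>+x\<in>A. ennreal (1 / measure m (ball x r)) *
            (\<integral>\<^sup>+y\<in>ball x r. ennreal (\<bar>f x - f y\<bar> powr p / r powr dw p) \<partial>m) \<partial>m)
        \<le> ennreal C * Limsup (at_right 0) (\<lambda>r. liminf (\<lambda>n. ennreal
            (scaled_energy p n (meeting n (\<Union>x\<in>A. ball x r)) f)))"
      using local[of F A f] unfolding ball_energy_def[abs_def] h_def by blast
  next
    fix f assume f: "in_Lp m p UNIV f"
    show "(SUP r\<in>{0<..}. \<integral>\<^sup>+x. ennreal (1 / measure m (ball x r)) *
            (\<integral>\<^sup>+y\<in>ball x r. ennreal (\<bar>f x - f y\<bar> powr p / r powr dw p) \<partial>m) \<partial>m)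
        \<le> ennreal C * ennreal_powr (Np p f) p"
      using global[OF f] unfolding ball_energy_def by (intro SUP_least) simp
  qed
qed

end

theorem proposition5p23:
  fixes E :: "'t \<Rightarrow> 't \<Rightarrow> bool" and root :: 't
    and K :: "'t \<Rightarrow> 'a::metric_space set"
    and m :: "'a measure" and Mstar :: nat and rstar :: real and p :: real
  assumes "1 < p"
    and "basic_geometric_framework E root K m Mstar rstar"
    and "ahlfors_regular m"
    and "measured_tree_cells.conductively_homogeneous E root K m Mstar p"
    and "\<exists>C0>0. \<forall>x. \<forall>s\<in>{0<..1}.
       (INF f \<in> {f \<in> measured_tree_cells.Wp E root K m Mstar p. continuous_on UNIV f \<and>
                  (\<forall>y\<in>ball x s. f y = 1) \<and> closure {y. f y \<noteq> 0} \<subseteq> ball x (2 * s)}.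
          ennreal_powr (measured_tree_cells.Np E root K m Mstar p f) p)
       \<le> ennreal (C0 * s powr (measured_tree_cells.df m -
                               measured_tree_cells.dw E root K m Mstar rstar p))"
  shows "\<exists>C>0.
     (\<forall>A E' f. A \<in> sets borel \<and> open E' \<and> closure A \<subseteq> E' \<and> in_Lp m p E' f \<longrightarrow>
        Limsup (at_right 0) (\<lambda>r. \<integral>\<^sup>+x\<in>A. ennreal (1 / measure m (ball x r)) *
            (\<integral>\<^sup>+y\<in>ball x r. ennreal (\<bar>f x - f y\<bar> powr p /
                r powr measured_tree_cells.dw E root K m Mstar rstar p) \<partial>m) \<partial>m)
        \<le> ennreal C * Limsup (at_right 0) (\<lambda>r. liminf (\<lambda>n. ennreal
            (measured_tree_cells.scaled_energy E root K m Mstar p n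
              (tree_cells.meeting E root K n (\<Union>x\<in>A. ball x r)) f)))) \<and>
     (\<forall>f. in_Lp m p UNIV f \<longrightarrow>
        (SUP r\<in>{0<..}. \<integral>\<^sup>+x. ennreal (1 / measure m (ball x r)) *
            (\<integral>\<^sup>+y\<in>ball x r. ennreal (\<bar>f x - f y\<bar> powr p /
                r powr measured_tree_cells.dw E root K m Mstar rstar p) \<partial>m) \<partial>m)
        \<le> ennreal C * ennreal_powr (measured_tree_cells.Np E root K m Mstar p f) p)"
proof -
  interpret basic_geometric_framework E root K m Mstar rstar by fact
  obtain Q CA where Q: "0 < Q" "1 \<le> CA" and reg: "\<And>x s. 0 < s \<Longrightarrow> s < 2 \<Longrightarrow>
     s powr Q / CA \<le> measure m (ball x s) \<and> measure m (ball x s) \<le> CA * s powr Q"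
    using assms(3) unfolding ahlfors_regular_def diameter_space by auto
  obtain \<J> where J: "covering_system \<J>" "(SUP k. sigma_sys \<J> p k * cap_const Mstar p k) < \<infinity>"
    using assms(4) unfolding conductively_homogeneous_def by blast
  interpret homogeneous_framework E root K m Mstar rstar Q CA p \<J>
    by unfold_locales (fact Q reg assms(1) J)+
  show ?thesis by (rule korevaar_schoen_bounds)
qed

end
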